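(* For each $x\in\mathcal{BT}(\mathbb Q)$, the inverse image $\lambda^{-1}(x)$ is an open affinoid subspace of $\Omega^r$ that satisfies the absolute value property AVP, i.e. every invertible holomorphic function on $\lambda^{-1}(x)$ has constant absolute value on $\lambda^{-1}(x)$.
   Context: Let $q$ be a prime power, $K_\infty=\mathbb F_q((T^{-1}))$ with absolute value normalized by $|T|=q$, $C_\infty$ the completion of an algebraic closure of $K_\infty$. Fix $r\ge2$. $\Omega^r$ is the rigid analytic space of points $\omega=(\omega_1:\dots:\omega_r)\in\mathbb P^{r-1}(C_\infty)$ with $\omega_1,\dots,\omega_r$ linearly independent over $K_\infty$. $\mathcal{BT}$ is the Bruhat–Tits building of $\mathrm{PGL}(r,K_\infty)$; its realization is identified with the set of homothety classes of non-archimedean real-valued norms on $K_\infty^r$, and $\mathcal{BT}(\mathbb Q)$ denotes its points with rational barycentric coordinates. The building map $\lambda:\Omega^r\to\mathcal{BT}(\mathbb Q)$ sends $\omega$ to the class of the norm $(x_1,\dots,x_r)\mapsto|\sum_i x_i\omega_i|$. *)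

theory Defs
  imports "HOL-Analysis.Analysis" "HOL-Computational_Algebra.Computational_Algebra"
begin

section \<open>The fields\<close>

text \<open>For a finite field \<open>'k\<close> with \<open>q\<close> elements, \<open>K\<^sub>\<infinity>\<close> is the type \<open>'k fls\<close>, where the
  Laurent series variable \<^term>\<open>fls_X\<close> is the uniformizer \<open>1/T\<close>; hence \<open>|T| = q\<close>. (The library
  metric on \<open>fls\<close> uses base 2 and is not used.)\<close>

definition abs_inf :: "'k::{field,finite} fls \<Rightarrow> real" where
  "abs_inf f = (if f = 0 then 0 else real CARD('k) powi (- fls_subdegree f))"

class nonarch_field = field + metric_space +
  fixes abs_val :: "'a \<Rightarrow> real"
  assumes dist_eq_abs_val: "dist x y = abs_val (x - y)"
    and abs_val_mult: "abs_val (x * y) = abs_val x * abs_val y"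
    and abs_val_add_le_max: "abs_val (x + y) \<le> max (abs_val x) (abs_val y)"

text \<open>\<open>C\<^sub>\<infinity>\<close> is specified by what a completion of an algebraic closure of \<open>K\<^sub>\<infinity>\<close> is: a complete
  valued field \<open>'c\<close> with an isometric embedding \<open>\<iota>\<close> of \<open>K\<^sub>\<infinity>\<close>, in which the elements algebraic
  over \<open>K\<^sub>\<infinity>\<close> form an algebraically closed field (an algebraic closure of \<open>K\<^sub>\<infinity>\<close>) that is
  dense. This determines \<open>('c, \<iota>)\<close> up to isometric isomorphism.\<close>

definition algebraic_over :: "('k::field \<Rightarrow> 'c::field) \<Rightarrow> 'c set" where
  "algebraic_over \<iota> = {x. \<exists>p. p \<noteq> 0 \<and> poly (map_poly \<iota> p) x = 0}"

definition completed_algebraic_closure :: "('k::{field,finite} fls \<Rightarrow> 'c::nonarch_field) \<Rightarrow> bool" where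
  "completed_algebraic_closure \<iota> \<longleftrightarrow>
     \<iota> 1 = 1 \<and> (\<forall>f g. \<iota> (f + g) = \<iota> f + \<iota> g) \<and> (\<forall>f g. \<iota> (f * g) = \<iota> f * \<iota> g) \<and>
     (\<forall>f. abs_val (\<iota> f) = abs_inf f) \<and>
     (\<forall>p. degree p > 0 \<and> (\<forall>i. coeff p i \<in> algebraic_over \<iota>) \<longrightarrow>
          (\<exists>x\<in>algebraic_over \<iota>. poly p x = 0)) \<and>
     closure (algebraic_over \<iota>) = UNIV \<and>
     complete (UNIV :: 'c set)"


section \<open>Norms on \<open>K\<^sub>\<infinity>\<^sup>r\<close> and the Bruhat-Tits building\<close>

text \<open>Vectors of length \<open>r\<close> are sequences that vanish from index \<open>r\<close> on.\<close>

definition vec :: "nat \<Rightarrow> (nat \<Rightarrow> 'a::zero) set" where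
  "vec r = {x. \<forall>i\<ge>r. x i = 0}"

definition nonarch_norm :: "nat \<Rightarrow> ((nat \<Rightarrow> 'k::{field,finite} fls) \<Rightarrow> real) \<Rightarrow> bool" where
  "nonarch_norm r N \<longleftrightarrow>
     (\<forall>x\<in>vec r. 0 \<le> N x \<and> (N x = 0 \<longleftrightarrow> x = (\<lambda>_. 0))) \<and>
     (\<forall>c. \<forall>x\<in>vec r. N (\<lambda>i. c * x i) = abs_inf c * N x) \<and>
     (\<forall>x\<in>vec r. \<forall>y\<in>vec r. N (\<lambda>i. x i + y i) \<le> max (N x) (N y))"

text \<open>Only values on \<^term>\<open>vec r\<close> matter; the members of a class are arbitrary elsewhere.\<close>

definition homothety_class ::
  "nat \<Rightarrow> ((nat \<Rightarrow> 'k::{field,finite} fls) \<Rightarrow> real) \<Rightarrow> ((nat \<Rightarrow> 'k fls) \<Rightarrow> real) set" where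
  "homothety_class r N = {M. \<exists>c>0. \<forall>x\<in>vec r. M x = c * N x}"

definition BT :: "nat \<Rightarrow> ((nat \<Rightarrow> 'k::{field,finite} fls) \<Rightarrow> real) set set" where
  "BT r = {homothety_class r N | N. nonarch_norm r N}"

definition O_lattice :: "nat \<Rightarrow> (nat \<Rightarrow> 'k::{field,finite} fls) set \<Rightarrow> bool" where
  "O_lattice r L \<longleftrightarrow> (\<exists>b. (\<forall>j<r. b j \<in> vec r) \<and>
     (\<forall>c. (\<lambda>i. \<Sum>j<r. c j * b j i) = (\<lambda>_. 0) \<longrightarrow> (\<forall>j<r. c j = 0)) \<and>
     L = {(\<lambda>i. \<Sum>j<r. c j * b j i) | c. \<forall>j<r. abs_inf (c j) \<le> 1})"

text \<open>The norm with unit ball \<open>L\<close>; its class is the vertex of the building given by \<open>L\<close>.\<close>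

definition lattice_norm ::
  "(nat \<Rightarrow> 'k::{field,finite} fls) set \<Rightarrow> (nat \<Rightarrow> 'k fls) \<Rightarrow> real" where
  "lattice_norm L v = Inf {abs_inf c | c. \<exists>w\<in>L. v = (\<lambda>i. c * w i)}"

text \<open>A \<open>k\<close>-simplex is given by lattices \<open>L\<^sub>0 \<supset> \<dots> \<supset> L\<^sub>k \<supset> \<pi> L\<^sub>0\<close>, with \<open>\<pi> = 1/T\<close>.\<close>

definition bt_simplex :: "nat \<Rightarrow> nat \<Rightarrow> (nat \<Rightarrow> (nat \<Rightarrow> 'k::{field,finite} fls) set) \<Rightarrow> bool" where
  "bt_simplex r k L \<longleftrightarrow> (\<forall>i\<le>k. O_lattice r (L i)) \<and> (\<forall>i<k. L (Suc i) \<subset> L i) \<and>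
     (\<lambda>w i. fls_X * w i) ` L 0 \<subset> L k"

text \<open>The point of a simplex with barycentric coordinates \<open>t\<^sub>0, \<dots>, t\<^sub>k\<close>. The identification of the
  realization with classes of norms is affine in the logarithms of the values on a basis
  \<open>(e\<^sub>j)\<close> adapted to all \<open>L\<^sub>i\<close>: the norm is \<open>\<Sum> x\<^sub>j e\<^sub>j \<mapsto> max\<^sub>j |x\<^sub>j| \<Prod>\<^sub>i \<parallel>e\<^sub>j\<parallel>\<^sub>i powr t\<^sub>i\<close>, where
  \<open>\<parallel>\<cdot>\<parallel>\<^sub>i\<close> is the norm of \<open>L\<^sub>i\<close>. Since the \<open>L\<^sub>i\<close> form a chain, for every vector some \<open>j\<close> attains the
  maximum in all \<open>\<parallel>\<cdot>\<parallel>\<^sub>i\<close> simultaneously, so this equals the basis-free product below.\<close>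

definition bt_point ::
  "nat \<Rightarrow> nat \<Rightarrow> (nat \<Rightarrow> (nat \<Rightarrow> 'k::{field,finite} fls) set) \<Rightarrow> (nat \<Rightarrow> real) \<Rightarrow>
   ((nat \<Rightarrow> 'k fls) \<Rightarrow> real) set" where
  "bt_point r k L t = homothety_class r (\<lambda>v. \<Prod>i\<le>k. lattice_norm (L i) v powr t i)"

definition BT_rat :: "nat \<Rightarrow> ((nat \<Rightarrow> 'k::{field,finite} fls) \<Rightarrow> real) set set" where
  "BT_rat r = {x \<in> BT r. \<exists>k L t. bt_simplex r k L \<and> (\<forall>i\<le>k. t i \<in> \<rat> \<and> t i \<ge> 0) \<and>
     (\<Sum>i\<le>k. t i) = 1 \<and> x = bt_point r k L t}"


section \<open>The space \<open>\<Omega>\<^sup>r\<close> and the building map\<close>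

definition proj_point :: "(nat \<Rightarrow> 'c::field) \<Rightarrow> (nat \<Rightarrow> 'c) set" where
  "proj_point \<omega> = {(\<lambda>i. c * \<omega> i) | c. c \<noteq> 0}"

definition Omega ::
  "('k::{field,finite} fls \<Rightarrow> 'c::nonarch_field) \<Rightarrow> nat \<Rightarrow> (nat \<Rightarrow> 'c) set set" where
  "Omega \<iota> r = {proj_point \<omega> | \<omega>. \<omega> \<in> vec r \<and>
     (\<forall>x\<in>vec r. (\<Sum>i<r. \<iota> (x i) * \<omega> i) = 0 \<longrightarrow> x = (\<lambda>_. 0))}"

text \<open>All representatives of a point give the same class, so the union is over a constant
  family.\<close>

definition building_map ::
  "('k::{field,finite} fls \<Rightarrow> 'c::nonarch_field) \<Rightarrow> nat \<Rightarrow> (nat \<Rightarrow> 'c) set \<Rightarrow>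
   ((nat \<Rightarrow> 'k fls) \<Rightarrow> real) set" where
  "building_map \<iota> r P = (\<Union>\<omega>\<in>P. homothety_class r (\<lambda>x. abs_val (\<Sum>i<r. \<iota> (x i) * \<omega> i)))"


section \<open>Affinoid varieties\<close>

text \<open>All spaces here are reduced and the base field is algebraically closed, so an affinoid
  variety is given by its set of points together with its algebra, viewed as an algebra of functions
  on the points (Nullstellensatz). Algebras of functions on \<open>X\<close> consist of total functions,
  and membership depends only on the values on \<open>X\<close>.\<close>

definition multi_indices :: "nat \<Rightarrow> (nat \<Rightarrow> nat) set" where
  "multi_indices n = {\<alpha>. \<forall>i\<ge>n. \<alpha> i = 0}"

definition polydisc :: "nat \<Rightarrow> (nat \<Rightarrow> 'c::nonarch_field) set" where
  "polydisc n = {z \<in> vec n. \<forall>i<n. abs_val (z i) \<le> 1}"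

text \<open>The Tate algebra \<open>C\<^sub>\<infinity>\<langle>Z\<^sub>0, \<dots>, Z\<^sub>n\<^sub>-\<^sub>1\<rangle>\<close>.\<close>

definition tate_algebra :: "nat \<Rightarrow> ((nat \<Rightarrow> 'c::nonarch_field) \<Rightarrow> 'c) set" where
  "tate_algebra n = {f. \<exists>a. (\<forall>\<epsilon>>0. finite {\<alpha> \<in> multi_indices n. abs_val (a \<alpha>) \<ge> \<epsilon>}) \<and>
     (\<forall>z\<in>polydisc n. ((\<lambda>\<alpha>. a \<alpha> * (\<Prod>i<n. z i ^ \<alpha> i)) has_sum f z) (multi_indices n))}"

text \<open>\<open>(X, A)\<close> is isomorphic to a Zariski closed subvariety \<open>Z\<close> of a polydisc.\<close>

definition affinoid :: "'p set \<Rightarrow> ('p \<Rightarrow> 'c::nonarch_field) set \<Rightarrow> bool" where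
  "affinoid X A \<longleftrightarrow> (\<exists>n S \<phi>. S \<subseteq> tate_algebra n \<and>
     bij_betw \<phi> X {z \<in> polydisc n. \<forall>g\<in>S. g z = 0} \<and>
     A = {f. \<exists>g\<in>tate_algebra n. \<forall>x\<in>X. f x = g (\<phi> x)})"

text \<open>The algebra \<open>A\<langle>f\<^sub>0/h, \<dots>, f\<^sub>m\<^sub>-\<^sub>1/h\<rangle>\<close>: its elements are the series in the \<open>f\<^sub>j/h\<close> with
  coefficients in \<open>A\<close> tending to \<open>0\<close> (\<open>A\<close> is reduced, so its Banach topology is given by the
  supremum norm on \<open>X\<close>).\<close>

definition rational_algebra ::
  "'p set \<Rightarrow> ('p \<Rightarrow> 'c::nonarch_field) set \<Rightarrow> 'p set \<Rightarrow> nat \<Rightarrow> ('p \<Rightarrow> 'c) \<Rightarrow> (nat \<Rightarrow> 'p \<Rightarrow> 'c) \<Rightarrow>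
   ('p \<Rightarrow> 'c) set" where
  "rational_algebra X A R m h f = {u. \<exists>a. (\<forall>\<alpha>\<in>multi_indices m. a \<alpha> \<in> A) \<and>
     (\<forall>\<epsilon>>0. finite {\<alpha> \<in> multi_indices m. \<exists>x\<in>X. abs_val (a \<alpha> x) \<ge> \<epsilon>}) \<and>
     (\<forall>x\<in>R. ((\<lambda>\<alpha>. a \<alpha> x * (\<Prod>j<m. (f j x / h x) ^ \<alpha> j)) has_sum u x) (multi_indices m))}"

text \<open>\<open>R\<close> is a rational subdomain of \<open>(X, A)\<close> with algebra \<open>B\<close>: it is defined by the inequalities
  \<open>|f\<^sub>j| \<le> |h|\<close>, where \<open>h, f\<^sub>0, \<dots>, f\<^sub>m\<^sub>-\<^sub>1\<close> generate the unit ideal of \<open>A\<close>.\<close>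

definition rational_subdomain ::
  "'p set \<Rightarrow> ('p \<Rightarrow> 'c::nonarch_field) set \<Rightarrow> 'p set \<Rightarrow> ('p \<Rightarrow> 'c) set \<Rightarrow> bool" where
  "rational_subdomain X A R B \<longleftrightarrow> (\<exists>m h f. h \<in> A \<and> (\<forall>j<m. f j \<in> A) \<and>
     (\<exists>u c. u \<in> A \<and> (\<forall>j<m. c j \<in> A) \<and> (\<forall>x\<in>X. u x * h x + (\<Sum>j<m. c j x * f j x) = 1)) \<and>
     R = {x \<in> X. \<forall>j<m. abs_val (f j x) \<le> abs_val (h x)} \<and>
     B = rational_algebra X A R m h f)"


section \<open>Open affinoid subspaces and holomorphic functions\<close>

text \<open>A rigid analytic structure is given by a set \<open>\<A>\<close> of affinoid charts \<open>(X, A)\<close>.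
  For projective space these are the polydiscs where the \<open>i\<close>-th homogeneous coordinate has the
  largest absolute value, with the coordinates \<open>\<omega>\<^sub>j/\<omega>\<^sub>i\<close>; the constant coordinate
  \<open>\<omega>\<^sub>i/\<omega>\<^sub>i = 1\<close> is kept to avoid renumbering.\<close>

definition proj_chart :: "nat \<Rightarrow> nat \<Rightarrow> (nat \<Rightarrow> 'c::nonarch_field) set set" where
  "proj_chart r i = {proj_point \<omega> | \<omega>. \<omega> \<in> polydisc r \<and> \<omega> i = 1}"

definition proj_chart_algebra ::
  "nat \<Rightarrow> nat \<Rightarrow> ((nat \<Rightarrow> 'c::nonarch_field) set \<Rightarrow> 'c) set" where
  "proj_chart_algebra r i =
     {f. \<exists>g\<in>tate_algebra r. \<forall>\<omega>\<in>polydisc r. \<omega> i = 1 \<longrightarrow> f (proj_point \<omega>) = g \<omega>}"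

definition proj_atlas ::
  "nat \<Rightarrow> ((nat \<Rightarrow> 'c::nonarch_field) set set \<times> ((nat \<Rightarrow> 'c) set \<Rightarrow> 'c) set) set" where
  "proj_atlas r = {(proj_chart r i, proj_chart_algebra r i) | i. i < r}"

text \<open>\<open>U\<close> is an open affinoid subspace if it carries an affinoid structure \<open>(U, A)\<close> for which the
  inclusion is an open immersion: the intersection of \<open>U\<close> with every chart is a finite union
  of sets that are rational subdomains both of \<open>U\<close> and of the chart, with the same
  algebra of functions. (For a separated space with a finite atlas, such as projective space, the
  intersection of two open affinoids is an affinoid subdomain of both, hence by the
  theorem of Gerritzen and Grauert a finite union of such sets.)\<close>

definition open_affinoid_subspace ::
  "('p set \<times> ('p \<Rightarrow> 'c::nonarch_field) set) set \<Rightarrow> 'p set \<Rightarrow> bool" where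
  "open_affinoid_subspace \<A> U \<longleftrightarrow> U \<subseteq> \<Union> (fst ` \<A>) \<and> (\<exists>A. affinoid U A \<and>
     (\<forall>(X, A')\<in>\<A>. \<exists>\<R>. finite \<R> \<and> \<Union> \<R> = U \<inter> X \<and>
        (\<forall>R\<in>\<R>. \<exists>B. rational_subdomain U A R B \<and> rational_subdomain X A' R B)))"

text \<open>The sections over \<open>U\<close> of the structure sheaf.\<close>

definition holomorphic_functions ::
  "('p set \<times> ('p \<Rightarrow> 'c::nonarch_field) set) set \<Rightarrow> 'p set \<Rightarrow> ('p \<Rightarrow> 'c) set" where
  "holomorphic_functions \<A> U =
     {f. \<forall>(X, A')\<in>\<A>. \<forall>R B. rational_subdomain X A' R B \<and> R \<subseteq> U \<longrightarrow> f \<in> B}"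

definition absolute_value_property ::
  "('p set \<times> ('p \<Rightarrow> 'c::nonarch_field) set) set \<Rightarrow> 'p set \<Rightarrow> bool" where
  "absolute_value_property \<A> U \<longleftrightarrow>
     (\<forall>f\<in>holomorphic_functions \<A> U.
        (\<exists>g\<in>holomorphic_functions \<A> U. \<forall>x\<in>U. f x * g x = 1) \<longrightarrow>
        (\<exists>c. \<forall>x\<in>U. abs_val (f x) = c))"

text \<open>\<open>\<Omega>\<^sup>r\<close> is an admissible open subspace of projective space, so its open affinoid subspaces and
  their holomorphic functions are those of projective space that are contained in it.\<close>

definition open_affinoid_subspace_of_Omega ::
  "('k::{field,finite} fls \<Rightarrow> 'c::nonarch_field) \<Rightarrow> nat \<Rightarrow> (nat \<Rightarrow> 'c) set set \<Rightarrow> bool" where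
  "open_affinoid_subspace_of_Omega \<iota> r U \<longleftrightarrow>
     U \<subseteq> Omega \<iota> r \<and> open_affinoid_subspace (proj_atlas r) U"

end

theory Submission
  imports Defs
begin

text \<open>After a choice of an orthogonal basis of the norm \<open>x\<close>, a point of the fibre is a point \<open>z\<close> of the
  unit polydisc on which finitely many linear forms of Gauss norm \<open>1\<close> have absolute value \<open>1\<close>: a vector
  with integral coordinates is determined up to smaller terms by its reduction, and \<open>F\<^sub>q\<^sup>r\<close> is finite.
  So with \<open>P\<close> the product of these forms the fibre is the affinoid \<open>{|P| = 1}\<close>, with coordinates \<open>z\<close> and
  \<open>1/P\<close>. As the residue field is infinite, finitely many polynomials attain their Gauss norms at a common
  point of it. Hence the supremum norm of \<open>Q(z)/P\<^sup>k\<close> is the Gauss norm of \<open>Q\<close>. This makes the algebra of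
  Tate series in \<open>z\<close> and \<open>1/P\<close> the uniform closure of the functions \<open>Q(z)/P\<^sup>k\<close>, a description that does not
  depend on the chart, and makes the supremum norm multiplicative, which gives AVP: if \<open>fg = 1\<close>, then
  \<open>|f(x)| \<le> \<parallel>f\<parallel>\<close> and \<open>|g(x)| \<le> \<parallel>g\<parallel>\<close> are equalities.\<close>

section \<open>Non-archimedean fields\<close>

text \<open>Rationality of the point enters twice. The values of the norm lie in q^(Z/D), which
  accumulates only at 0, so the minima that define an orthogonal basis are attained. The same values
  are absolute values of elements of \<open>'c\<close>, because powers of T have D-th roots there;
  so the basis forms can be rescaled to Gauss norm 1. Over the base field only powers of q are
  available for rescaling, hence the window 1 <= M(e_j) < q. It is what makes reduction work:
  passing to constant terms leaves an error in each coordinate of size at most 1/q, and M(e_j)/q <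
  1, while the reduced vector has norm at least 1. Points are projective, whereas z and P depend on
  the representative. The i-th homogeneous coordinate is therefore fixed to a constant of the right
  absolute value. For this rescaling to be by an invertible function, the forms of the standard
  basis vectors are included among the factors of P. The ratios of the homogeneous coordinates have
  constant absolute values on the fibre. So each standard chart contains the fibre or misses it, and
  no gluing occurs.\<close>

lemma abs_val_0 [simp]: "abs_val (0::'c::nonarch_field) = 0"
  using dist_eq_abs_val[of "0::'c" 0] by simp

lemma abs_val_eq_0_iff [simp]: "abs_val (x::'c::nonarch_field) = 0 \<longleftrightarrow> x = 0"
  by (metis diff_zero dist_eq_0_iff dist_eq_abs_val)

lemma abs_val_nonneg [simp]: "0 \<le> abs_val (x::'c::nonarch_field)"
  using dist_eq_abs_val[of x 0] by (metis diff_zero zero_le_dist)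

lemma abs_val_pos_iff [simp]: "0 < abs_val (x::'c::nonarch_field) \<longleftrightarrow> x \<noteq> 0"
  by (metis abs_val_eq_0_iff abs_val_nonneg less_eq_real_def less_irrefl)

lemma abs_val_1 [simp]: "abs_val (1::'c::nonarch_field) = 1"
  using abs_val_mult[of "1::'c" 1] by simp

lemma abs_val_minus [simp]: "abs_val (- x) = abs_val (x::'c::nonarch_field)"
  using dist_eq_abs_val[of x 0] dist_eq_abs_val[of 0 x] by (simp add: dist_commute)

lemma abs_val_diff_commute: "abs_val (x - y) = abs_val (y - (x::'c::nonarch_field))"
  using dist_eq_abs_val[of x y] dist_eq_abs_val[of y x] by (simp add: dist_commute)

lemma abs_val_diff_le_max: "abs_val (x - y) \<le> max (abs_val x) (abs_val (y::'c::nonarch_field))"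
  using abs_val_add_le_max[of x "- y"] by simp

lemma abs_val_add_le: "abs_val x \<le> b \<Longrightarrow> abs_val y \<le> b \<Longrightarrow> abs_val (x + y :: 'c::nonarch_field) \<le> b"
  using abs_val_add_le_max[of x y] by simp

lemma abs_val_diff_le: "abs_val x \<le> b \<Longrightarrow> abs_val y \<le> b \<Longrightarrow> abs_val (x - y :: 'c::nonarch_field) \<le> b"
  using abs_val_diff_le_max[of x y] by simp

lemma abs_val_diff_less: "abs_val x < b \<Longrightarrow> abs_val y < b \<Longrightarrow> abs_val (x - y :: 'c::nonarch_field) < b"
  using abs_val_diff_le_max[of x y] by simp

lemma abs_val_diff_trans:
  "abs_val (x - y) \<le> b \<Longrightarrow> abs_val (y - z) \<le> b \<Longrightarrow> abs_val (x - z :: 'c::nonarch_field) \<le> b"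
  using abs_val_add_le[of "x - y" b "y - z"] by simp

text \<open>The ultrametric inequality for x = (x - y) + y gives |x| <= |y|; for y = x - (x - y) it
  gives |y| <= |x|, since |x - y| is too small to bound |y|.\<close>

lemma abs_val_eqI: "abs_val (x - y) < abs_val y \<Longrightarrow> abs_val x = abs_val (y::'c::nonarch_field)"
  using abs_val_add_le_max[of "x - y" y] abs_val_diff_le_max[of x "x - y"] by auto

lemma abs_val_add_eq: "abs_val y < abs_val x \<Longrightarrow> abs_val (x + y) = abs_val (x::'c::nonarch_field)"
  by (rule abs_val_eqI) simp

lemma abs_val_sum_le:
  assumes "\<And>i. i \<in> A \<Longrightarrow> abs_val (f i :: 'c::nonarch_field) \<le> b" "0 \<le> b"
  shows "abs_val (sum f A) \<le> b"
  using assms by (induction A rule: infinite_finite_induct) (auto intro: abs_val_add_le)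

lemma abs_val_power: "abs_val (x ^ n) = abs_val (x::'c::nonarch_field) ^ n"
  by (induction n) (auto simp: abs_val_mult)

lemma abs_val_prod: "abs_val (prod f A) = (\<Prod>i\<in>A. abs_val (f i :: 'c::nonarch_field))"
  by (induction A rule: infinite_finite_induct) (auto simp: abs_val_mult)

lemma abs_val_inverse: "abs_val (inverse x) = inverse (abs_val (x::'c::nonarch_field))"
proof (cases "x = 0")
  case False
  have "abs_val x * abs_val (inverse x) = 1"
    using False by (simp flip: abs_val_mult)
  then show ?thesis by (metis inverse_unique)
qed auto

lemma abs_val_divide: "abs_val (x / y) = abs_val x / abs_val (y::'c::nonarch_field)"
  by (simp add: divide_inverse abs_val_mult abs_val_inverse)

text \<open>Ultrametric errors do not accumulate: all terms after the k-th stay within 1 / 2^k of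
  it, and this non-strict bound passes to the limit.\<close>

lemma complete_nonarchD:
  fixes u :: "nat \<Rightarrow> 'c::nonarch_field"
  assumes "complete (UNIV :: 'c set)"
    and step: "\<And>k. abs_val (u (Suc k) - u k) \<le> 1 / 2 ^ k"
  shows "\<exists>l. \<forall>k. abs_val (l - u k) \<le> 1 / 2 ^ k"
proof -
  have *: "abs_val (u (k + m) - u k) \<le> 1 / 2 ^ k" for k m
  proof (induction m)
    case (Suc m)
    have "(2::real) ^ k \<le> 2 ^ (k + m)" by (intro power_increasing) auto
    then have "abs_val (u (Suc (k + m)) - u (k + m)) \<le> 1 / 2 ^ k"
      by (intro order.trans[OF step]) (simp add: frac_le)
    then show ?case
      using Suc abs_val_diff_trans by simp blast
  qed simp
  have "Cauchy u"
  proof (rule metric_CauchyI)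
    fix \<epsilon> :: real assume "\<epsilon> > 0"
    then obtain k where k: "(1/2) ^ k < \<epsilon>" using real_arch_pow_inv[of \<epsilon> "1/2"] by auto
    have "dist (u m) (u n) < \<epsilon>" if "m \<ge> k" "n \<ge> k" for m n
    proof -
      have "abs_val (u m - u k) \<le> 1 / 2 ^ k" "abs_val (u k - u n) \<le> 1 / 2 ^ k"
        using *[of k "m - k"] *[of k "n - k"] that by (auto simp: abs_val_diff_commute)
      then have "abs_val (u m - u n) \<le> 1 / 2 ^ k" by (rule abs_val_diff_trans)
      with k show ?thesis by (simp add: dist_eq_abs_val power_one_over)
    qed
    then show "\<exists>M. \<forall>m\<ge>M. \<forall>n\<ge>M. dist (u m) (u n) < \<epsilon>" by blast
  qed
  then obtain l where l: "u \<longlonglongrightarrow> l"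
    using assms(1) unfolding complete_def by auto
  have "abs_val (l - u k) \<le> 1 / 2 ^ k" for k
  proof -
    have "(\<lambda>m. dist (u m) (u k)) \<longlonglongrightarrow> dist l (u k)" using l by (intro tendsto_intros)
    moreover have "\<forall>\<^sub>F m in sequentially. dist (u m) (u k) \<le> 1 / 2 ^ k"
      unfolding dist_eq_abs_val
      by (rule eventually_sequentiallyI[of k]) (use *[of k] le_add_diff_inverse in metis)
    ultimately show ?thesis
      by (metis dist_eq_abs_val tendsto_upperbound sequentially_bot)
  qed
  then show ?thesis by blast
qed

text \<open>However many terms the tail has, its size is at most that of its largest term; compare
  with a finite sum over G \<union> F that is already \<epsilon>-close to s.\<close>

lemma has_sum_approx:
  fixes t :: "'i \<Rightarrow> 'c::nonarch_field"
  assumes "(t has_sum s) I" "finite F" "F \<subseteq> I" "\<And>i. i \<in> I - F \<Longrightarrow> abs_val (t i) \<le> \<epsilon>" "\<epsilon> > 0"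
  shows "abs_val (s - sum t F) \<le> \<epsilon>"
proof -
  have "\<forall>\<^sub>F G in finite_subsets_at_top I. dist (sum t G) s < \<epsilon>"
    using assms(1,5) unfolding has_sum_def by (rule tendstoD)
  then obtain G where G: "finite G" "G \<subseteq> I" "\<And>Y. finite Y \<Longrightarrow> G \<subseteq> Y \<Longrightarrow> Y \<subseteq> I \<Longrightarrow> dist (sum t Y) s < \<epsilon>"
    unfolding eventually_finite_subsets_at_top by auto
  have "abs_val (sum t (G \<union> F) - s) \<le> \<epsilon>"
    using G(3)[of "G \<union> F"] G(1,2) assms(2,3) by (simp add: dist_eq_abs_val less_imp_le)
  moreover have "sum t (G \<union> F) = sum t F + sum t (G - F)"
    using G(1) assms(2) sum.union_disjoint[of F "G - F" t] by (simp add: Un_commute)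
  moreover have "abs_val (sum t (G - F)) \<le> \<epsilon>"
    using assms(4,5) G(2) by (intro abs_val_sum_le) auto
  ultimately show ?thesis
    using abs_val_diff_trans[of s "sum t (G \<union> F)" \<epsilon> "sum t F"] by (simp add: abs_val_diff_commute)
qed

lemma has_sum_nonarchI:
  fixes t :: "'i \<Rightarrow> 'c::nonarch_field"
  assumes "\<And>\<epsilon>. \<epsilon> > 0 \<Longrightarrow> \<exists>F. finite F \<and> F \<subseteq> I \<and>
      (\<forall>G. finite G \<and> F \<subseteq> G \<and> G \<subseteq> I \<longrightarrow> abs_val (s - sum t G) < \<epsilon>)"
  shows "(t has_sum s) I"
  unfolding has_sum_def
proof (rule tendstoI)
  fix \<epsilon> :: real assume "\<epsilon> > 0"
  then show "\<forall>\<^sub>F G in finite_subsets_at_top I. dist (sum t G) s < \<epsilon>"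
    using assms[of \<epsilon>] unfolding eventually_finite_subsets_at_top
    by (metis abs_val_diff_commute dist_eq_abs_val)
qed


section \<open>Polynomial functions and Tate series\<close>

abbreviation mpow :: "nat \<Rightarrow> (nat \<Rightarrow> 'c::comm_monoid_mult) \<Rightarrow> (nat \<Rightarrow> nat) \<Rightarrow> 'c" where
  "mpow n z \<alpha> \<equiv> (\<Prod>i<n. z i ^ \<alpha> i)"

lemma abs_val_mpow_le: "z \<in> polydisc n \<Longrightarrow> abs_val (mpow n z \<alpha>) \<le> 1"
  unfolding abs_val_prod abs_val_power polydisc_def by (intro prod_le_1) (auto intro: power_le_one)

lemma abs_val_term_le:
  assumes "abs_val c \<le> b" "z \<in> polydisc n"
  shows "abs_val (c * mpow n z \<alpha>) \<le> b"
  using assms mult_mono[of "abs_val c" b "abs_val (mpow n z \<alpha>)" 1] abs_val_mpow_le[of z n \<alpha>]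
  by (auto simp: abs_val_mult intro: order.trans[OF abs_val_nonneg])

definition polyfun :: "nat \<Rightarrow> ((nat \<Rightarrow> 'c::nonarch_field) \<Rightarrow> 'c) set" where
  "polyfun n = {f. \<exists>c S. finite S \<and> S \<subseteq> multi_indices n \<and> f = (\<lambda>z. \<Sum>\<alpha>\<in>S. c \<alpha> * mpow n z \<alpha>)}"

lemma polyfun_monomial: "\<alpha> \<in> multi_indices n \<Longrightarrow> (\<lambda>z. c * mpow n z \<alpha>) \<in> polyfun n"
  unfolding polyfun_def by (intro CollectI exI[of _ "\<lambda>_. c"] exI[of _ "{\<alpha>}"]) auto

lemma polyfun_add:
  assumes "f \<in> polyfun n" "g \<in> polyfun n"
  shows "(\<lambda>z. f z + g z) \<in> polyfun n"
proof -
  obtain c S d T where *: "finite S" "S \<subseteq> multi_indices n" "f = (\<lambda>z. \<Sum>\<alpha>\<in>S. c \<alpha> * mpow n z \<alpha>)"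
    "finite T" "T \<subseteq> multi_indices n" "g = (\<lambda>z. \<Sum>\<alpha>\<in>T. d \<alpha> * mpow n z \<alpha>)"
    using assms unfolding polyfun_def by auto
  let ?e = "\<lambda>\<alpha>. (if \<alpha> \<in> S then c \<alpha> else 0) + (if \<alpha> \<in> T then d \<alpha> else 0)"
  have "(\<Sum>\<alpha>\<in>S. c \<alpha> * mpow n z \<alpha>) = (\<Sum>\<alpha>\<in>S \<union> T. (if \<alpha> \<in> S then c \<alpha> else 0) * mpow n z \<alpha>)"
    "(\<Sum>\<alpha>\<in>T. d \<alpha> * mpow n z \<alpha>) = (\<Sum>\<alpha>\<in>S \<union> T. (if \<alpha> \<in> T then d \<alpha> else 0) * mpow n z \<alpha>)" for z
    using *(1,4) by (auto intro!: sum.mono_neutral_cong_left)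
  then have "(\<lambda>z. f z + g z) = (\<lambda>z. \<Sum>\<alpha>\<in>S \<union> T. ?e \<alpha> * mpow n z \<alpha>)"
    unfolding *(3,6) by (auto simp: fun_eq_iff distrib_right sum.distrib)
  then show ?thesis
    using *(1,2,4,5) unfolding polyfun_def by (intro CollectI exI[of _ ?e] exI[of _ "S \<union> T"]) simp
qed

lemma polyfun_const: "(\<lambda>_. c) \<in> polyfun n"
  using polyfun_monomial[of "\<lambda>_. 0" n c] by (simp add: multi_indices_def)

lemma polyfun_sum: "(\<And>i. i \<in> I \<Longrightarrow> f i \<in> polyfun n) \<Longrightarrow> (\<lambda>z. \<Sum>i\<in>I. f i z) \<in> polyfun n"
  by (induction I rule: infinite_finite_induct) (auto intro: polyfun_const polyfun_add)

lemma polyfun_mult: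
  assumes "f \<in> polyfun n" "g \<in> polyfun n"
  shows "(\<lambda>z. f z * g z) \<in> polyfun n"
proof -
  obtain c S d T where *: "S \<subseteq> multi_indices n" "f = (\<lambda>z. \<Sum>\<alpha>\<in>S. c \<alpha> * mpow n z \<alpha>)"
    "T \<subseteq> multi_indices n" "g = (\<lambda>z. \<Sum>\<alpha>\<in>T. d \<alpha> * mpow n z \<alpha>)"
    using assms unfolding polyfun_def by auto
  have "(\<lambda>z. f z * g z) = (\<lambda>z. \<Sum>\<alpha>\<in>S. \<Sum>\<beta>\<in>T. (c \<alpha> * d \<beta>) * mpow n z (\<lambda>i. \<alpha> i + \<beta> i))"
    unfolding *(2,4) by (simp add: sum_product power_add prod.distrib algebra_simps)
  also have "\<dots> \<in> polyfun n"
    using *(1,3) by (intro polyfun_sum polyfun_monomial) (auto simp: multi_indices_def)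
  finally show ?thesis .
qed

lemma polyfun_power: "f \<in> polyfun n \<Longrightarrow> (\<lambda>z. f z ^ k) \<in> polyfun n"
  by (induction k) (auto intro: polyfun_const polyfun_mult)

lemma polyfun_prod: "(\<And>i. i \<in> I \<Longrightarrow> f i \<in> polyfun n) \<Longrightarrow> (\<lambda>z. \<Prod>i\<in>I. f i z) \<in> polyfun n"
  by (induction I rule: infinite_finite_induct) (auto intro: polyfun_const polyfun_mult)

lemma mpow_unit: "j < n \<Longrightarrow> mpow n z (\<lambda>i. if i = j then 1 else 0) = z j"
  by (simp add: if_distrib cong: if_cong)

lemma polyfun_coord: "j < n \<Longrightarrow> (\<lambda>z. z j) \<in> polyfun n"
  using polyfun_monomial[of "\<lambda>i. if i = j then 1 else 0" n 1]
  by (simp add: mpow_unit multi_indices_def)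

lemmas polyfun_intros = polyfun_const polyfun_coord polyfun_add polyfun_mult polyfun_power
  polyfun_sum polyfun_prod

lemma polyfun_diff: "f \<in> polyfun n \<Longrightarrow> g \<in> polyfun n \<Longrightarrow> (\<lambda>z. f z - g z) \<in> polyfun n"
  using polyfun_add[OF _ polyfun_mult[OF polyfun_const[of "-1"]], of f n g] by simp

lemma polyfun_tate_algebra: "f \<in> polyfun n \<Longrightarrow> f \<in> tate_algebra n"
proof -
  assume "f \<in> polyfun n"
  then obtain c S where *: "finite S" "S \<subseteq> multi_indices n" "f = (\<lambda>z. \<Sum>\<alpha>\<in>S. c \<alpha> * mpow n z \<alpha>)"
    unfolding polyfun_def by auto
  let ?a = "\<lambda>\<alpha>. if \<alpha> \<in> S then c \<alpha> else 0"
  have "finite {\<alpha> \<in> multi_indices n. abs_val (?a \<alpha>) \<ge> \<epsilon>}" if "\<epsilon> > 0" for \<epsilon>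
    using that by (intro finite_subset[OF _ *(1)]) auto
  moreover have "((\<lambda>\<alpha>. ?a \<alpha> * mpow n z \<alpha>) has_sum f z) (multi_indices n)" for z
  proof -
    have "((\<lambda>\<alpha>. c \<alpha> * mpow n z \<alpha>) has_sum f z) S"
      unfolding *(3) using *(1) by (rule has_sum_finite)
    also have "?this \<longleftrightarrow> ?thesis"
      using *(2) by (intro has_sum_cong_neutral) auto
    finally show ?thesis .
  qed
  ultimately show ?thesis
    unfolding tate_algebra_def by (intro CollectI exI[of _ ?a]) simp
qed

text \<open>Completeness of the Tate algebra for the Gauss norm, phrased for coefficient families
  because convergence has to be coefficientwise. The limit coefficients tend to 0: one of size above
  1 / 2^k is already nonzero in \<open>G k\<close>.\<close>

lemma tate_limit:
  fixes G :: "nat \<Rightarrow> (nat \<Rightarrow> nat) \<Rightarrow> 'c::nonarch_field"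
  assumes comp: "complete (UNIV :: 'c set)"
    and fin: "\<And>k. finite {\<alpha>. G k \<alpha> \<noteq> 0}" and sub: "\<And>k. {\<alpha>. G k \<alpha> \<noteq> 0} \<subseteq> multi_indices n"
    and step: "\<And>k \<alpha>. abs_val (G (Suc k) \<alpha> - G k \<alpha>) \<le> 1 / 2 ^ k"
  shows "\<exists>g\<in>tate_algebra n. \<forall>z\<in>polydisc n. \<forall>k.
    abs_val (g z - (\<Sum>\<alpha> | G k \<alpha> \<noteq> 0. G k \<alpha> * mpow n z \<alpha>)) \<le> 1 / 2 ^ k"
proof -
  define p where "p k z = (\<Sum>\<alpha> | G k \<alpha> \<noteq> 0. G k \<alpha> * mpow n z \<alpha>)" for k z
  have p_eq: "p k z = (\<Sum>\<alpha>\<in>S. G k \<alpha> * mpow n z \<alpha>)" if "finite S" "{\<alpha>. G k \<alpha> \<noteq> 0} \<subseteq> S" for k S z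
    unfolding p_def using that by (intro sum.mono_neutral_left) auto
  have "\<exists>l. \<forall>k. abs_val (l - G k \<alpha>) \<le> 1 / 2 ^ k" for \<alpha>
    using comp step by (rule complete_nonarchD)
  then obtain a where a: "\<And>\<alpha> k. abs_val (a \<alpha> - G k \<alpha>) \<le> 1 / 2 ^ k" by metis
  have "\<exists>l. \<forall>k. abs_val (l - p k z) \<le> 1 / 2 ^ k" if "z \<in> polydisc n" for z
    using comp
  proof (rule complete_nonarchD)
    fix k
    let ?S = "{\<alpha>. G k \<alpha> \<noteq> 0} \<union> {\<alpha>. G (Suc k) \<alpha> \<noteq> 0}"
    have "p (Suc k) z - p k z = (\<Sum>\<alpha>\<in>?S. (G (Suc k) \<alpha> - G k \<alpha>) * mpow n z \<alpha>)"
      using fin by (subst (1 2) p_eq[of ?S]) (auto simp: sum_subtractf left_diff_distrib)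
    also have "abs_val \<dots> \<le> 1 / 2 ^ k"
      using step that by (intro abs_val_sum_le abs_val_term_le) auto
    finally show "abs_val (p (Suc k) z - p k z) \<le> 1 / 2 ^ k" .
  qed
  then obtain g where g: "\<And>z k. z \<in> polydisc n \<Longrightarrow> abs_val (g z - p k z) \<le> 1 / 2 ^ k" by metis
  have ex: "\<exists>k. 1 / 2 ^ k < \<epsilon>" if "\<epsilon> > 0" for \<epsilon> :: real
    using real_arch_pow_inv[of \<epsilon> "1/2"] that by (auto simp: power_one_over)
  have "finite {\<alpha> \<in> multi_indices n. abs_val (a \<alpha>) \<ge> \<epsilon>}" if \<epsilon>: "\<epsilon> > 0" for \<epsilon>
  proof -
    obtain k where k: "1 / 2 ^ k < \<epsilon>" using ex \<epsilon> by blast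
    have "G k \<alpha> \<noteq> 0" if "abs_val (a \<alpha>) \<ge> \<epsilon>" for \<alpha>
      using a[of \<alpha> k] k that by auto
    then show ?thesis by (intro finite_subset[OF _ fin[of k]]) auto
  qed
  moreover have "((\<lambda>\<alpha>. a \<alpha> * mpow n z \<alpha>) has_sum g z) (multi_indices n)" if z: "z \<in> polydisc n" for z
  proof (rule has_sum_nonarchI)
    fix \<epsilon> :: real assume "\<epsilon> > 0"
    then obtain k where k: "1 / 2 ^ k < \<epsilon>" using ex by blast
    \<comment> \<open>Once F contains the support of \<open>G k\<close>, both \<open>g z\<close> and
      the partial sum over F are within 1 / 2^k of \<open>p k z\<close>.\<close>
    have "abs_val (g z - (\<Sum>\<alpha>\<in>F. a \<alpha> * mpow n z \<alpha>)) < \<epsilon>"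
      if F: "finite F" "{\<alpha>. G k \<alpha> \<noteq> 0} \<subseteq> F" for F
    proof -
      have "p k z - (\<Sum>\<alpha>\<in>F. a \<alpha> * mpow n z \<alpha>) = (\<Sum>\<alpha>\<in>F. (G k \<alpha> - a \<alpha>) * mpow n z \<alpha>)"
        using F by (subst p_eq[of F]) (auto simp: sum_subtractf left_diff_distrib)
      also have "abs_val \<dots> \<le> 1 / 2 ^ k"
        using a z by (intro abs_val_sum_le abs_val_term_le) (auto simp: abs_val_diff_commute)
      finally have "abs_val (g z - (\<Sum>\<alpha>\<in>F. a \<alpha> * mpow n z \<alpha>)) \<le> 1 / 2 ^ k"
        by (rule abs_val_diff_trans[OF g[OF z]])
      with k show ?thesis by simp
    qed
    then show "\<exists>F. finite F \<and> F \<subseteq> multi_indices n \<and> (\<forall>G. finite G \<and> F \<subseteq> G \<and> G \<subseteq> multi_indices n \<longrightarrow>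
        abs_val (g z - (\<Sum>\<alpha>\<in>G. a \<alpha> * mpow n z \<alpha>)) < \<epsilon>)"
      using fin[of k] sub[of k] by (intro exI[of _ "{\<alpha>. G k \<alpha> \<noteq> 0}"]) auto
  qed
  ultimately have "g \<in> tate_algebra n"
    unfolding tate_algebra_def by (intro CollectI exI[of _ a]) simp
  with g show ?thesis unfolding p_def by (intro bexI[of _ g]) auto
qed


section \<open>Common points of maximal absolute value\<close>

text \<open>Horner's scheme only multiplies by c and adds, so it stays inside the valuation
  ring.\<close>

lemma synthetic_div_integral:
  fixes p :: "'c::nonarch_field poly"
  assumes "\<And>i. abs_val (coeff p i) \<le> 1" "abs_val c \<le> 1"
  shows "abs_val (poly p c) \<le> 1 \<and> (\<forall>i. abs_val (coeff (synthetic_div p c) i) \<le> 1)"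
  using assms(1)
proof (induction p)
  case (pCons a p)
  have "abs_val (coeff p i) \<le> 1" for i
    using pCons.prems[of "Suc i"] by simp
  then have IH: "abs_val (poly p c) \<le> 1" "\<And>i. abs_val (coeff (synthetic_div p c) i) \<le> 1"
    using pCons.IH by auto
  have "abs_val (c * poly p c) \<le> 1"
    using IH(1) assms(2) by (simp add: abs_val_mult mult_le_one)
  then show ?case
    using IH pCons.prems[of 0] by (auto simp: coeff_pCons split: nat.split intro: abs_val_add_le)
qed simp

text \<open>The reduction of p is a nonzero polynomial and has finitely many roots, while the
  \<open>t n\<close> represent distinct residue classes. The residue field is never formed: the
  induction splits off a linear factor up to a remainder of absolute value below 1.\<close>

lemma finite_small_values:
  fixes p :: "'c::nonarch_field poly" and t :: "nat \<Rightarrow> 'c"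
  assumes t: "\<And>n. abs_val (t n) \<le> 1" "\<And>m n. m \<noteq> n \<Longrightarrow> abs_val (t m - t n) = 1"
    and p: "\<And>i. abs_val (coeff p i) \<le> 1" "\<exists>i. abs_val (coeff p i) = 1"
  shows "finite {n. abs_val (poly p (t n)) < 1}"
  using p
proof (induction "degree p" arbitrary: p rule: less_induct)
  case less
  show ?case
  proof (cases "\<exists>n0. abs_val (poly p (t n0)) < 1")
    case True
    then obtain n0 where n0: "abs_val (poly p (t n0)) < 1" by auto
    define c q where "c = t n0" and "q = synthetic_div p c"
    have p_eq: "p = [:-c, 1:] * q + [:poly p c:]"
      unfolding q_def using synthetic_div_correct'[of c p] by simp
    have q_le: "\<And>i. abs_val (coeff q i) \<le> 1"
      unfolding q_def using synthetic_div_integral[of p c] less.prems(1) t(1) c_def by auto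
    \<comment> \<open>If all coefficients of q were smaller than 1, so would be those of p = (X - c)
      q + p(c).\<close>
    have q_1: "\<exists>i. abs_val (coeff q i) = 1"
    proof (rule ccontr)
      assume "\<nexists>i. abs_val (coeff q i) = 1"
      then have q_less: "abs_val (coeff q i) < 1" for i
        using q_le[of i] by (metis less_eq_real_def)
      have "abs_val (c * coeff q i) < 1" for i
        using q_less[of i] t(1)[of n0] mult_left_le_one_le[of "abs_val (coeff q i)" "abs_val c"]
        unfolding c_def by (simp add: abs_val_mult)
      then have "abs_val (coeff p i) < 1" for i
        using q_less n0 by (subst p_eq)
          (auto simp: coeff_pCons c_def[symmetric] split: nat.split intro!: abs_val_diff_less)
      then show False using less.prems(2) by (metis less_irrefl)
    qed
    have "degree p \<noteq> 0"
    proof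
      assume "degree p = 0"
      then obtain a where "p = [:a:]" by (metis degree_eq_zeroE)
      moreover obtain i where "abs_val (coeff p i) = 1" using less.prems(2) by blast
      ultimately show False using n0 by (cases i) auto
    qed
    then have "finite {n. abs_val (poly q (t n)) < 1}"
      using less.hyps[of q] q_le q_1 by (simp add: q_def degree_synthetic_div)
    \<comment> \<open>Since |t n - c| = 1, the value q(t n) is as large as p(t n) - p(c), a
      difference of two small values.\<close>
    moreover have "abs_val (poly q (t n)) < 1" if "abs_val (poly p (t n)) < 1" "n \<noteq> n0" for n
    proof -
      have "poly p (t n) - poly p c = (t n - c) * poly q (t n)"
        by (subst (1) p_eq) (simp add: algebra_simps)
      then have "abs_val (poly q (t n)) = abs_val (poly p (t n) - poly p c)"
        using t(2)[OF that(2)] by (simp add: abs_val_mult c_def)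
      also have "\<dots> < 1"
        using that n0 abs_val_diff_le_max[of "poly p (t n)" "poly p c"] by (simp add: c_def)
      finally show ?thesis .
    qed
    then have "{n. abs_val (poly p (t n)) < 1} \<subseteq> insert n0 {n. abs_val (poly q (t n)) < 1}" by blast
    ultimately show ?thesis by (meson finite_insert finite_subset)
  qed simp
qed

text \<open>Induction on the number of variables. Each polynomial has a unit coefficient at some
  \<open>\<mu> i\<close>; its part of degree \<open>\<mu> i n\<close> in the last variable is a
  polynomial of Gauss norm 1 in the others. At a common good point of these parts, every polynomial
  becomes a one-variable polynomial of Gauss norm 1.\<close>

lemma common_maximal_point:
  fixes c :: "'i \<Rightarrow> (nat \<Rightarrow> nat) \<Rightarrow> 'c::nonarch_field" and t :: "nat \<Rightarrow> 'c"
  assumes t: "\<And>n. abs_val (t n) \<le> 1" "\<And>m n. m \<noteq> n \<Longrightarrow> abs_val (t m - t n) = 1"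
    and "finite I" "\<And>i. i \<in> I \<Longrightarrow> finite (S i) \<and> S i \<subseteq> multi_indices n"
    and "\<And>i \<alpha>. i \<in> I \<Longrightarrow> \<alpha> \<in> S i \<Longrightarrow> abs_val (c i \<alpha>) \<le> 1"
    and "\<And>i. i \<in> I \<Longrightarrow> \<exists>\<alpha>\<in>S i. abs_val (c i \<alpha>) = 1"
  shows "\<exists>z\<in>polydisc n. \<forall>i\<in>I. abs_val (\<Sum>\<alpha>\<in>S i. c i \<alpha> * mpow n z \<alpha>) = 1"
  using assms(4-6)
proof (induction n arbitrary: S c)
  case 0
  have mi: "multi_indices 0 = {\<lambda>_. 0}" by (auto simp: multi_indices_def)
  have "abs_val (\<Sum>\<alpha>\<in>S i. c i \<alpha> * mpow 0 z \<alpha>) = 1" if "i \<in> I" for i z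
  proof -
    have "S i = {\<lambda>_. 0}" using 0(1)[OF that] 0(3)[OF that] unfolding mi by auto
    then show ?thesis using 0(3)[OF that] by simp
  qed
  then show ?case by (intro bexI[of _ "\<lambda>_. 0"]) (auto simp: polydisc_def vec_def)
next
  case (Suc n)
  obtain \<mu> where \<mu>: "\<And>i. i \<in> I \<Longrightarrow> \<mu> i \<in> S i \<and> abs_val (c i (\<mu> i)) = 1"
    using Suc.prems(3) by metis
  let ?cut = "\<lambda>\<alpha>. \<alpha>(n := 0)"
  define T where "T m i = {\<alpha> \<in> S i. \<alpha> n = m}" for m i
  have inj: "inj_on ?cut (T m i)" for m i
  proof (rule inj_onI)
    fix \<alpha> \<beta> assume *: "\<alpha> \<in> T m i" "\<beta> \<in> T m i" "?cut \<alpha> = ?cut \<beta>"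
    have "\<alpha> = (?cut \<alpha>)(n := \<alpha> n)" "\<beta> = (?cut \<beta>)(n := \<beta> n)" by simp_all
    with * show "\<alpha> = \<beta>" unfolding T_def by (metis (mono_tags, lifting) mem_Collect_eq)
  qed
  have mpow_cut: "mpow n z (?cut \<alpha>) = mpow n z \<alpha>" for z :: "nat \<Rightarrow> 'c" and \<alpha>
    by (intro prod.cong) auto
  \<comment> \<open>The coefficients of the power \<open>\<mu> i n\<close> of the last variable, as
    a family in the first n variables.\<close>
  define c' where "c' i \<beta> = c i (\<beta>(n := \<mu> i n))" for i \<beta>
  have c'_cut: "c' i (?cut \<alpha>) = c i \<alpha>" if "\<alpha> \<in> T (\<mu> i n) i" for i \<alpha>
  proof -
    have "(?cut \<alpha>)(n := \<mu> i n) = \<alpha>" using that unfolding T_def by auto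
    then show ?thesis unfolding c'_def by simp
  qed
  have "\<exists>z\<in>polydisc n. \<forall>i\<in>I. abs_val (\<Sum>\<beta>\<in>?cut ` T (\<mu> i n) i. c' i \<beta> * mpow n z \<beta>) = 1"
  proof (rule Suc.IH)
    fix i assume i: "i \<in> I"
    show "finite (?cut ` T (\<mu> i n) i) \<and> ?cut ` T (\<mu> i n) i \<subseteq> multi_indices n"
      using Suc.prems(1)[OF i] unfolding T_def by (auto simp: multi_indices_def)
    show "\<exists>\<alpha>\<in>?cut ` T (\<mu> i n) i. abs_val (c' i \<alpha>) = 1"
      using \<mu>[OF i] c'_cut[of "\<mu> i" i] by (intro bexI[of _ "?cut (\<mu> i)"]) (auto simp: T_def)
    show "abs_val (c' i \<alpha>) \<le> 1" if "\<alpha> \<in> ?cut ` T (\<mu> i n) i" for \<alpha>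
      using that c'_cut[of _ i] Suc.prems(2)[OF i] by (auto simp: T_def)
  qed
  then obtain z where z: "z \<in> polydisc n"
    and z1: "\<And>i. i \<in> I \<Longrightarrow> abs_val (\<Sum>\<beta>\<in>?cut ` T (\<mu> i n) i. c' i \<beta> * mpow n z \<beta>) = 1" by auto
  define b where "b i m = (\<Sum>\<alpha>\<in>T m i. c i \<alpha> * mpow n z \<alpha>)" for i m
  have b1: "abs_val (b i (\<mu> i n)) = 1" if i: "i \<in> I" for i
  proof -
    have "(\<Sum>\<beta>\<in>?cut ` T (\<mu> i n) i. c' i \<beta> * mpow n z \<beta>) = b i (\<mu> i n)"
      unfolding b_def by (subst sum.reindex[OF inj]) (simp add: c'_cut mpow_cut)
    then show ?thesis using z1[OF i] by simp
  qed
  have b_le: "abs_val (b i m) \<le> 1" if "i \<in> I" for i m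
    unfolding b_def using Suc.prems(2)[OF that] z
    by (intro abs_val_sum_le abs_val_term_le) (auto simp: T_def)
  define p where "p i = (\<Sum>m\<in>(\<lambda>\<alpha>. \<alpha> n) ` S i. monom (b i m) m)" for i
  have fin: "finite ((\<lambda>\<alpha>. \<alpha> n) ` S i)" if "i \<in> I" for i using Suc.prems(1)[OF that] by auto
  have coeff_p: "coeff (p i) m = (if m \<in> (\<lambda>\<alpha>. \<alpha> n) ` S i then b i m else 0)" if "i \<in> I" for i m
    unfolding p_def coeff_sum coeff_monom using fin[OF that] by (simp add: sum.delta')
  have "finite {k. abs_val (poly (p i) (t k)) < 1}" if i: "i \<in> I" for i
  proof (rule finite_small_values[OF t])
    show "abs_val (coeff (p i) m) \<le> 1" for m
      using b_le[OF i] by (simp add: coeff_p[OF i])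
    show "\<exists>m. abs_val (coeff (p i) m) = 1"
      using b1[OF i] \<mu>[OF i] by (intro exI[of _ "\<mu> i n"]) (auto simp: coeff_p[OF i])
  qed
  \<comment> \<open>Each of the finitely many polynomials rules out finitely many of the
    \<open>t k\<close>, so one of them serves all.\<close>
  then have "finite (\<Union>i\<in>I. {k. abs_val (poly (p i) (t k)) < 1})" using \<open>finite I\<close> by blast
  then obtain k where k: "k \<notin> (\<Union>i\<in>I. {k. abs_val (poly (p i) (t k)) < 1})"
    using ex_new_if_finite infinite_UNIV_nat by metis
  let ?z = "z(n := t k)"
  have z': "?z \<in> polydisc (Suc n)"
    using z t(1) by (auto simp: polydisc_def vec_def less_Suc_eq)
  have mpow_Suc: "mpow (Suc n) ?z \<alpha> = mpow n z \<alpha> * t k ^ \<alpha> n" for \<alpha>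
  proof -
    have "mpow n ?z \<alpha> = mpow n z \<alpha>" by (intro prod.cong) auto
    then show ?thesis by simp
  qed
  have "abs_val (\<Sum>\<alpha>\<in>S i. c i \<alpha> * mpow (Suc n) ?z \<alpha>) = 1" if i: "i \<in> I" for i
  proof -
    have "(\<Sum>\<alpha>\<in>S i. c i \<alpha> * mpow (Suc n) ?z \<alpha>) =
        (\<Sum>m\<in>(\<lambda>\<alpha>. \<alpha> n) ` S i. \<Sum>\<alpha>\<in>T m i. c i \<alpha> * mpow (Suc n) ?z \<alpha>)"
      unfolding T_def using Suc.prems(1)[OF i] by (subst sum.image_gen[of _ _ "\<lambda>\<alpha>. \<alpha> n"]) auto
    also have "\<dots> = (\<Sum>m\<in>(\<lambda>\<alpha>. \<alpha> n) ` S i. b i m * t k ^ m)"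
      unfolding b_def sum_distrib_right mpow_Suc by (intro sum.cong) (auto simp: T_def mult.assoc)
    also have "\<dots> = poly (p i) (t k)"
      unfolding p_def by (simp add: poly_sum poly_monom)
    finally have eq: "(\<Sum>\<alpha>\<in>S i. c i \<alpha> * mpow (Suc n) ?z \<alpha>) = poly (p i) (t k)" .
    have "abs_val (poly (p i) (t k)) \<le> 1"
      unfolding eq[symmetric] by (intro abs_val_sum_le abs_val_term_le z') (use Suc.prems(2)[OF i] in auto)
    with k i eq show ?thesis by (metis (mono_tags, lifting) UN_I linorder_not_less mem_Collect_eq order_antisym)
  qed
  with z' show ?case by blast
qed


section \<open>The field \<open>C\<^sub>\<infinity>\<close>\<close>

locale complete_closure =
  fixes \<iota> :: "'k::{field,finite} fls \<Rightarrow> 'c::nonarch_field" and q :: real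
  assumes q_eq: "q = real CARD('k)"
    and cac: "completed_algebraic_closure \<iota>"
begin

lemma iota_1 [simp]: "\<iota> 1 = 1" and iota_add: "\<iota> (f + g) = \<iota> f + \<iota> g"
  and iota_mult: "\<iota> (f * g) = \<iota> f * \<iota> g" and abs_val_iota: "abs_val (\<iota> f) = abs_inf f"
  and comp: "complete (UNIV :: 'c set)"
  using cac unfolding completed_algebraic_closure_def by auto

lemma algebraic_root:
  assumes "degree p > 0" "\<And>i. coeff p i \<in> algebraic_over \<iota>"
  shows "\<exists>x\<in>algebraic_over \<iota>. poly p x = 0"
  using cac assms unfolding completed_algebraic_closure_def by blast

lemma iota_0 [simp]: "\<iota> 0 = 0"
  by (metis add_cancel_right_right iota_add)

lemma iota_minus: "\<iota> (- f) = - \<iota> f"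
  using iota_add[of f "- f"] by (simp add: eq_neg_iff_add_eq_0 add.commute)

lemma iota_diff: "\<iota> (f - g) = \<iota> f - \<iota> g"
  using iota_add[of f "- g"] by (simp add: iota_minus)

lemma iota_sum: "\<iota> (sum f A) = (\<Sum>i\<in>A. \<iota> (f i))"
  by (induction A rule: infinite_finite_induct) (auto simp: iota_add)

lemma abs_inf_0 [simp]: "abs_inf (0 :: 'k fls) = 0" by (simp add: abs_inf_def)

lemma abs_inf_nonneg [simp]: "0 \<le> abs_inf (f :: 'k fls)"
  using abs_val_iota[of f] by (metis abs_val_nonneg)

lemma abs_inf_eq_0_iff [simp]: "abs_inf (f :: 'k fls) = 0 \<longleftrightarrow> f = 0"
  by (auto simp: abs_inf_def)

lemma abs_inf_pos_iff [simp]: "0 < abs_inf (f :: 'k fls) \<longleftrightarrow> f \<noteq> 0"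
  by (metis abs_inf_eq_0_iff abs_inf_nonneg order_less_le)

lemma iota_eq_0_iff [simp]: "\<iota> f = 0 \<longleftrightarrow> f = 0"
  using abs_val_iota[of f] by (metis abs_inf_eq_0_iff abs_val_eq_0_iff)

lemma abs_inf_1 [simp]: "abs_inf (1 :: 'k fls) = 1"
  using abs_val_iota[of 1] by simp

lemma abs_inf_mult: "abs_inf (f * g :: 'k fls) = abs_inf f * abs_inf g"
  by (simp flip: abs_val_iota add: iota_mult abs_val_mult)

lemma abs_inf_inverse: "abs_inf (inverse f :: 'k fls) = inverse (abs_inf f)"
proof (cases "f = 0")
  case False
  then have "abs_inf f * abs_inf (inverse f) = 1"
    by (simp flip: abs_inf_mult)
  then show ?thesis by (metis inverse_unique)
qed simp

lemma iota_algebraic: "\<iota> f \<in> algebraic_over \<iota>"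
proof -
  have "map_poly \<iota> [:- f, 1:] = [:- \<iota> f, 1:]"
    by (simp add: map_poly_pCons iota_minus)
  then show ?thesis unfolding algebraic_over_def by (intro CollectI exI[of _ "[:- f, 1:]"]) auto
qed

text \<open>X^n - f has coefficients in the image of the base field, hence a root. Such roots
  provide elements whose absolute values are rational powers of q.\<close>

lemma ex_root: "n > 0 \<Longrightarrow> \<exists>x. x ^ n = \<iota> f"
proof -
  assume n: "n > 0"
  let ?p = "monom 1 n + [:- \<iota> f:]"
  have c: "coeff ?p i \<in> algebraic_over \<iota>" for i
  proof -
    have "coeff ?p i = \<iota> (if i = n then 1 else if i = 0 then - f else 0)"
      using n by (auto simp: iota_minus coeff_pCons split: nat.split)
    then show ?thesis using iota_algebraic by metis
  qed
  have "degree ?p = n"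
    using n by (subst degree_add_eq_left) (auto simp: degree_monom_eq)
  then obtain x where "poly ?p x = 0"
    using algebraic_root[of ?p] n c by auto
  then show ?thesis by (auto simp: poly_monom)
qed

text \<open>The residue field is infinite: with \<open>\<sigma> u = u - u\<^sup>2\<close> and \<open>t\<^sub>0 = 1\<close>, \<open>\<sigma> t\<^sub>k\<^sub>+\<^sub>1 = t\<^sub>k\<close>, the \<open>j\<close>-th
  iterate of \<open>\<sigma>\<close> maps \<open>t\<^sub>j\<close> to \<open>1\<close> and \<open>t\<^sub>i\<close> to \<open>0\<close> for \<open>i < j\<close>, and \<open>\<sigma>\<close> does not increase distances.\<close>

lemma ex_residue_sequence:
  "\<exists>t :: nat \<Rightarrow> 'c. (\<forall>n. abs_val (t n) \<le> 1) \<and> (\<forall>m n. m \<noteq> n \<longrightarrow> abs_val (t m - t n) = 1)"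
proof -
  have "\<exists>x\<in>algebraic_over \<iota>. x - x\<^sup>2 = y" if "y \<in> algebraic_over \<iota>" for y
  proof -
    have "coeff [:y, -1, 1:] i \<in> algebraic_over \<iota>" for i
      using that iota_algebraic[of 1] iota_algebraic[of "-1"] iota_algebraic[of 0]
      by (auto simp: coeff_pCons iota_minus split: nat.split)
    then obtain x where "x \<in> algebraic_over \<iota>" "poly [:y, -1, 1:] x = 0"
      using algebraic_root[of "[:y, -1, 1:]"] by auto
    then show ?thesis by (intro bexI[of _ x]) (auto simp: algebra_simps power2_eq_square)
  qed
  then obtain \<tau> where \<tau>: "\<And>y. y \<in> algebraic_over \<iota> \<Longrightarrow> \<tau> y \<in> algebraic_over \<iota> \<and> \<tau> y - (\<tau> y)\<^sup>2 = y"
    by metis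
  define t where "t k = (\<tau> ^^ k) 1" for k
  define \<sigma> where "\<sigma> u = u - u\<^sup>2" for u :: 'c
  have alg: "t k \<in> algebraic_over \<iota>" for k
    unfolding t_def using iota_algebraic[of 1] \<tau> by (induction k) auto
  have \<sigma>_t: "\<sigma> (t (Suc k)) = t k" for k
    using \<tau>[OF alg[of k]] by (simp add: t_def \<sigma>_def)
  have t_le: "abs_val (t k) \<le> 1" for k
  proof (induction k)
    case (Suc k)
    show ?case
    \<comment> \<open>If |t(k+1)| > 1, the square dominates in \<sigma>, and |t(k)| = |t(k+1)|^2 > 1
      contradicts the induction hypothesis.\<close>
    proof (rule ccontr)
      assume "\<not> ?thesis"
      then have gt: "abs_val (t (Suc k)) > 1" by simp
      then have "abs_val (t (Suc k)) * 1 < abs_val (t (Suc k)) * abs_val (t (Suc k))"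
        by (intro mult_strict_left_mono) auto
      then have "abs_val (t (Suc k)) < abs_val (- (t (Suc k))\<^sup>2)"
        by (simp add: abs_val_mult power2_eq_square)
      then have "abs_val (- (t (Suc k))\<^sup>2 + t (Suc k)) = abs_val (- (t (Suc k))\<^sup>2)"
        by (rule abs_val_add_eq)
      then have "abs_val (t k) = abs_val (- (t (Suc k))\<^sup>2)"
        using \<sigma>_t[of k] by (simp add: \<sigma>_def)
      with Suc gt \<open>_ < abs_val (- (t (Suc k))\<^sup>2)\<close> show False by simp
    qed
  qed (simp add: t_def)
  have \<sigma>_le: "abs_val (\<sigma> u) \<le> 1" if "abs_val u \<le> 1" for u
    using that unfolding \<sigma>_def by (intro abs_val_diff_le) (auto simp: abs_val_power power_le_one)
  have \<sigma>_lip: "abs_val (\<sigma> u - \<sigma> v) \<le> abs_val (u - v)" if "abs_val u \<le> 1" "abs_val v \<le> 1" for u v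
  proof -
    have "\<sigma> u - \<sigma> v = (u - v) * (1 - (u + v))"
      unfolding \<sigma>_def by (simp add: algebra_simps power2_eq_square)
    moreover have "abs_val (1 - (u + v)) \<le> 1"
      using that by (intro abs_val_diff_le abs_val_add_le) auto
    ultimately show ?thesis by (simp add: abs_val_mult mult_left_le)
  qed
  have iter_le: "abs_val ((\<sigma> ^^ k) u) \<le> 1" if "abs_val u \<le> 1" for u k
    using that by (induction k) (auto intro: \<sigma>_le)
  have iter_lip: "abs_val ((\<sigma> ^^ k) u - (\<sigma> ^^ k) v) \<le> abs_val (u - v)"
    if "abs_val u \<le> 1" "abs_val v \<le> 1" for u v k
  proof (induction k)
    case (Suc k)
    then show ?case using \<sigma>_lip[OF iter_le[of u k] iter_le[of v k]] that by auto
  qed simp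
  have iter_t: "(\<sigma> ^^ k) (t (k + m)) = t m" for k m
    by (induction k) (auto simp: \<sigma>_t funpow_swap1)
  have iter_0: "(\<sigma> ^^ m) 0 = 0" for m
    by (induction m) (auto simp: \<sigma>_def)
  have dist: "abs_val (t i - t j) = 1" if "i < j" for i j
  proof -
    have "(\<sigma> ^^ j) (t j) = 1" using iter_t[of j 0] by (simp add: t_def)
    moreover have "(\<sigma> ^^ j) (t i) = 0"
    proof -
      have d: "j = (j - Suc i) + Suc i" using that by simp
      have "(\<sigma> ^^ i) (t i) = 1" using iter_t[of i 0] by (simp add: t_def)
      then have "(\<sigma> ^^ Suc i) (t i) = 0" by (simp add: \<sigma>_def)
      then show ?thesis by (subst d) (simp only: funpow_add o_apply iter_0)
    qed
    ultimately have "1 \<le> abs_val (t i - t j)"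
      using iter_lip[of "t i" "t j" j] t_le by simp
    moreover have "abs_val (t i - t j) \<le> 1" using t_le by (intro abs_val_diff_le)
    ultimately show ?thesis by simp
  qed
  have "abs_val (t m - t n) = 1" if "m \<noteq> n" for m n
    using dist[of m n] dist[of n m] that by (metis abs_val_diff_commute nat_neq_iff)
  with t_le show ?thesis by blast
qed

end


section \<open>Orthogonal bases for the points of the building\<close>

text \<open>The exponents are integers, bounded below because of m > 0; shifted by that bound, they
  have a least natural number. This turns infima into minima, for lattice norms (D = 1) as well as
  for M.\<close>

lemma discrete_minimum:
  fixes S :: "real set" and q m :: real and D :: nat
  assumes "x0 \<in> S" "\<And>x. x \<in> S \<Longrightarrow> \<exists>n::int. x = q powr (n / D)" "D > 0" "q > 1"
    "\<And>x. x \<in> S \<Longrightarrow> m \<le> x" "m > 0"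
  shows "\<exists>x\<in>S. \<forall>y\<in>S. x \<le> y"
proof -
  obtain n :: "real \<Rightarrow> int" where n: "\<And>x. x \<in> S \<Longrightarrow> x = q powr (n x / D)"
    using assms(2) by metis
  define l where "l = \<lfloor>D * log q m\<rfloor>"
  have l: "l \<le> n x" if "x \<in> S" for x
  proof -
    have "log q m \<le> log q (q powr (n x / D))"
      using assms(4,6) assms(5)[OF that] n[OF that] by (intro log_mono) auto
    then have "D * log q m \<le> n x"
      using assms(3,4) by (simp add: pos_le_divide_eq mult.commute)
    then show ?thesis unfolding l_def by linarith
  qed
  obtain x where x: "x \<in> S" "\<And>y. y \<in> S \<Longrightarrow> nat (n x - l) \<le> nat (n y - l)"
    using ex_has_least_nat[of "\<lambda>x. x \<in> S" x0 "\<lambda>x. nat (n x - l)"] assms(1) by auto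
  have "x \<le> y" if "y \<in> S" for y
  proof -
    have "n x \<le> n y" using x(2)[OF that] l[OF that] l[OF x(1)] by linarith
    then have "q powr (n x / D) \<le> q powr (n y / D)"
      using assms(3,4) by (intro powr_mono divide_right_mono) auto
    then show ?thesis using n[OF that] n[OF x(1)] by simp
  qed
  with x(1) show ?thesis by blast
qed

lemma common_denominator:
  assumes "\<And>i. i \<le> (k::nat) \<Longrightarrow> (t i :: real) \<in> \<rat>"
  shows "\<exists>D>0. \<forall>i\<le>k. \<exists>a::int. t i = a / real D"
  using assms
proof (induction k)
  case 0
  obtain a :: int and b :: nat where "b > 0" "t 0 = a / b"
    using 0[of 0] unfolding Rats_eq_int_div_nat by auto
  then show ?case by (intro exI[of _ b]) auto
next
  case (Suc k)
  then obtain D where D: "D > 0" "\<And>i. i \<le> k \<Longrightarrow> \<exists>a::int. t i = a / real D" by (metis le_Suc_eq)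
  obtain a :: int and b :: nat where b: "b > 0" "t (Suc k) = a / b"
    using Suc.prems[of "Suc k"] unfolding Rats_eq_int_div_nat by auto
  have "\<exists>a::int. t i = a / real (D * b)" if i: "i \<le> Suc k" for i
  proof (cases "i = Suc k")
    case True
    then have "t i = of_int (a * int D) / real (D * b)" using b D(1) by simp
    then show ?thesis by blast
  next
    case False
    then obtain c :: int where "t i = c / real D" using D(2) i by (metis le_SucE)
    then have "t i = of_int (c * int b) / real (D * b)" using b D(1) by simp
    then show ?thesis by blast
  qed
  then show ?case using D(1) b(1) by (intro exI[of _ "D * b"]) auto
qed

lemma vec_scale: "x \<in> vec r \<Longrightarrow> (\<lambda>i. c * x i) \<in> vec r" for x :: "nat \<Rightarrow> 'a::ring"
  by (auto simp: vec_def)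

lemma vec_add: "x \<in> vec r \<Longrightarrow> y \<in> vec r \<Longrightarrow> (\<lambda>i. x i + y i) \<in> vec r" for x :: "nat \<Rightarrow> 'a::ring"
  by (auto simp: vec_def)

lemma vec_mono: "x \<in> vec r \<Longrightarrow> r \<le> s \<Longrightarrow> x \<in> vec s"
  by (auto simp: vec_def)

lemma homothety_class_self: "N \<in> homothety_class r N"
  unfolding homothety_class_def by (intro CollectI exI[of _ 1]) auto

lemma homothety_class_eqI:
  assumes "c > 0" "\<And>x. x \<in> vec r \<Longrightarrow> M x = c * N x"
  shows "homothety_class r M = homothety_class r N"
proof (intro set_eqI iffI)
  fix F assume "F \<in> homothety_class r M"
  then obtain d where "d > 0" "\<And>x. x \<in> vec r \<Longrightarrow> F x = d * M x" unfolding homothety_class_def by auto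
  then show "F \<in> homothety_class r N"
    unfolding homothety_class_def using assms by (intro CollectI exI[of _ "d * c"]) auto
next
  fix F assume "F \<in> homothety_class r N"
  then obtain d where "d > 0" "\<And>x. x \<in> vec r \<Longrightarrow> F x = d * N x" unfolding homothety_class_def by auto
  then show "F \<in> homothety_class r M"
    unfolding homothety_class_def using assms by (intro CollectI exI[of _ "d / c"]) auto
qed

definition vsum :: "nat \<Rightarrow> (nat \<Rightarrow> nat \<Rightarrow> 'a::comm_ring) \<Rightarrow> (nat \<Rightarrow> 'a) \<Rightarrow> nat \<Rightarrow> 'a" where
  "vsum r e a = (\<lambda>i. \<Sum>j<r. a j * e j i)"

lemma vsum_vec: "(\<And>j. j < r \<Longrightarrow> e j \<in> vec s) \<Longrightarrow> vsum r e a \<in> vec s"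
  by (auto simp: vsum_def vec_def intro!: sum.neutral)

text \<open>The set whose infimum is \<open>lattice_norm\<close>. It is named because its emptiness,
  hidden in the value of \<open>Inf\<close>, decides whether that norm is meaningful.\<close>

definition lattice_scalars ::
  "(nat \<Rightarrow> 'k::{field,finite} fls) set \<Rightarrow> (nat \<Rightarrow> 'k fls) \<Rightarrow> real set" where
  "lattice_scalars L v = {abs_inf c | c. \<exists>w\<in>L. v = (\<lambda>i. c * w i)}"

section \<open>Lattice norms, norms of rational points and their orthogonal bases\<close>

context complete_closure
begin

lemma q_gt_1: "q > 1"
proof -
  have "card {0::'k, 1} \<le> CARD('k)" by (intro card_mono) auto
  then show ?thesis by (simp add: q_eq)
qed

lemma abs_inf_powr: "f \<noteq> 0 \<Longrightarrow> abs_inf (f :: 'k fls) = q powr of_int (- fls_subdegree f)"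
  using q_gt_1 by (simp add: abs_inf_def q_eq powr_real_of_int' del: of_int_minus)

lemma abs_inf_X_intpow: "abs_inf (fls_X_intpow n :: 'k fls) = q powr of_int (- n)"
  by (subst abs_inf_powr) auto

lemma ex_abs_val: "D > 0 \<Longrightarrow> \<exists>\<kappa>::'c. abs_val \<kappa> = q powr (of_int n / real D)"
proof -
  assume D: "D > 0"
  then obtain \<kappa> where "\<kappa> ^ D = \<iota> (fls_X_intpow (- n))" using ex_root by blast
  then have "abs_val \<kappa> ^ D = abs_inf (fls_X_intpow (- n) :: 'k fls)"
    by (metis abs_val_power abs_val_iota)
  then have *: "abs_val \<kappa> ^ D = q powr of_int n" unfolding abs_inf_X_intpow by simp
  then have pos: "abs_val \<kappa> > 0"
    using D q_gt_1 by (cases "\<kappa> = 0") (auto simp: power_0_left)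
  then have "abs_val \<kappa> = (abs_val \<kappa> powr real D) powr (1 / real D)"
    using D by (simp add: powr_powr)
  also have "\<dots> = q powr (of_int n / real D)"
    using * pos by (simp add: powr_realpow powr_powr)
  finally show ?thesis by blast
qed

lemma abs_inf_sum_le:
  assumes "\<And>i. i \<in> A \<Longrightarrow> abs_inf (f i :: 'k fls) \<le> b" "0 \<le> b"
  shows "abs_inf (sum f A) \<le> b"
  using abs_val_sum_le[of A "\<lambda>i. \<iota> (f i)" b] assms by (simp flip: iota_sum add: abs_val_iota)

lemma lattice_scalars_scale:
  assumes "c \<noteq> 0"
  shows "lattice_scalars L (\<lambda>i. c * v i) = (\<lambda>s. abs_inf c * s) ` lattice_scalars L (v :: nat \<Rightarrow> 'k fls)"
proof (intro set_eqI iffI)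
  fix s assume "s \<in> lattice_scalars L (\<lambda>i. c * v i)"
  then obtain d w where d: "s = abs_inf d" "w \<in> L" "(\<lambda>i. c * v i) = (\<lambda>i. d * w i)"
    unfolding lattice_scalars_def by auto
  have "v = (\<lambda>i. (inverse c * d) * w i)"
  proof
    fix i have "c * v i = d * w i" using d(3) by metis
    then have "inverse c * (c * v i) = inverse c * (d * w i)" by simp
    then show "v i = inverse c * d * w i" using assms by (simp flip: mult.assoc)
  qed
  then have "abs_inf (inverse c * d) \<in> lattice_scalars L v"
    using d(2) unfolding lattice_scalars_def by blast
  moreover have "s = abs_inf c * abs_inf (inverse c * d)"
    using assms d(1) by (simp add: abs_inf_mult abs_inf_inverse)
  ultimately show "s \<in> (\<lambda>s. abs_inf c * s) ` lattice_scalars L v" by blast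
next
  fix s assume "s \<in> (\<lambda>s. abs_inf c * s) ` lattice_scalars L v"
  then obtain d w where d: "s = abs_inf c * abs_inf d" "w \<in> L" "v = (\<lambda>i. d * w i)"
    unfolding lattice_scalars_def by auto
  then have "s = abs_inf (c * d)" "(\<lambda>i. c * v i) = (\<lambda>i. (c * d) * w i)"
    by (auto simp: abs_inf_mult mult.assoc)
  with d(2) show "s \<in> lattice_scalars L (\<lambda>i. c * v i)"
    unfolding lattice_scalars_def by blast
qed

text \<open>A lattice is bounded, so v = c w with w in L forces |c| >= |v_i| / B; as |c| is a power
  of q, the infimum is attained. The same B later compares M with the entries of a vector.\<close>

lemma lattice_norm_minimum:
  assumes L: "O_lattice r (L :: (nat \<Rightarrow> 'k fls) set)"
  shows "\<exists>B>0. \<forall>v\<in>vec r. v \<noteq> (\<lambda>_. 0) \<longrightarrow> lattice_scalars L v \<noteq> {} \<longrightarrow>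
    lattice_norm L v \<in> lattice_scalars L v \<and> (\<forall>s\<in>lattice_scalars L v. lattice_norm L v \<le> s) \<and>
    (\<exists>n::int. lattice_norm L v = q powr n) \<and> (\<forall>i. abs_inf (v i) \<le> B * lattice_norm L v)"
proof -
  obtain b where b: "\<And>j. j < r \<Longrightarrow> b j \<in> vec r"
    and L_eq: "L = {(\<lambda>i. \<Sum>j<r. c j * b j i) | c. \<forall>j<r. abs_inf (c j) \<le> 1}"
    using L unfolding O_lattice_def by auto
  \<comment> \<open>Bounds all entries of the basis vectors and so, by the ultrametric inequality,
    those of every vector of L; the summand 1 makes it positive.\<close>
  define B where "B = 1 + (\<Sum>j<r. \<Sum>i<r. abs_inf (b j i))"
  have B: "B > 0" unfolding B_def by (intro add_pos_nonneg sum_nonneg) auto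
  have b_le: "abs_inf (b j i) \<le> B" if "j < r" for i j
  proof (cases "i < r")
    case True
    have "abs_inf (b j i) \<le> (\<Sum>i<r. abs_inf (b j i))"
      using True by (intro member_le_sum) auto
    also have "\<dots> \<le> (\<Sum>j<r. \<Sum>i<r. abs_inf (b j i))"
      using that by (intro member_le_sum[of j _ "\<lambda>j. \<Sum>i<r. abs_inf (b j i)"]) (auto intro: sum_nonneg)
    finally show ?thesis unfolding B_def by simp
  next
    case False
    then show ?thesis using b[OF that] B by (auto simp: vec_def)
  qed
  have w_le: "abs_inf (w i) \<le> B" if "w \<in> L" for w i
  proof -
    obtain c where c: "w = (\<lambda>i. \<Sum>j<r. c j * b j i)" "\<And>j. j < r \<Longrightarrow> abs_inf (c j) \<le> 1"
      using \<open>w \<in> L\<close> unfolding L_eq by auto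
    show ?thesis unfolding c(1)
    proof (intro abs_inf_sum_le)
      fix j assume "j \<in> {..<r}"
      then have "abs_inf (c j) * abs_inf (b j i) \<le> 1 * B"
        using c(2) b_le by (intro mult_mono) auto
      then show "abs_inf (c j * b j i) \<le> B" by (simp add: abs_inf_mult)
    qed (use B in auto)
  qed
  have "lattice_norm L v \<in> lattice_scalars L v \<and> (\<forall>s\<in>lattice_scalars L v. lattice_norm L v \<le> s) \<and>
    (\<exists>n::int. lattice_norm L v = q powr n) \<and> (\<forall>i. abs_inf (v i) \<le> B * lattice_norm L v)"
    if v: "v \<in> vec r" "v \<noteq> (\<lambda>_. 0)" "lattice_scalars L v \<noteq> {}" for v
  proof -
    have le: "abs_inf (v i) \<le> B * s" if s: "s \<in> lattice_scalars L v" for s i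
    proof -
      obtain c w where "s = abs_inf c" "w \<in> L" "v = (\<lambda>i. c * w i)"
        using s unfolding lattice_scalars_def by auto
      then show ?thesis using w_le[of w i] by (simp add: abs_inf_mult mult.commute[of B] mult_left_mono)
    qed
    obtain i where i: "v i \<noteq> 0" using v(2) by auto
    obtain s0 where s0: "s0 \<in> lattice_scalars L v" using v(3) by auto
    have val: "\<exists>n::int. s = q powr n" if s: "s \<in> lattice_scalars L v" for s
    proof -
      obtain c w where c: "s = abs_inf c" "w \<in> L" "v = (\<lambda>i. c * w i)"
        using s unfolding lattice_scalars_def by auto
      then have "c \<noteq> 0" using i by auto
      then show ?thesis using c(1) abs_inf_powr by blast
    qed
    have "\<exists>s\<in>lattice_scalars L v. \<forall>s'\<in>lattice_scalars L v. s \<le> s'"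
    proof (rule discrete_minimum[of s0 _ q 1 "abs_inf (v i) / B"])
      show "abs_inf (v i) / B \<le> s" if "s \<in> lattice_scalars L v" for s
        using le[OF that, of i] B by (simp add: pos_divide_le_eq mult.commute)
    qed (use s0 val q_gt_1 i B in auto)
    then obtain s where s: "s \<in> lattice_scalars L v" "\<And>s'. s' \<in> lattice_scalars L v \<Longrightarrow> s \<le> s'" by auto
    then have "lattice_norm L v = s"
      unfolding lattice_norm_def lattice_scalars_def[symmetric] by (rule cInf_eq_minimum)
    with s val le show ?thesis by auto
  qed
  with B show ?thesis by blast
qed

lemma nonarch_normD:
  assumes "nonarch_norm r (M :: (nat \<Rightarrow> 'k fls) \<Rightarrow> real)"
  shows "x \<in> vec r \<Longrightarrow> 0 \<le> M x" "x \<in> vec r \<Longrightarrow> M x = 0 \<longleftrightarrow> x = (\<lambda>_. 0)"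
    "x \<in> vec r \<Longrightarrow> M (\<lambda>i. c * x i) = abs_inf c * M x"
    "x \<in> vec r \<Longrightarrow> y \<in> vec r \<Longrightarrow> M (\<lambda>i. x i + y i) \<le> max (M x) (M y)"
  using assms unfolding nonarch_norm_def by blast+

text \<open>A vector outside the span of one of the lattices has no meaningful \<^const>\<open>lattice_norm\<close>.
  Comparing the values at \<open>v\<close> and \<open>T v\<close> shows that such a lattice has weight \<open>0\<close>, so there is no
  need to show that \<open>r\<close> independent vectors span.\<close>

lemma BT_rat_norm:
  assumes "x \<in> BT_rat r"
  shows "\<exists>M :: (nat \<Rightarrow> 'k fls) \<Rightarrow> real. \<exists>D C. nonarch_norm r M \<and> x = homothety_class r M \<and> D > 0 \<and> C > 0 \<and>
    (\<forall>v\<in>vec r. v \<noteq> (\<lambda>_. 0) \<longrightarrow> (\<exists>n::int. M v = q powr (n / real D))) \<and>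
    (\<forall>v\<in>vec r. \<forall>i. C * abs_inf (v i) \<le> M v)"
proof -
  obtain k t and L :: "nat \<Rightarrow> (nat \<Rightarrow> 'k fls) set" where x: "x \<in> BT r" "bt_simplex r k L"
    and t: "\<And>i. i \<le> k \<Longrightarrow> t i \<in> \<rat>" "\<And>i. i \<le> k \<Longrightarrow> t i \<ge> 0" "(\<Sum>i\<le>k. t i) = 1"
    and x_eq: "x = bt_point r k L t"
    using assms unfolding BT_rat_def by blast
  define M where "M = (\<lambda>v. \<Prod>i\<le>k. lattice_norm (L i) v powr t i)"
  obtain N where N: "x = homothety_class r N" "nonarch_norm r N"
    using x(1) unfolding BT_def by auto
  have xM: "x = homothety_class r M" unfolding x_eq bt_point_def M_def ..
  then obtain c where c: "c > 0" "\<And>v. v \<in> vec r \<Longrightarrow> M v = c * N v"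
    using homothety_class_self[of M r] unfolding xM[symmetric] unfolding N(1)
    by (auto simp: homothety_class_def)
  \<comment> \<open>The product of lattice norms is a positive multiple of the norm N that
    membership in \<open>BT\<close> provides, and inherits its axioms.\<close>
  have M: "nonarch_norm r M"
    unfolding nonarch_norm_def
  proof (intro conjI ballI allI)
    fix v :: "nat \<Rightarrow> 'k fls" assume v: "v \<in> vec r"
    show "0 \<le> M v" using v c nonarch_normD(1)[OF N(2) v] by simp
    show "M v = 0 \<longleftrightarrow> v = (\<lambda>_. 0)" using v c nonarch_normD(2)[OF N(2) v] by simp
    show "M (\<lambda>i. a * v i) = abs_inf a * M v" for a
      using v c(2) nonarch_normD(3)[OF N(2) v] by (simp add: vec_scale)
    fix w :: "nat \<Rightarrow> 'k fls" assume w: "w \<in> vec r"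
    have "M (\<lambda>i. v i + w i) = c * N (\<lambda>i. v i + w i)" using v w by (intro c(2) vec_add)
    also have "\<dots> \<le> c * max (N v) (N w)"
      using nonarch_normD(4)[OF N(2) v w] c(1) by (intro mult_left_mono) auto
    also have "\<dots> = max (M v) (M w)" using c v w by (simp add: max_mult_distrib_left)
    finally show "M (\<lambda>i. v i + w i) \<le> max (M v) (M w)" .
  qed
  have lat: "O_lattice r (L i)" if "i \<le> k" for i using x(2) that unfolding bt_simplex_def by auto
  obtain B where B: "\<And>i. i \<le> k \<Longrightarrow> B i > 0"
    and LN: "\<And>i v. i \<le> k \<Longrightarrow> v \<in> vec r \<Longrightarrow> v \<noteq> (\<lambda>_. 0) \<Longrightarrow> lattice_scalars (L i) v \<noteq> {} \<Longrightarrow>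
      lattice_norm (L i) v \<in> lattice_scalars (L i) v \<and>
      (\<forall>s\<in>lattice_scalars (L i) v. lattice_norm (L i) v \<le> s) \<and>
      (\<exists>n::int. lattice_norm (L i) v = q powr n) \<and> (\<forall>j. abs_inf (v j) \<le> B i * lattice_norm (L i) v)"
    using lattice_norm_minimum[OF lat] by metis
  define T :: "'k fls" where "T = fls_X_intpow (-1)"
  have "abs_inf T = q" using q_gt_1 unfolding T_def abs_inf_X_intpow by simp
  then have T: "T \<noteq> 0" "abs_inf T = q" using q_gt_1 by auto
  have weight0: "t i = 0" if v: "v \<in> vec r" "v \<noteq> (\<lambda>_. 0)" and i: "i \<le> k" "lattice_scalars (L i) v = {}" for v i
  proof -
    define E where "E = {i. i \<le> k \<and> lattice_scalars (L i) v = {}}"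
    let ?v = "\<lambda>i. T * v i"
    have scalars_T: "lattice_scalars (L i) ?v = (\<lambda>s. q * s) ` lattice_scalars (L i) v" for i
      using lattice_scalars_scale[OF T(1)] T(2) by auto
    have v': "?v \<in> vec r" "?v \<noteq> (\<lambda>_. 0)"
      using v T(1) vec_scale by (auto simp: fun_eq_iff)
    \<comment> \<open>For i in E both sides are the same default value, the infimum of the empty
      set; for the other i the minimum scales by |T| = q.\<close>
    have scale: "lattice_norm (L i) ?v = (if i \<in> E then 1 else q) * lattice_norm (L i) v" if i: "i \<le> k" for i
    proof (cases "i \<in> E")
      case True
      then show ?thesis
        using scalars_T[of i] unfolding E_def lattice_norm_def lattice_scalars_def[symmetric] by auto
    next
      case False
      then have ne: "lattice_scalars (L i) v \<noteq> {}" "lattice_scalars (L i) ?v \<noteq> {}"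
        using i scalars_T[of i] unfolding E_def by auto
      note 1 = LN[OF i v ne(1)] and 2 = LN[OF i v' ne(2)]
      have "lattice_norm (L i) ?v \<le> q * lattice_norm (L i) v"
        using 1 2 unfolding scalars_T by auto
      moreover have "q * lattice_norm (L i) v \<le> lattice_norm (L i) ?v"
        using 1 2 q_gt_1 unfolding scalars_T by auto
      ultimately show ?thesis using False by simp
    qed
    have "M ?v = (\<Prod>i\<le>k. (if i \<in> E then 1 else q) powr t i * lattice_norm (L i) v powr t i)"
      unfolding M_def
    proof (rule prod.cong[OF refl])
      fix i assume i: "i \<in> {..k}"
      show "lattice_norm (L i) ?v powr t i = (if i \<in> E then 1 else q) powr t i * lattice_norm (L i) v powr t i"
      proof (cases "i \<in> E")
        case False
        then have "lattice_norm (L i) v > 0"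
          using LN[OF _ v, of i] i q_gt_1 by (auto simp: E_def)
        then show ?thesis using scale[of i] i False q_gt_1 by (simp add: powr_mult)
      qed (use scale[of i] i in simp)
    qed
    also have "\<dots> = (\<Prod>i\<le>k. q powr (if i \<in> E then 0 else t i)) * M v"
      unfolding M_def prod.distrib using q_gt_1 by (intro arg_cong2[of _ _ _ _ "(*)"] prod.cong) auto
    also have "(\<Prod>i\<le>k. q powr (if i \<in> E then 0 else t i)) = q powr (\<Sum>i\<le>k. if i \<in> E then 0 else t i)"
      using q_gt_1 by (subst powr_sum) auto
    finally have "q powr (\<Sum>i\<le>k. if i \<in> E then 0 else t i) * M v = q * M v"
      using nonarch_normD(3)[OF M v(1), of T] T(2) by metis
    moreover have "M v \<noteq> 0" using nonarch_normD(2)[OF M v(1)] v(2) by simp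
    ultimately have "q powr (\<Sum>i\<le>k. if i \<in> E then 0 else t i) = q powr 1" using q_gt_1 by simp
    \<comment> \<open>The weights off E already add up to 1, so the nonnegative weights on E
      vanish.\<close>
    then have "(\<Sum>i\<le>k. if i \<in> E then 0 else t i) = 1" using q_gt_1 by (subst (asm) powr_inj) auto
    then have "(\<Sum>i\<le>k. t i - (if i \<in> E then 0 else t i)) = 0"
      unfolding sum_subtractf using t(3) by simp
    then have "\<forall>i\<in>{..k}. t i - (if i \<in> E then 0 else t i) = 0"
      using t(2) by (subst (asm) sum_nonneg_eq_0_iff) auto
    then have "t i - (if i \<in> E then 0 else t i) = 0" using i(1) by blast
    then show ?thesis using i unfolding E_def by simp
  qed
  \<comment> \<open>Since \<open>0 powr 0 = 0\<close>, even a factor of weight 0 could vanish; M v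
    \<noteq> 0 excludes this, and then such a factor is 1.\<close>
  have factor_pos: "lattice_norm (L i) v powr t i > 0"
    if "v \<in> vec r" "v \<noteq> (\<lambda>_. 0)" "i \<le> k" for v i
  proof -
    have "M v \<noteq> 0" using nonarch_normD(2)[OF M that(1)] that(2) by simp
    then have "lattice_norm (L i) v powr t i \<noteq> 0" using that(3) unfolding M_def by auto
    then show ?thesis by simp
  qed
  obtain D where D: "D > 0" "\<And>i. i \<le> k \<Longrightarrow> \<exists>a::int. t i = a / real D"
    using common_denominator[of k t] t(1) by auto
  then obtain a :: "nat \<Rightarrow> int" where a: "\<And>i. i \<le> k \<Longrightarrow> t i = a i / real D" by metis
  have M_vals: "\<exists>n::int. M v = q powr (n / real D)" if v: "v \<in> vec r" "v \<noteq> (\<lambda>_. 0)" for v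
  proof -
    have "\<exists>n::int. lattice_norm (L i) v powr t i = q powr (n / real D)" if i: "i \<le> k" for i
    proof (cases "lattice_scalars (L i) v = {}")
      case True
      then have "t i = 0" using weight0 v i by blast
      then have "lattice_norm (L i) v powr t i = q powr (of_int 0 / real D)"
        using factor_pos[OF v i] q_gt_1 by auto
      then show ?thesis by blast
    next
      case False
      then obtain n :: int where "lattice_norm (L i) v = q powr n" using LN[OF i v] by auto
      then have "lattice_norm (L i) v powr t i = q powr (of_int (n * a i) / real D)"
        using a[OF i] by (simp add: powr_powr)
      then show ?thesis by blast
    qed
    then obtain n :: "nat \<Rightarrow> int" where n: "\<And>i. i \<le> k \<Longrightarrow> lattice_norm (L i) v powr t i = q powr (n i / real D)"
      by metis
    have "M v = q powr (\<Sum>i\<le>k. n i / real D)"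
      unfolding M_def using n q_gt_1 by (subst powr_sum) auto
    also have "(\<Sum>i\<le>k. n i / real D) = of_int (\<Sum>i\<le>k. n i) / real D"
      by (simp add: sum_divide_distrib)
    finally show ?thesis by blast
  qed
  \<comment> \<open>Weighted product of the bounds |v_j| <= B_i ||v||_i; as the weights add up to 1,
    |v_j| comes out with exponent 1.\<close>
  define C where "C = (\<Prod>i\<le>k. inverse (B i) powr t i)"
  have C: "C > 0" unfolding C_def using less_imp_neq[OF B] by (intro prod_pos) (auto dest: sym)
  have "C * abs_inf (v j) \<le> M v" if v: "v \<in> vec r" for v j
  proof (cases "v j = 0")
    case True
    then show ?thesis using nonarch_normD(1)[OF M v] by simp
  next
    case False
    then have v0: "v \<noteq> (\<lambda>_. 0)" by auto
    have "C * abs_inf (v j) = (\<Prod>i\<le>k. inverse (B i) powr t i) * (\<Prod>i\<le>k. abs_inf (v j) powr t i)"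
      using t(3) False unfolding C_def by (subst powr_sum[symmetric]) auto
    also have "\<dots> = (\<Prod>i\<le>k. (inverse (B i) * abs_inf (v j)) powr t i)"
      using B by (subst prod.distrib[symmetric]) (auto intro!: prod.cong simp: powr_mult less_imp_le)
    also have "\<dots> \<le> M v"
      unfolding M_def
    proof (intro prod_mono conjI)
      fix i assume "i \<in> {..k}"
      then have i: "i \<le> k" by simp
      show "(inverse (B i) * abs_inf (v j)) powr t i \<le> lattice_norm (L i) v powr t i"
      proof (cases "lattice_scalars (L i) v = {}")
        case True
        then have "t i = 0" using weight0 v v0 i by blast
        then show ?thesis using factor_pos[OF v v0 i] by auto
      next
        case ne: False
        then have "abs_inf (v j) \<le> B i * lattice_norm (L i) v" using LN[OF i v v0] by auto
        then have "inverse (B i) * abs_inf (v j) \<le> lattice_norm (L i) v"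
          using B[OF i] by (simp add: field_simps)
        then show ?thesis using B[OF i] t(2)[OF i] by (intro powr_mono2) auto
      qed
    qed simp
    finally show ?thesis .
  qed
  with M xM D(1) C M_vals show ?thesis by blast
qed

text \<open>Non-archimedean Gram-Schmidt: e_j is proportional to a vector of least norm among those
  supported on 0, ..., j with j-th entry 1. The lower bound C and the discreteness of the values
  provide it, and its minimality is orthogonality to the earlier vectors.\<close>

lemma orthogonal_basis:
  fixes M :: "(nat \<Rightarrow> 'k fls) \<Rightarrow> real"
  assumes M: "nonarch_norm r M" and D: "D > 0" and C: "C > 0"
    and vals: "\<And>v. v \<in> vec r \<Longrightarrow> v \<noteq> (\<lambda>_. 0) \<Longrightarrow> \<exists>n::int. M v = q powr (n / real D)"
    and lower: "\<And>v i. v \<in> vec r \<Longrightarrow> C * abs_inf (v i) \<le> M v"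
  shows "\<exists>e. (\<forall>j<r. e j \<in> vec r \<and> 1 \<le> M (e j) \<and> M (e j) < q) \<and>
    (\<forall>v\<in>vec r. \<exists>a\<in>vec r. v = vsum r e a) \<and>
    (\<forall>a. \<forall>j<r. abs_inf (a j) * M (e j) \<le> M (vsum r e a))"
proof -
  note Md = nonarch_normD[OF M]
  have "\<exists>e\<in>vec (Suc j). e j \<noteq> 0 \<and> 1 \<le> M e \<and> M e < q \<and>
      (\<forall>w\<in>vec (Suc j). abs_inf (w j) * M e \<le> abs_inf (e j) * M w)" if j: "j < r" for j
  proof -
    have sub: "w \<in> vec r" if "w \<in> vec (Suc j)" for w :: "nat \<Rightarrow> 'k fls"
      using vec_mono[OF that] j by simp
    let ?S = "M ` {w \<in> vec (Suc j). w j = 1}"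
    let ?\<delta> = "\<lambda>i. if i = j then 1 else 0 :: 'k fls"
    have "\<exists>x\<in>?S. \<forall>y\<in>?S. x \<le> y"
    proof (rule discrete_minimum[where q = q and D = D and m = C])
      show "M ?\<delta> \<in> ?S" by (auto simp: vec_def)
      show "\<exists>n::int. x = q powr (n / real D)" if "x \<in> ?S" for x
        using that vals[OF sub] by fastforce
      show "C \<le> x" if x: "x \<in> ?S" for x
      proof -
        obtain w where w: "w \<in> vec (Suc j)" "w j = 1" "x = M w" using x by auto
        show ?thesis using lower[OF sub[OF w(1)], of j] w by simp
      qed
    qed (use D C q_gt_1 in auto)
    then obtain e0 where e0: "e0 \<in> vec (Suc j)" "e0 j = 1"
      and min: "\<And>w. w \<in> vec (Suc j) \<Longrightarrow> w j = 1 \<Longrightarrow> M e0 \<le> M w" by auto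
    have e0_pos: "M e0 > 0"
      using Md(1,2)[OF sub[OF e0(1)]] e0(2) by (metis less_eq_real_def zero_neq_one)
    have min': "abs_inf (w j) * M e0 \<le> M w" if w: "w \<in> vec (Suc j)" for w
    proof (cases "w j = 0")
      case True
      then show ?thesis using Md(1)[OF sub[OF w]] by simp
    next
      case False
      have "M e0 \<le> M (\<lambda>i. inverse (w j) * w i)"
        using False w by (intro min vec_scale) auto
      also have "\<dots> = inverse (abs_inf (w j)) * M w"
        using Md(3)[OF sub[OF w]] by (simp add: abs_inf_inverse)
      finally show ?thesis using False by (simp add: field_simps)
    qed
    \<comment> \<open>The multiplier below has absolute value q^(-m), which moves the norm into [1,
      q).\<close>
    define m where "m = \<lfloor>log q (M e0)\<rfloor>"
    define e where "e = (\<lambda>i. fls_X_intpow m * e0 i)"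
    have X: "abs_inf (fls_X_intpow m :: 'k fls) = q powr of_int (- m)" by (rule abs_inf_X_intpow)
    have Me: "M e = q powr of_int (- m) * M e0"
      unfolding e_def using Md(3)[OF sub[OF e0(1)]] X by simp
    have "M e = q powr (log q (M e0) - m)"
      using e0_pos q_gt_1 by (simp add: Me powr_diff powr_minus field_simps)
    moreover have "q powr 0 \<le> q powr (log q (M e0) - m)"
      unfolding m_def using q_gt_1 by (intro powr_mono) auto
    moreover have "q powr (log q (M e0) - m) < q powr 1"
      unfolding m_def using q_gt_1 by (intro powr_less_mono) linarith+
    ultimately have "1 \<le> M e" "M e < q" using q_gt_1 by auto
    moreover have "e \<in> vec (Suc j)" unfolding e_def using e0(1) by (rule vec_scale)
    moreover have ej: "e j = fls_X_intpow m" unfolding e_def using e0(2) by simp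
    moreover have "abs_inf (w j) * M e \<le> abs_inf (e j) * M w" if "w \<in> vec (Suc j)" for w
      using mult_left_mono[OF min'[OF that], of "q powr of_int (- m)"] unfolding ej X Me
      by (simp only: mult_ac powr_ge_zero)
    moreover have "e j \<noteq> 0" unfolding ej by simp
    ultimately show ?thesis by blast
  qed
  then obtain e where e: "\<And>j. j < r \<Longrightarrow> e j \<in> vec (Suc j)" "\<And>j. j < r \<Longrightarrow> e j j \<noteq> 0"
    "\<And>j. j < r \<Longrightarrow> 1 \<le> M (e j)" "\<And>j. j < r \<Longrightarrow> M (e j) < q"
    and min: "\<And>j w. j < r \<Longrightarrow> w \<in> vec (Suc j) \<Longrightarrow> abs_inf (w j) * M (e j) \<le> abs_inf (e j j) * M w"
    by metis
  have e_vec: "e j \<in> vec r" if "j < r" for j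
    using vec_mono[OF e(1)[OF that]] that by simp
  have vs: "vsum k e a \<in> vec k" if "k \<le> r" for k a
  proof (rule vsum_vec)
    fix j assume "j < k"
    then show "e j \<in> vec k" using vec_mono[OF e(1)[of j], of k] that by simp
  qed
  have span: "\<exists>a\<in>vec k. v = vsum k e a" if "k \<le> r" "v \<in> vec k" for k v
    using that
  proof (induction k arbitrary: v)
    case 0
    then show ?case by (intro bexI[of _ "\<lambda>_. 0"]) (auto simp: vsum_def vec_def)
  next
    case (Suc k)
    define c where "c = v k / e k k"
    let ?w = "\<lambda>i. v i - c * e k i"
    have ek: "e k \<in> vec (Suc k)" "e k k \<noteq> 0" using e(1,2)[of k] Suc.prems(1) by auto
    have "?w i = 0" if "i \<ge> k" for i
      using ek Suc.prems(2) that by (cases "i = k") (auto simp: c_def vec_def)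
    then have "?w \<in> vec k" by (simp add: vec_def)
    then obtain a where a: "a \<in> vec k" "?w = vsum k e a" using Suc.IH Suc.prems(1) by fastforce
    have "v = vsum (Suc k) e (a(k := c))"
    proof
      fix i
      have "v i - c * e k i = (\<Sum>j<k. a j * e j i)" using a(2) unfolding vsum_def by metis
      then show "v i = vsum (Suc k) e (a(k := c)) i" by (simp add: vsum_def algebra_simps)
    qed
    moreover have "a(k := c) \<in> vec (Suc k)" using a(1) by (auto simp: vec_def)
    ultimately show ?case by blast
  qed
  have orth: "\<forall>j<k. abs_inf (a j) * M (e j) \<le> M (vsum k e a)" if "k \<le> r" for k a
    using that
  proof (induction k)
    case (Suc k)
    let ?f = "vsum (Suc k) e a"
    have k: "k < r" using Suc.prems by simp
    have f: "?f \<in> vec (Suc k)" "?f \<in> vec r"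
      using vs[of "Suc k" a] Suc.prems vec_mono by blast+
    have f_eq: "?f = (\<lambda>i. vsum k e a i + a k * e k i)" by (simp add: vsum_def)
    \<comment> \<open>Among e_0, ..., e_k only e_k has a nonzero k-th entry, so minimality of e_k
      bounds the last summand by the norm of the whole sum. The remaining sum is the difference of
      the two, so it obeys the same bound.\<close>
    have "?f k = a k * e k k" using vs[of k a] k unfolding f_eq by (simp add: vec_def)
    then have "abs_inf (a k) * abs_inf (e k k) * M (e k) \<le> abs_inf (e k k) * M ?f"
      using min[OF k f(1)] by (simp add: abs_inf_mult)
    then have "abs_inf (e k k) * (abs_inf (a k) * M (e k)) \<le> abs_inf (e k k) * M ?f"
      by (simp add: mult_ac)
    then have last: "abs_inf (a k) * M (e k) \<le> M ?f"
      using e(2)[OF k] by simp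
    have "vsum k e a = (\<lambda>i. ?f i + (- a k) * e k i)" unfolding f_eq by auto
    then have "M (vsum k e a) \<le> max (M ?f) (M (\<lambda>i. (- a k) * e k i))"
      using Md(4)[OF f(2) vec_scale[OF e_vec[OF k], of "- a k"]] by metis
    also have "M (\<lambda>i. (- a k) * e k i) = abs_inf (a k) * M (e k)"
      using Md(3)[OF e_vec[OF k], of "- a k"] by (metis abs_val_iota abs_val_minus iota_minus)
    finally have "M (vsum k e a) \<le> M ?f" using last by simp
    then show ?case using Suc last by (auto simp: less_Suc_eq intro: order.trans)
  qed simp
  show ?thesis using e(3,4) e_vec span[of r] orth[of r] by blast
qed

end


section \<open>Uniform closures of function algebras\<close>

locale bounded_function_algebra =
  fixes X :: "'p set" and H :: "('p \<Rightarrow> 'c::nonarch_field) set"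
  assumes const_H: "(\<lambda>_. c) \<in> H"
    and add_H: "f \<in> H \<Longrightarrow> g \<in> H \<Longrightarrow> (\<lambda>x. f x + g x) \<in> H"
    and mult_H: "f \<in> H \<Longrightarrow> g \<in> H \<Longrightarrow> (\<lambda>x. f x * g x) \<in> H"
    and bounded_H: "f \<in> H \<Longrightarrow> \<exists>b. \<forall>x\<in>X. abs_val (f x) \<le> b"
begin

text \<open>The completion of H for the supremum norm on X, realised by total functions whose values
  off X are arbitrary, as in the convention for algebras of functions.\<close>

definition uclosure :: "('p \<Rightarrow> 'c) set" where
  "uclosure = {f. \<forall>\<epsilon>>0. \<exists>h\<in>H. \<forall>x\<in>X. abs_val (f x - h x) \<le> \<epsilon>}"

lemma uclosureD: "f \<in> uclosure \<Longrightarrow> \<epsilon> > 0 \<Longrightarrow> \<exists>h\<in>H. \<forall>x\<in>X. abs_val (f x - h x) \<le> \<epsilon>"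
  unfolding uclosure_def by blast

lemma H_uclosure: "f \<in> H \<Longrightarrow> f \<in> uclosure"
  unfolding uclosure_def by (auto intro!: bexI[of _ f])

lemma uclosure_limit:
  assumes "\<And>\<epsilon>. \<epsilon> > 0 \<Longrightarrow> \<exists>h\<in>uclosure. \<forall>x\<in>X. abs_val (f x - h x) \<le> \<epsilon>"
  shows "f \<in> uclosure"
  unfolding uclosure_def
proof (intro CollectI allI impI)
  fix \<epsilon> :: real assume "\<epsilon> > 0"
  then obtain h where h: "h \<in> uclosure" "\<And>x. x \<in> X \<Longrightarrow> abs_val (f x - h x) \<le> \<epsilon>" using assms by blast
  obtain h' where h': "h' \<in> H" "\<And>x. x \<in> X \<Longrightarrow> abs_val (h x - h' x) \<le> \<epsilon>"
    using uclosureD[OF h(1) \<open>\<epsilon> > 0\<close>] by blast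
  show "\<exists>h\<in>H. \<forall>x\<in>X. abs_val (f x - h x) \<le> \<epsilon>"
    using h' h(2) abs_val_diff_trans by (intro bexI[of _ h']) blast+
qed

lemma uclosure_cong: "f \<in> uclosure \<Longrightarrow> (\<And>x. x \<in> X \<Longrightarrow> f x = g x) \<Longrightarrow> g \<in> uclosure"
  by (rule uclosure_limit) (auto intro!: bexI[of _ f])

lemma uclosure_bounded:
  assumes "f \<in> uclosure"
  shows "\<exists>b>0. \<forall>x\<in>X. abs_val (f x) \<le> b"
proof -
  obtain h where h: "h \<in> H" "\<And>x. x \<in> X \<Longrightarrow> abs_val (f x - h x) \<le> 1"
    using uclosureD[OF assms, of 1] by auto
  obtain b where b: "\<And>x. x \<in> X \<Longrightarrow> abs_val (h x) \<le> b" using bounded_H[OF h(1)] by auto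
  have "abs_val (f x) \<le> max 1 b" if "x \<in> X" for x
    using abs_val_add_le[of "f x - h x" "max 1 b" "h x"] h(2)[OF that] b[OF that] by simp
  then show ?thesis by (intro exI[of _ "max 1 b"]) auto
qed

lemma uclosure_const: "(\<lambda>_. c) \<in> uclosure"
  by (intro H_uclosure const_H)

lemma uclosure_add:
  assumes "f \<in> uclosure" "g \<in> uclosure"
  shows "(\<lambda>x. f x + g x) \<in> uclosure"
  unfolding uclosure_def
proof (intro CollectI allI impI)
  fix \<epsilon> :: real assume "\<epsilon> > 0"
  then obtain f' g' where *: "f' \<in> H" "\<And>x. x \<in> X \<Longrightarrow> abs_val (f x - f' x) \<le> \<epsilon>"
    "g' \<in> H" "\<And>x. x \<in> X \<Longrightarrow> abs_val (g x - g' x) \<le> \<epsilon>"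
    using uclosureD[OF assms(1)] uclosureD[OF assms(2)] by meson
  have "abs_val (f x + g x - (f' x + g' x)) \<le> \<epsilon>" if "x \<in> X" for x
    using abs_val_add_le[OF *(2,4)[OF that]] by (simp add: algebra_simps)
  with add_H[OF *(1,3)] show "\<exists>h\<in>H. \<forall>x\<in>X. abs_val (f x + g x - h x) \<le> \<epsilon>"
    by (intro bexI[of _ "\<lambda>x. f' x + g' x"]) auto
qed

lemma uclosure_mult:
  assumes "f \<in> uclosure" "g \<in> uclosure"
  shows "(\<lambda>x. f x * g x) \<in> uclosure"
  unfolding uclosure_def
proof (intro CollectI allI impI)
  fix \<epsilon> :: real assume \<epsilon>: "\<epsilon> > 0"
  obtain b where b: "b > 0" "\<And>x. x \<in> X \<Longrightarrow> abs_val (f x) \<le> b"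
    using uclosure_bounded[OF assms(1)] by auto
  \<comment> \<open>g' comes first, because the accuracy required of f' depends on a bound for
    g'.\<close>
  obtain g' where g': "g' \<in> H" "\<And>x. x \<in> X \<Longrightarrow> abs_val (g x - g' x) \<le> \<epsilon> / b"
    using uclosureD[OF assms(2), of "\<epsilon> / b"] \<epsilon> b(1) by auto
  obtain b' where b': "b' > 0" "\<And>x. x \<in> X \<Longrightarrow> abs_val (g' x) \<le> b'"
    using uclosure_bounded[OF H_uclosure[OF g'(1)]] by auto
  obtain f' where f': "f' \<in> H" "\<And>x. x \<in> X \<Longrightarrow> abs_val (f x - f' x) \<le> \<epsilon> / b'"
    using uclosureD[OF assms(1), of "\<epsilon> / b'"] \<epsilon> b'(1) by auto
  have "abs_val (f x * g x - f' x * g' x) \<le> \<epsilon>" if x: "x \<in> X" for x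
  proof -
    have "abs_val (f x) * abs_val (g x - g' x) \<le> b * (\<epsilon> / b)"
      using b g'(2) x by (intro mult_mono) auto
    moreover have "abs_val (f x - f' x) * abs_val (g' x) \<le> (\<epsilon> / b') * b'"
      using b' f'(2) x \<epsilon> by (intro mult_mono) auto
    ultimately have "abs_val (f x * (g x - g' x) + (f x - f' x) * g' x) \<le> \<epsilon>"
      using b(1) b'(1) by (intro abs_val_add_le) (auto simp: abs_val_mult)
    then show ?thesis by (simp add: algebra_simps)
  qed
  with mult_H[OF f'(1) g'(1)] show "\<exists>h\<in>H. \<forall>x\<in>X. abs_val (f x * g x - h x) \<le> \<epsilon>"
    by (intro bexI[of _ "\<lambda>x. f' x * g' x"]) auto
qed

lemma uclosure_sum: "(\<And>i. i \<in> I \<Longrightarrow> f i \<in> uclosure) \<Longrightarrow> (\<lambda>x. \<Sum>i\<in>I. f i x) \<in> uclosure"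
  by (induction I rule: infinite_finite_induct) (auto intro: uclosure_const uclosure_add)

lemma uclosure_prod: "(\<And>i. i \<in> I \<Longrightarrow> f i \<in> uclosure) \<Longrightarrow> (\<lambda>x. \<Prod>i\<in>I. f i x) \<in> uclosure"
  by (induction I rule: infinite_finite_induct) (auto intro: uclosure_const uclosure_mult)

lemma uclosure_power: "f \<in> uclosure \<Longrightarrow> (\<lambda>x. f x ^ k) \<in> uclosure"
  by (induction k) (auto intro: uclosure_const uclosure_mult)

text \<open>Truncation to the indices whose coefficient reaches \<epsilon> somewhere on X leaves a
  uniformly small tail. The coefficients are functions so that both Tate series and rational
  algebras are covered.\<close>

lemma uclosure_series:
  assumes a: "\<And>\<alpha>. \<alpha> \<in> multi_indices m \<Longrightarrow> a \<alpha> \<in> uclosure"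
    and fin: "\<And>\<epsilon>. \<epsilon> > 0 \<Longrightarrow> finite {\<alpha> \<in> multi_indices m. \<exists>x\<in>X. abs_val (a \<alpha> x) \<ge> \<epsilon>}"
    and \<phi>: "\<And>j. j < m \<Longrightarrow> \<phi> j \<in> uclosure" "\<And>j x. j < m \<Longrightarrow> x \<in> X \<Longrightarrow> abs_val (\<phi> j x) \<le> 1"
    and sum: "\<And>x. x \<in> X \<Longrightarrow> ((\<lambda>\<alpha>. a \<alpha> x * (\<Prod>j<m. \<phi> j x ^ \<alpha> j)) has_sum u x) (multi_indices m)"
  shows "u \<in> uclosure"
proof (rule uclosure_limit)
  fix \<epsilon> :: real assume \<epsilon>: "\<epsilon> > 0"
  define F where "F = {\<alpha> \<in> multi_indices m. \<exists>x\<in>X. abs_val (a \<alpha> x) \<ge> \<epsilon>}"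
  have "abs_val (u x - (\<Sum>\<alpha>\<in>F. a \<alpha> x * (\<Prod>j<m. \<phi> j x ^ \<alpha> j))) \<le> \<epsilon>" if x: "x \<in> X" for x
  proof (rule has_sum_approx[OF sum[OF x]])
    fix \<alpha> assume "\<alpha> \<in> multi_indices m - F"
    then have "abs_val (a \<alpha> x) \<le> \<epsilon>" unfolding F_def using x by force
    moreover have "abs_val (\<Prod>j<m. \<phi> j x ^ \<alpha> j) \<le> 1"
      unfolding abs_val_prod abs_val_power using \<phi>(2) x by (intro prod_le_1) (auto intro: power_le_one)
    ultimately have "abs_val (a \<alpha> x) * abs_val (\<Prod>j<m. \<phi> j x ^ \<alpha> j) \<le> \<epsilon> * 1"
      using \<epsilon> by (intro mult_mono) auto
    then show "abs_val (a \<alpha> x * (\<Prod>j<m. \<phi> j x ^ \<alpha> j)) \<le> \<epsilon>" by (simp add: abs_val_mult)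
  qed (use fin[OF \<epsilon>] \<epsilon> in \<open>auto simp: F_def\<close>)
  moreover have "(\<lambda>x. \<Sum>\<alpha>\<in>F. a \<alpha> x * (\<Prod>j<m. \<phi> j x ^ \<alpha> j)) \<in> uclosure"
    using a \<phi>(1) by (intro uclosure_sum uclosure_mult uclosure_prod uclosure_power) (auto simp: F_def)
  ultimately show "\<exists>h\<in>uclosure. \<forall>x\<in>X. abs_val (u x - h x) \<le> \<epsilon>"
    by (intro bexI[of _ "\<lambda>x. \<Sum>\<alpha>\<in>F. a \<alpha> x * (\<Prod>j<m. \<phi> j x ^ \<alpha> j)"]) auto
qed

lemma uclosure_tate_compose:
  assumes "g \<in> tate_algebra m" "\<And>x. x \<in> X \<Longrightarrow> \<Phi> x \<in> polydisc m"
    and "\<And>j. j < m \<Longrightarrow> (\<lambda>x. \<Phi> x j) \<in> uclosure"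
  shows "(\<lambda>x. g (\<Phi> x)) \<in> uclosure"
proof -
  obtain a where a: "\<And>\<epsilon>. \<epsilon> > 0 \<Longrightarrow> finite {\<alpha> \<in> multi_indices m. abs_val (a \<alpha>) \<ge> \<epsilon>}"
    and g: "\<And>z. z \<in> polydisc m \<Longrightarrow> ((\<lambda>\<alpha>. a \<alpha> * mpow m z \<alpha>) has_sum g z) (multi_indices m)"
    using assms(1) unfolding tate_algebra_def by auto
  show ?thesis
  proof (rule uclosure_series[of m "\<lambda>\<alpha> _. a \<alpha>" "\<lambda>j x. \<Phi> x j"])
    show "finite {\<alpha> \<in> multi_indices m. \<exists>x\<in>X. abs_val (a \<alpha>) \<ge> \<epsilon>}" if "\<epsilon> > 0" for \<epsilon>
      by (rule finite_subset[OF _ a[OF that]]) auto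
  qed (use assms(2,3) g in \<open>auto simp: polydisc_def intro: uclosure_const\<close>)
qed

end


section \<open>Fibres of the building map\<close>

text \<open>The norm \<^term>\<open>M\<close> has the orthogonal basis \<open>e\<^sub>0, \<dots>, e\<^sub>r\<^sub>-\<^sub>1\<close>. The linear form given by \<open>e\<^sub>j\<close>,
  divided by \<open>\<kappa>\<^sub>j\<close>, is a coordinate \<open>z\<^sub>j\<close> of absolute value \<open>1\<close> on the fibre.\<close>

locale building_fibre = complete_closure \<iota> q
  for \<iota> :: "'k::{field,finite} fls \<Rightarrow> 'c::nonarch_field" and q :: real +
  fixes r :: nat and M :: "(nat \<Rightarrow> 'k fls) \<Rightarrow> real" and e :: "nat \<Rightarrow> nat \<Rightarrow> 'k fls" and \<kappa> :: "nat \<Rightarrow> 'c"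
  assumes r_pos: "r > 0"
    and M: "nonarch_norm r M"
    and e_vec: "\<And>j. j < r \<Longrightarrow> e j \<in> vec r"
    and e_ge: "\<And>j. j < r \<Longrightarrow> 1 \<le> M (e j)" and e_less: "\<And>j. j < r \<Longrightarrow> M (e j) < q"
    and span: "\<And>v. v \<in> vec r \<Longrightarrow> \<exists>a\<in>vec r. v = vsum r e a"
    and orth: "\<And>a j. j < r \<Longrightarrow> abs_inf (a j) * M (e j) \<le> M (vsum r e a)"
    and abs_\<kappa>: "\<And>j. j < r \<Longrightarrow> abs_val (\<kappa> j) = M (e j)"
begin

lemmas Md = nonarch_normD[OF M]

lemma vsum_in_vec: "vsum r e a \<in> vec r"
  by (intro vsum_vec e_vec)

lemma \<kappa>_nz: "j < r \<Longrightarrow> \<kappa> j \<noteq> 0"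
  using abs_\<kappa>[of j] e_ge[of j] by auto

lemma M_vsum_le:
  assumes "\<And>j. j < r \<Longrightarrow> abs_inf (a j) * M (e j) \<le> b" "0 \<le> b"
  shows "M (vsum r e a) \<le> b"
proof -
  have "M (vsum k e a) \<le> b" if "k \<le> r" for k
    using that
  proof (induction k)
    case 0
    have "M (\<lambda>_. 0) = 0" using Md(2)[of "\<lambda>_. 0"] by (simp add: vec_def)
    then show ?case using assms(2) by (simp add: vsum_def)
  next
    case (Suc k)
    have v: "vsum k e a \<in> vec r" using Suc.prems by (intro vsum_vec e_vec) simp
    have ek: "e k \<in> vec r" using Suc.prems by (intro e_vec) simp
    have "vsum (Suc k) e a = (\<lambda>i. vsum k e a i + a k * e k i)" by (simp add: vsum_def)
    then have "M (vsum (Suc k) e a) \<le> max (M (vsum k e a)) (M (\<lambda>i. a k * e k i))"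
      using Md(4)[OF v vec_scale[OF ek, of "a k"]] by simp
    also have "M (\<lambda>i. a k * e k i) = abs_inf (a k) * M (e k)" by (rule Md(3)[OF ek])
    also have "max (M (vsum k e a)) (abs_inf (a k) * M (e k)) \<le> b"
      using Suc assms(1)[of k] by simp
    finally show ?case .
  qed
  then show ?thesis by simp
qed

text \<open>Orthogonality bounds the norm below by every term, the ultrametric inequality bounds it
  above by the largest one.\<close>

lemma M_vsum_attained:
  assumes "a \<in> vec r" "a \<noteq> (\<lambda>_. 0)"
  shows "\<exists>j<r. a j \<noteq> 0 \<and> M (vsum r e a) = abs_inf (a j) * M (e j)"
proof -
  obtain i where i: "a i \<noteq> 0" "i < r" using assms by (auto simp: vec_def fun_eq_iff) (metis not_le)
  let ?S = "(\<lambda>j. abs_inf (a j) * M (e j)) ` {..<r}"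
  have S: "finite ?S" "?S \<noteq> {}" using i by auto
  obtain j where j: "j < r" "Max ?S = abs_inf (a j) * M (e j)" using Max_in[OF S] by auto
  have le: "abs_inf (a k) * M (e k) \<le> abs_inf (a j) * M (e j)" if "k < r" for k
    using Max_ge[OF S(1), of "abs_inf (a k) * M (e k)"] that j(2) by auto
  have "M (vsum r e a) \<le> abs_inf (a j) * M (e j)"
    using le e_ge[OF j(1)] by (intro M_vsum_le) auto
  with orth[OF j(1), of a] have "M (vsum r e a) = abs_inf (a j) * M (e j)" by simp
  moreover have "abs_inf (a i) * M (e i) > 0" using i e_ge[of i] by (intro mult_pos_pos) auto
  then have "a j \<noteq> 0" using le[OF i(2)] by auto
  ultimately show ?thesis using j(1) by blast
qed

lemma M_vsum_pos: "a \<in> vec r \<Longrightarrow> a \<noteq> (\<lambda>_. 0) \<Longrightarrow> M (vsum r e a) > 0"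
  using M_vsum_attained[of a] e_ge by (metis abs_inf_pos_iff less_le_trans mult_pos_pos zero_less_one)

lemma vsum_inj:
  assumes "vsum r e a = vsum r e b" "j < r"
  shows "a j = b j"
proof -
  have "vsum r e (\<lambda>j. a j - b j) = (\<lambda>_. 0)"
    using assms(1) by (auto simp: vsum_def fun_eq_iff left_diff_distrib sum_subtractf)
  then have "abs_inf (a j - b j) * M (e j) \<le> 0"
    using orth[OF assms(2), of "\<lambda>j. a j - b j"] Md(2)[of "\<lambda>_. 0"] by (simp add: vec_def)
  then have "abs_inf (a j - b j) \<le> 0"
    using e_ge[OF assms(2)] by (metis less_le_trans mult_pos_pos not_less zero_less_one)
  then show ?thesis by (metis abs_inf_pos_iff eq_iff_diff_eq_0 not_less)
qed

section \<open>Linear forms and orthogonal coordinates\<close>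

definition lin_form :: "(nat \<Rightarrow> 'k fls) \<Rightarrow> (nat \<Rightarrow> 'c) \<Rightarrow> 'c" where
  "lin_form v \<omega> = (\<Sum>i<r. \<iota> (v i) * \<omega> i)"

text \<open>The linear form of the vector with coordinates a, rewritten in z; by orthogonality its
  Gauss norm is \<open>M (vsum r e a)\<close>.\<close>

definition form :: "(nat \<Rightarrow> 'k fls) \<Rightarrow> (nat \<Rightarrow> 'c) \<Rightarrow> 'c" where
  "form a z = (\<Sum>j<r. \<iota> (a j) * \<kappa> j * z j)"

definition unit_vec :: "nat \<Rightarrow> nat \<Rightarrow> 'k fls" where
  "unit_vec i = (\<lambda>j. if j = i then 1 else 0)"

text \<open>The coordinates of a standard basis vector with respect to e; thus
  \<open>form (dual i)\<close> expresses the i-th homogeneous coordinate in terms of z.\<close>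

definition dual :: "nat \<Rightarrow> nat \<Rightarrow> 'k fls" where
  "dual i = (SOME a. a \<in> vec r \<and> unit_vec i = vsum r e a)"

definition coords :: "(nat \<Rightarrow> 'c) \<Rightarrow> nat \<Rightarrow> 'c" where
  "coords \<omega> = (\<lambda>j. if j < r then lin_form (e j) \<omega> / \<kappa> j else 0)"

definition from_coords :: "(nat \<Rightarrow> 'c) \<Rightarrow> nat \<Rightarrow> 'c" where
  "from_coords z = (\<lambda>i. if i < r then form (dual i) z else 0)"

text \<open>The nonzero vectors over the finite field are the possible reductions. The dual vectors
  are adjoined so that every homogeneous coordinate is, up to a constant, a factor of
  \<open>form_prod\<close>.\<close>

definition test_vecs :: "(nat \<Rightarrow> 'k fls) set" where
  "test_vecs = {a \<in> vec r. a \<noteq> (\<lambda>_. 0) \<and> (\<forall>j. a j \<in> range fls_const)} \<union> dual ` {..<r}"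

definition form_scale :: "(nat \<Rightarrow> 'k fls) \<Rightarrow> 'c" where
  "form_scale a = (SOME c. abs_val c = M (vsum r e a))"

definition coord_fibre :: "(nat \<Rightarrow> 'c) set" where
  "coord_fibre = {z \<in> polydisc r. \<forall>a\<in>test_vecs. abs_val (form a z) = M (vsum r e a)}"

text \<open>The representatives whose norm is M itself and not just a multiple; what remains free is
  scaling by constants of absolute value 1.\<close>

definition fibre_cone :: "(nat \<Rightarrow> 'c) set" where
  "fibre_cone = {\<omega> \<in> vec r. \<forall>v\<in>vec r. abs_val (lin_form v \<omega>) = M v}"

definition form_prod :: "(nat \<Rightarrow> 'c) \<Rightarrow> 'c" where
  "form_prod z = (\<Prod>a\<in>test_vecs. form a z / form_scale a)"

lemma unit_vec_vec: "i < r \<Longrightarrow> unit_vec i \<in> vec r" by (auto simp: unit_vec_def vec_def)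

lemma dual: "i < r \<Longrightarrow> dual i \<in> vec r" "i < r \<Longrightarrow> vsum r e (dual i) = unit_vec i"
  using someI_ex[of "\<lambda>a. a \<in> vec r \<and> unit_vec i = vsum r e a"] span[OF unit_vec_vec[of i]]
  unfolding dual_def by (blast, metis (no_types, lifting))

lemma dual_nonzero: "i < r \<Longrightarrow> dual i \<noteq> (\<lambda>_. 0)"
proof
  assume i: "i < r" "dual i = (\<lambda>_. 0)"
  then have "unit_vec i = vsum r e (\<lambda>_. 0)" using dual(2) by metis
  then have "unit_vec i i = 0" by (simp add: vsum_def)
  then show False by (simp add: unit_vec_def)
qed

lemma test_vecs:
  assumes "a \<in> test_vecs"
  shows "a \<in> vec r" "a \<noteq> (\<lambda>_. 0)"
proof -
  consider "a \<in> vec r" "a \<noteq> (\<lambda>_. 0)" | i where "i < r" "a = dual i"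
    using assms unfolding test_vecs_def by auto
  then have "a \<in> vec r \<and> a \<noteq> (\<lambda>_. 0)"
    by cases (simp_all add: dual(1) dual_nonzero)
  then show "a \<in> vec r" "a \<noteq> (\<lambda>_. 0)" by auto
qed

lemma finite_test_vecs: "finite test_vecs"
proof -
  have "finite (range (fls_const :: 'k \<Rightarrow> 'k fls))" by simp
  then have "finite {a. \<forall>j. (j \<in> {..<r} \<longrightarrow> a j \<in> range (fls_const :: 'k \<Rightarrow> 'k fls)) \<and> (j \<notin> {..<r} \<longrightarrow> a j = 0)}"
    by (intro finite_set_of_finite_funs) auto
  then have "finite {a \<in> vec r. a \<noteq> (\<lambda>_. 0) \<and> (\<forall>j. a j \<in> range (fls_const :: 'k \<Rightarrow> 'k fls))}"
    by (rule rev_finite_subset) (auto simp: vec_def)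
  then show ?thesis unfolding test_vecs_def by simp
qed

lemma dual_test_vecs: "i < r \<Longrightarrow> dual i \<in> test_vecs" unfolding test_vecs_def by blast

lemma abs_form_scale: "a \<in> vec r \<Longrightarrow> a \<noteq> (\<lambda>_. 0) \<Longrightarrow> abs_val (form_scale a) = M (vsum r e a)"
proof -
  assume "a \<in> vec r" "a \<noteq> (\<lambda>_. 0)"
  then obtain j where "j < r" "M (vsum r e a) = abs_inf (a j) * M (e j)" using M_vsum_attained by blast
  then have "abs_val (\<iota> (a j) * \<kappa> j) = M (vsum r e a)" by (simp add: abs_val_mult abs_val_iota abs_\<kappa>)
  then show ?thesis unfolding form_scale_def by (rule someI)
qed

lemma form_scale_nonzero: "a \<in> test_vecs \<Longrightarrow> form_scale a \<noteq> 0"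
  using abs_form_scale[of a] M_vsum_pos[of a] test_vecs[of a] by auto

lemma lin_form_vsum: "lin_form (vsum r e a) \<omega> = (\<Sum>j<r. \<iota> (a j) * lin_form (e j) \<omega>)"
  unfolding lin_form_def vsum_def iota_sum iota_mult sum_distrib_left sum_distrib_right
  by (subst sum.swap) (simp add: mult.assoc)

lemma form_coords: "form a (coords \<omega>) = lin_form (vsum r e a) \<omega>"
  unfolding form_def lin_form_vsum by (intro sum.cong) (auto simp: coords_def \<kappa>_nz)

lemma lin_form_unit_vec: "i < r \<Longrightarrow> lin_form (unit_vec i) \<omega> = \<omega> i"
  unfolding lin_form_def unit_vec_def by (simp add: if_distrib if_distribR cong: if_cong)

lemma lin_form_scale: "lin_form v (\<lambda>i. c * \<omega> i) = c * lin_form v \<omega>"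
  unfolding lin_form_def sum_distrib_left by (intro sum.cong) auto

lemma form_scale: "form a (\<lambda>i. c * z i) = c * form a z"
  unfolding form_def sum_distrib_left by (intro sum.cong) auto

lemma form_scale_left: "form (\<lambda>i. c * a i) z = \<iota> c * form a z"
  unfolding form_def sum_distrib_left iota_mult by (intro sum.cong) auto

lemma form_diff: "form (\<lambda>j. a j - b j) z = form a z - form b z"
  unfolding form_def iota_diff left_diff_distrib sum_subtractf ..

lemma from_coords_coords: "\<omega> \<in> vec r \<Longrightarrow> from_coords (coords \<omega>) = \<omega>"
  unfolding from_coords_def form_coords by (auto simp: fun_eq_iff dual lin_form_unit_vec vec_def)

text \<open>Expand the vector in the standard basis and each standard vector in e; uniqueness of
  coordinates with respect to e returns a.\<close>

lemma lin_form_from_coords: "lin_form (vsum r e a) (from_coords z) = form a z"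
proof -
  let ?v = "vsum r e a"
  let ?b = "\<lambda>j. \<Sum>i<r. ?v i * dual i j"
  have "vsum r e ?b = ?v"
  proof
    fix k
    have "vsum r e ?b k = (\<Sum>i<r. ?v i * vsum r e (dual i) k)"
      unfolding vsum_def sum_distrib_left sum_distrib_right by (subst sum.swap) (simp add: mult.assoc)
    also have "\<dots> = (\<Sum>i<r. if k = i then ?v i else 0)"
      by (intro sum.cong) (auto simp: dual unit_vec_def)
    also have "\<dots> = ?v k"
      using vsum_in_vec[of a] by (auto simp: vec_def)
    finally show "vsum r e ?b k = ?v k" .
  qed
  then have b: "?b j = a j" if "j < r" for j using vsum_inj that by blast
  have "lin_form ?v (from_coords z) = (\<Sum>i<r. \<iota> (?v i) * form (dual i) z)"
    unfolding lin_form_def from_coords_def by (intro sum.cong) auto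
  also have "\<dots> = form ?b z"
    unfolding form_def iota_sum iota_mult sum_distrib_left sum_distrib_right
    by (subst sum.swap) (simp add: mult.assoc)
  also have "\<dots> = form a z"
    unfolding form_def by (intro sum.cong) (auto simp: b)
  finally show ?thesis .
qed

lemma vsum_unit_vec: "j < r \<Longrightarrow> vsum r e (unit_vec j) = e j"
  by (auto simp: vsum_def unit_vec_def fun_eq_iff if_distrib if_distribR cong: if_cong)

lemma form_unit_vec: "j < r \<Longrightarrow> form (unit_vec j) z = \<kappa> j * z j"
  unfolding form_def unit_vec_def by (simp add: if_distrib if_distribR cong: if_cong)

lemma coords_from_coords: "z \<in> vec r \<Longrightarrow> coords (from_coords z) = z"
proof
  fix j assume z: "z \<in> vec r"
  show "coords (from_coords z) j = z j"
  proof (cases "j < r")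
    case True
    then have "lin_form (e j) (from_coords z) = \<kappa> j * z j" using lin_form_from_coords[of "unit_vec
        j" z] by (simp add: vsum_unit_vec form_unit_vec)
    then show ?thesis using True \<kappa>_nz by (simp add: coords_def)
  qed (use z in \<open>auto simp: coords_def vec_def\<close>)
qed

lemma abs_form_le: "z \<in> polydisc r \<Longrightarrow> abs_val (form a z) \<le> M (vsum r e a)"
  unfolding form_def
proof (intro abs_val_sum_le)
  fix j assume *: "j \<in> {..<r}" "z \<in> polydisc r"
  then have "abs_val (\<iota> (a j) * \<kappa> j) * abs_val (z j) \<le> M (vsum r e a) * 1"
    using orth[of j a] Md(1)[OF vsum_in_vec]
    by (intro mult_mono) (auto simp: abs_val_mult abs_val_iota abs_\<kappa> polydisc_def)
  then show "abs_val (\<iota> (a j) * \<kappa> j * z j) \<le> M (vsum r e a)" by (simp add: abs_val_mult)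
qed (rule Md(1)[OF vsum_in_vec])

lemma abs_inf_le_1_decompose:
  assumes "abs_inf (f :: 'k fls) \<le> 1"
  shows "abs_inf (f - fls_const (fls_nth f 0)) \<le> 1 / q"
proof (cases "f - fls_const (fls_nth f 0) = 0")
  case False
  let ?g = "f - fls_const (fls_nth f 0)"
  have "f = 0 \<or> fls_subdegree f \<ge> 0"
  proof (cases "f = 0")
    case False
    then have "q powr of_int (- fls_subdegree f) \<le> q powr 0" using assms abs_inf_powr q_gt_1 by simp
    then have "real_of_int (- fls_subdegree f) \<le> 0" using q_gt_1 powr_le_cancel_iff by blast
    then show ?thesis by simp
  qed simp
  then have "fls_nth ?g k = 0" if "k < 1" for k
    using that fls_eq0_below_subdegree[of k f] by (cases "k = 0") auto
  then have "1 \<le> fls_subdegree ?g" by (rule fls_subdegree_geI[OF False])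
  then have "q powr of_int (- fls_subdegree ?g) \<le> q powr (- 1)"
    using q_gt_1 by (intro powr_mono) auto
  then show ?thesis using abs_inf_powr[OF False] q_gt_1 by (simp add: powr_minus divide_inverse)
qed (use q_gt_1 in simp)

text \<open>A vector with coefficients of absolute value at most \<open>1\<close>, one of them equal to \<open>1\<close>, is close
  to the vector of constant terms, which belongs to the finite set \<^const>\<open>test_vecs\<close>.\<close>

lemma abs_form_eq:
  assumes z: "z \<in> coord_fibre" and b: "b \<in> vec r"
  shows "abs_val (form b z) = M (vsum r e b)"
proof (cases "b = (\<lambda>_. 0)")
  case True
  then show ?thesis using Md(2)[of "\<lambda>_. 0"] by (simp add: form_def vsum_def vec_def)
next
  case False
  have zp: "z \<in> polydisc r" using z unfolding coord_fibre_def by simp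
  let ?S = "(\<lambda>j. abs_inf (b j)) ` {..<r}"
  have S: "finite ?S" "?S \<noteq> {}" using r_pos by auto
  obtain j0 where j0: "j0 < r" "Max ?S = abs_inf (b j0)" using Max_in[OF S] by auto
  have le: "abs_inf (b k) \<le> abs_inf (b j0)" for k
  proof (cases "k < r")
    case True
    then show ?thesis using Max_ge[OF S(1), of "abs_inf (b k)"] j0(2) by auto
  qed (use b in \<open>auto simp: vec_def\<close>)
  define c where "c = b j0"
  have "abs_inf c > 0"
  proof -
    obtain i where "b i \<noteq> 0" using False by auto
    then have "abs_inf (b i) > 0" by simp
    then show ?thesis using le[of i] unfolding c_def by linarith
  qed
  then have c: "c \<noteq> 0" by simp
  define b' where "b' = (\<lambda>j. inverse c * b j)"
  have b_eq: "b = (\<lambda>j. c * b' j)" unfolding b'_def using c by (simp add: fun_eq_iff flip: mult.assoc)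
  have b'_le: "abs_inf (b' j) \<le> 1" for j
  proof -
    have "abs_inf (b' j) = abs_inf (b j) / abs_inf c"
      unfolding b'_def abs_inf_mult abs_inf_inverse by (simp add: divide_inverse)
    then show ?thesis using le[of j] \<open>abs_inf c > 0\<close> by (simp add: c_def)
  qed
  have b'_j0: "b' j0 = 1" unfolding b'_def using c by (simp add: c_def)
  define a where "a = (\<lambda>j. fls_const (fls_nth (b' j) 0) :: 'k fls)"
  have a_j0: "a j0 = 1" unfolding a_def b'_j0 by simp
  have "a \<in> vec r" unfolding a_def b'_def using b by (auto simp: vec_def)
  then have a: "a \<in> test_vecs" using a_j0 unfolding test_vecs_def by (auto simp: a_def fun_eq_iff)
  define d where "d = (\<lambda>j. b' j - a j)"
  \<comment> \<open>Here M(e_j) < q is used: the error loses a factor q and drops below 1, while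
    a_j0 = 1 and M(e_j0) >= 1 keep the norm of a at least 1.\<close>
  have d_le: "abs_inf (d j) * M (e j) < 1" if "j < r" for j
  proof -
    have "abs_inf (d j) * M (e j) \<le> 1 / q * M (e j)"
      using abs_inf_le_1_decompose[OF b'_le[of j]] e_ge[OF that] unfolding d_def a_def
      by (intro mult_right_mono) auto
    also have "\<dots> < 1" using e_less[OF that] q_gt_1 by simp
    finally show ?thesis .
  qed
  have Md1: "M (vsum r e d) < 1"
  proof (cases "d = (\<lambda>_. 0)")
    case True
    then show ?thesis using Md(2)[of "\<lambda>_. 0"] by (simp add: vsum_def vec_def)
  next
    case False
    moreover have "d \<in> vec r" unfolding d_def b'_def using b \<open>a \<in> vec r\<close> by (auto simp: vec_def)
    ultimately show ?thesis using M_vsum_attained[of d] d_le by metis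
  qed
  have Ma: "1 \<le> M (vsum r e a)"
    using orth[OF j0(1), of a] a_j0 e_ge[OF j0(1)] by simp
  have "abs_val (form d z) < abs_val (form a z)"
    using abs_form_le[OF zp, of d] Md1 Ma a z unfolding coord_fibre_def by simp
  moreover have "form b' z = form a z + form d z" unfolding d_def form_diff by simp
  ultimately have 1: "abs_val (form b' z) = M (vsum r e a)"
    using abs_val_add_eq[of "form d z" "form a z"] a z unfolding coord_fibre_def by simp
  have "M (vsum r e b') = M (vsum r e a)"
  proof (rule antisym)
    have "vsum r e b' = (\<lambda>i. vsum r e a i + vsum r e d i)"
      unfolding d_def vsum_def by (simp add: fun_eq_iff left_diff_distrib sum_subtractf)
    then have "M (vsum r e b') \<le> max (M (vsum r e a)) (M (vsum r e d))"
      using Md(4)[OF vsum_in_vec vsum_in_vec] by metis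
    then show "M (vsum r e b') \<le> M (vsum r e a)" using Md1 Ma by simp
    show "M (vsum r e a) \<le> M (vsum r e b')"
      using 1 abs_form_le[OF zp, of b'] by simp
  qed
  moreover have "vsum r e b = (\<lambda>i. c * vsum r e b' i)"
    by (subst b_eq) (simp add: vsum_def fun_eq_iff sum_distrib_left mult.assoc)
  ultimately have "M (vsum r e b) = abs_inf c * M (vsum r e a)"
    using Md(3)[OF vsum_in_vec] by simp
  moreover have "form b z = \<iota> c * form b' z" by (subst b_eq) (rule form_scale_left)
  ultimately show ?thesis using 1 by (simp add: abs_val_mult abs_val_iota)
qed

lemma from_coords_fibre_cone: "z \<in> coord_fibre \<Longrightarrow> from_coords z \<in> fibre_cone"
  unfolding fibre_cone_def
proof (intro CollectI conjI ballI)
  fix v :: "nat \<Rightarrow> 'k fls" assume "z \<in> coord_fibre" "v \<in> vec r"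
  then obtain a where "a \<in> vec r" "v = vsum r e a" using span by blast
  then show "abs_val (lin_form v (from_coords z)) = M v" using \<open>z \<in> coord_fibre\<close> by (simp add:
      lin_form_from_coords abs_form_eq)
qed (auto simp: from_coords_def vec_def)

lemma coords_coord_fibre: "\<omega> \<in> fibre_cone \<Longrightarrow> coords \<omega> \<in> coord_fibre"
proof -
  assume \<omega>: "\<omega> \<in> fibre_cone"
  have "abs_val (coords \<omega> j) \<le> 1" if "j < r" for j
    using \<omega> e_vec[OF that] e_ge[OF that] abs_\<kappa>[OF that] that
    unfolding coords_def fibre_cone_def by (auto simp: abs_val_divide)
  moreover have "abs_val (form a (coords \<omega>)) = M (vsum r e a)" for a
    unfolding form_coords using \<omega> vsum_in_vec unfolding fibre_cone_def by blast
  moreover have "coords \<omega> \<in> vec r" by (auto simp: coords_def vec_def)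
  ultimately show ?thesis unfolding coord_fibre_def polydisc_def by auto
qed

lemma coord_fibre_scale: "z \<in> coord_fibre \<Longrightarrow> abs_val c = 1 \<Longrightarrow> (\<lambda>i. c * z i) \<in> coord_fibre"
  unfolding coord_fibre_def polydisc_def by (auto simp: form_scale abs_val_mult vec_def)

lemma from_coords_scale: "from_coords (\<lambda>i. c * z i) = (\<lambda>i. c * from_coords z i)"
  by (auto simp: from_coords_def form_scale)

lemma form_prod_scale: "form_prod (\<lambda>i. c * z i) = c ^ card test_vecs * form_prod z"
  unfolding form_prod_def form_scale by (simp flip: times_divide_eq_right add: prod.distrib)

lemma abs_form_prod: "z \<in> coord_fibre \<Longrightarrow> abs_val (form_prod z) = 1"
  unfolding form_prod_def abs_val_prod
proof (rule prod.neutral, rule ballI)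
  fix a assume *: "a \<in> test_vecs" "z \<in> coord_fibre"
  then have "abs_val (form_scale a) = M (vsum r e a)" "M (vsum r e a) > 0" using abs_form_scale
      M_vsum_pos test_vecs by auto
  with * show "abs_val (form a z / form_scale a) = 1" by (auto simp: coord_fibre_def abs_val_divide)
qed

lemma form_prod_nonzero: "z \<in> coord_fibre \<Longrightarrow> form_prod z \<noteq> 0"
  using abs_form_prod[of z] by auto

lemma form_polyfun: "r \<le> n \<Longrightarrow> form a \<in> polyfun n"
  unfolding form_def[abs_def] by (intro polyfun_intros) auto

lemma form_prod_polyfun: "r \<le> n \<Longrightarrow> form_prod \<in> polyfun n"
  unfolding form_prod_def[abs_def] divide_inverse by (intro polyfun_intros form_polyfun)

section \<open>Projective points of the fibre and points of maximal absolute value\<close>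

definition fibre :: "(nat \<Rightarrow> 'c) set set" where
  "fibre = proj_point ` fibre_cone"

definition coord_point :: "(nat \<Rightarrow> 'c) \<Rightarrow> (nat \<Rightarrow> 'c) set" where
  "coord_point z = proj_point (from_coords z)"

lemma fibre_coord_point: "fibre = coord_point ` coord_fibre"
proof -
  have "fibre_cone = from_coords ` coord_fibre"
    using from_coords_fibre_cone coords_coord_fibre from_coords_coords unfolding fibre_cone_def by
        (auto simp: image_iff) (metis (no_types, lifting))
  then show ?thesis unfolding fibre_def coord_point_def by auto
qed

text \<open>The normalised test forms are added to the given polynomials before a common maximal
  point is taken: that they have absolute value 1 there is exactly what places the point in
  \<open>coord_fibre\<close>.\<close>

lemma max_point:
  fixes c :: "'i \<Rightarrow> (nat \<Rightarrow> nat) \<Rightarrow> 'c"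
  assumes "finite I" "\<And>i. i \<in> I \<Longrightarrow> finite (S i) \<and> S i \<subseteq> multi_indices r"
    and "\<And>i. i \<in> I \<Longrightarrow> \<mu> i \<in> S i \<and> c i (\<mu> i) \<noteq> 0"
    and "\<And>i \<alpha>. i \<in> I \<Longrightarrow> \<alpha> \<in> S i \<Longrightarrow> abs_val (c i \<alpha>) \<le> abs_val (c i (\<mu> i))"
  shows "\<exists>z\<in>coord_fibre. \<forall>i\<in>I. abs_val (\<Sum>\<alpha>\<in>S i. c i \<alpha> * mpow r z \<alpha>) = abs_val (c i (\<mu> i))"
proof -
  define u where "u j = (\<lambda>i. if i = j then 1 else 0 :: nat)" for j :: nat
  have inj: "inj_on u {..<r}" unfolding u_def by (rule inj_onI) (metis zero_neq_one)
  \<comment> \<open>Evaluated only at the exponents \<open>u j\<close>, which have a single entry 1;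
    there the sum picks the coefficient of the j-th variable.\<close>
  define L where "L a \<alpha> = (\<Sum>j<r. if \<alpha> j = 1 then \<iota> (a j) * \<kappa> j / form_scale a else 0)" for a and \<alpha>
      :: "nat \<Rightarrow> nat"
  have L_u: "L a (u j) = \<iota> (a j) * \<kappa> j / form_scale a" if "j < r" for a j
  proof -
    have "u j k = 1 \<longleftrightarrow> k = j" for k by (simp add: u_def)
    then show ?thesis unfolding L_def using that by simp
  qed
  have abs_L: "abs_val (L a (u j)) = abs_inf (a j) * M (e j) / M (vsum r e a)" if "j < r" "a \<in>
      test_vecs" for a j
    using that test_vecs by (simp add: L_u abs_val_divide abs_val_mult abs_val_iota abs_\<kappa> abs_form_scale)
  have L_sum: "(\<Sum>\<alpha>\<in>u ` {..<r}. L a \<alpha> * mpow r z \<alpha>) = form a z / form_scale a" for a z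
    unfolding form_def sum_divide_distrib
    by (subst sum.reindex[OF inj]) (auto intro!: sum.cong simp: L_u mpow_unit u_def[symmetric], auto
        simp: u_def mpow_unit)
  define C where "C x \<alpha> = (case x of Inl i \<Rightarrow> c i \<alpha> / c i (\<mu> i) | Inr a \<Rightarrow> L a \<alpha>)" for x \<alpha>
  define T where "T x = (case x of Inl i \<Rightarrow> S i | Inr a \<Rightarrow> u ` {..<r})" for x :: "'i + (nat \<Rightarrow> 'k fls)"
  obtain t :: "nat \<Rightarrow> 'c" where t: "\<And>n. abs_val (t n) \<le> 1" "\<And>m n. m \<noteq> n \<Longrightarrow> abs_val (t m - t n) = 1"
    using ex_residue_sequence by blast
  have "\<exists>z\<in>polydisc r. \<forall>x\<in>I <+> test_vecs. abs_val (\<Sum>\<alpha>\<in>T x. C x \<alpha> * mpow r z \<alpha>) = 1"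
  proof (rule common_maximal_point[where t = t])
    show "abs_val (t n) \<le> 1" for n by (rule t(1))
    show "abs_val (t m - t n) = 1" if "m \<noteq> n" for m n using that by (rule t(2))
    show "finite (I <+> test_vecs)" by (rule finite_Plus[OF assms(1) finite_test_vecs])
    fix x assume x: "x \<in> I <+> test_vecs"
    show "finite (T x) \<and> T x \<subseteq> multi_indices r"
    proof -
      have "u ` {..<r} \<subseteq> multi_indices r" by (auto simp: multi_indices_def u_def)
      moreover have "finite (S i)" "S i \<subseteq> multi_indices r" if "i \<in> I" for i using assms(2)[OF that] by auto
      ultimately show ?thesis using x by (elim PlusE) (simp_all add: T_def)
    qed
    show "abs_val (C x \<alpha>) \<le> 1" if \<alpha>: "\<alpha> \<in> T x" for \<alpha>
      using x
    proof (rule PlusE)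
      fix i assume "i \<in> I" "x = Inl i"
      then show ?thesis using that assms(3,4) by (auto simp: T_def C_def abs_val_divide)
    next
      fix a assume a: "a \<in> test_vecs" "x = Inr a"
      then obtain j where j: "j < r" "\<alpha> = u j" using \<alpha> by (auto simp: T_def)
      then show ?thesis using a abs_L[OF j(1) a(1)] orth[OF j(1), of a] M_vsum_pos[of a] test_vecs[of a]
        by (simp add: C_def)
    qed
    show "\<exists>\<alpha>\<in>T x. abs_val (C x \<alpha>) = 1"
      using x
    proof (rule PlusE)
      fix i assume "i \<in> I" "x = Inl i"
      then show ?thesis using assms(3) by (intro bexI[of _ "\<mu> i"]) (auto simp: T_def C_def)
    next
      fix a assume a: "a \<in> test_vecs" "x = Inr a"
      then obtain j where j: "j < r" "M (vsum r e a) = abs_inf (a j) * M (e j)"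
        using M_vsum_attained test_vecs by blast
      then have "abs_val (C x (u j)) = 1"
        using a abs_L[OF j(1) a(1)] M_vsum_pos[of a] test_vecs[of a] by (auto simp: C_def)
      then show ?thesis using j(1) a(2) by (auto simp: T_def)
    qed
  qed
  then obtain z where z: "z \<in> polydisc r"
    and z1: "\<And>x. x \<in> I <+> test_vecs \<Longrightarrow> abs_val (\<Sum>\<alpha>\<in>T x. C x \<alpha> * mpow r z \<alpha>) = 1" by blast
  have "abs_val (form a z) = M (vsum r e a)" if a: "a \<in> test_vecs" for a
    using z1[of "Inr a"] a abs_form_scale[of a] test_vecs[of a] M_vsum_pos[of a]
    by (simp add: T_def C_def L_sum abs_val_divide InrI)
  then have "z \<in> coord_fibre" using z unfolding coord_fibre_def by blast
  moreover have "abs_val (\<Sum>\<alpha>\<in>S i. c i \<alpha> * mpow r z \<alpha>) = abs_val (c i (\<mu> i))" if i: "i \<in> I" for i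
  proof -
    have "(\<Sum>\<alpha>\<in>S i. c i \<alpha> / c i (\<mu> i) * mpow r z \<alpha>) = (\<Sum>\<alpha>\<in>S i. c i \<alpha> * mpow r z \<alpha>) / c i (\<mu> i)"
      by (simp add: sum_divide_distrib)
    then have "abs_val ((\<Sum>\<alpha>\<in>S i. c i \<alpha> * mpow r z \<alpha>) / c i (\<mu> i)) = 1"
      using z1[of "Inl i"] i by (simp add: T_def C_def InlI)
    then show ?thesis using assms(3)[OF i] by (simp add: abs_val_divide)
  qed
  ultimately show ?thesis by blast
qed

text \<open>Apply \<open>max_point\<close> to a coefficient of largest absolute value: the Gauss
  norm is a value taken on the fibre.\<close>

lemma coefficient_bound:
  assumes "finite S" "S \<subseteq> multi_indices r"
    and "\<And>z. z \<in> coord_fibre \<Longrightarrow> abs_val (\<Sum>\<alpha>\<in>S. c \<alpha> * mpow r z \<alpha>) \<le> b" "\<alpha> \<in> S" "b \<ge> 0"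
  shows "abs_val (c \<alpha>) \<le> b"
proof (cases "c \<alpha> = 0")
  case False
  have S: "finite ((\<lambda>\<alpha>. abs_val (c \<alpha>)) ` S)" "(\<lambda>\<alpha>. abs_val (c \<alpha>)) ` S \<noteq> {}" using assms(1,4) by auto
  obtain \<mu> where \<mu>: "\<mu> \<in> S" "Max ((\<lambda>\<alpha>. abs_val (c \<alpha>)) ` S) = abs_val (c \<mu>)" using Max_in[OF S] by auto
  have le: "abs_val (c \<beta>) \<le> abs_val (c \<mu>)" if "\<beta> \<in> S" for \<beta>
    using Max_ge[OF S(1), of "abs_val (c \<beta>)"] that \<mu>(2) by auto
  have "c \<mu> \<noteq> 0" using le[OF assms(4)] False by (metis abs_val_0 abs_val_pos_iff not_le)
  then have "\<exists>z\<in>coord_fibre. \<forall>i\<in>{()}. abs_val (\<Sum>\<alpha>\<in>S. c \<alpha> * mpow r z \<alpha>) = abs_val (c \<mu>)"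
    using \<mu>(1) assms(1,2) le by (intro max_point[of "{()}" "\<lambda>_. S" "\<lambda>_. \<mu>" "\<lambda>_. c"]) auto
  then obtain z where z: "z \<in> coord_fibre" "abs_val (\<Sum>\<alpha>\<in>S. c \<alpha> * mpow r z \<alpha>) = abs_val (c \<mu>)" by blast
  have "abs_val (c \<mu>) \<le> b" using assms(3)[OF z(1)] z(2) by simp
  with le[OF assms(4)] show ?thesis by simp
qed (use assms(5) in simp)

text \<open>As h is a function of the projective point, the equation forces the quotient to be
  invariant under scaling z by units; this takes the place of a degree condition on Q.\<close>

definition fractions :: "((nat \<Rightarrow> 'c) set \<Rightarrow> 'c) set" where
  "fractions = {h. \<exists>k. \<exists>Q\<in>polyfun r. \<forall>z\<in>coord_fibre. h (coord_point z) = Q z / form_prod z ^ k}"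

lemma HsI: "Q \<in> polyfun r \<Longrightarrow> (\<And>z. z \<in> coord_fibre \<Longrightarrow> h (coord_point z) = Q z / form_prod z ^ k) \<Longrightarrow> h \<in> fractions"
  unfolding fractions_def by blast

lemma polyfun_bounded: "Q \<in> polyfun r \<Longrightarrow> \<exists>b. \<forall>z\<in>polydisc r. abs_val (Q z) \<le> b"
proof -
  assume "Q \<in> polyfun r"
  then obtain c S where S: "finite S" "Q = (\<lambda>z. \<Sum>\<alpha>\<in>S. c \<alpha> * mpow r z \<alpha>)" unfolding polyfun_def by auto
  have "abs_val (Q z) \<le> (\<Sum>\<alpha>\<in>S. abs_val (c \<alpha>))" if "z \<in> polydisc r" for z
    unfolding S(2)
  proof (intro abs_val_sum_le abs_val_term_le that)
    show "abs_val (c \<alpha>) \<le> (\<Sum>\<alpha>\<in>S. abs_val (c \<alpha>))" if "\<alpha> \<in> S" for \<alpha>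
      using S(1) that by (intro member_le_sum) auto
  qed (auto intro: sum_nonneg)
  then show ?thesis by blast
qed

sublocale bounded_function_algebra fibre fractions
proof
  show "(\<lambda>_. c) \<in> fractions" for c by (rule HsI[of "\<lambda>_. c" _ 0]) (auto intro: polyfun_intros)
  fix f g assume "f \<in> fractions" "g \<in> fractions"
  then obtain Q k Q' k' where *: "Q \<in> polyfun r" "\<And>z. z \<in> coord_fibre \<Longrightarrow> f (coord_point z) = Q z /
      form_prod z ^ k"
    "Q' \<in> polyfun r" "\<And>z. z \<in> coord_fibre \<Longrightarrow> g (coord_point z) = Q' z / form_prod z ^ k'"
    unfolding fractions_def by blast
  show "(\<lambda>x. f x * g x) \<in> fractions"
    by (rule HsI[of "\<lambda>z. Q z * Q' z" _ "k + k'"]) (use * in \<open>auto intro: polyfun_intros simp: power_add\<close>)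
  show "(\<lambda>x. f x + g x) \<in> fractions"
    by (rule HsI[of "\<lambda>z. Q z * form_prod z ^ k' + Q' z * form_prod z ^ k" _ "k + k'"])
      (use * form_prod_nonzero in \<open>auto intro!: polyfun_add polyfun_mult polyfun_power
          form_prod_polyfun simp: power_add field_simps\<close>)
  obtain b where b: "\<And>z. z \<in> polydisc r \<Longrightarrow> abs_val (Q z) \<le> b" using polyfun_bounded[OF *(1)] by blast
  have "abs_val (f (coord_point z)) \<le> b" if "z \<in> coord_fibre" for z
    using b[of z] that *(2)[OF that] abs_form_prod[OF that] unfolding coord_fibre_def
    by (simp add: abs_val_divide abs_val_power)
  then show "\<exists>b. \<forall>x\<in>fibre. abs_val (f x) \<le> b" unfolding fibre_coord_point by blast
qed

lemma fractions_diff: "f \<in> fractions \<Longrightarrow> g \<in> fractions \<Longrightarrow> (\<lambda>x. f x - g x) \<in> fractions"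
  using add_H[OF _ mult_H[OF const_H[of "-1"]], of f g] by simp

text \<open>The supremum norm on the fibre is multiplicative, because a common point of maximal absolute
  value exists for the numerators of any two elements of \<^const>\<open>fractions\<close>.\<close>

lemma unit_abs_le:
  assumes f: "f \<in> uclosure" and g: "g \<in> uclosure" and fg: "\<And>x. x \<in> fibre \<Longrightarrow> f x * g x = 1"
    and x: "x \<in> fibre" and y: "y \<in> fibre"
  shows "abs_val (f y) \<le> abs_val (f x)"
proof (rule ccontr)
  assume "\<not> ?thesis"
  then have less: "abs_val (f x) < abs_val (f y)" by simp
  have nonzero: "f x \<noteq> 0" "f y \<noteq> 0" "g x \<noteq> 0" using fg[OF x] fg[OF y] by auto
  \<comment> \<open>Approximate u within |u w| / 2 by a fraction with numerator Q. By the isosceles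
    principle |u| = |Q| wherever |Q| >= |u w|. The Gauss norm of Q is at least |Q| at w, which is |u
    w|, so |u| >= |u w| wherever Q attains its Gauss norm.\<close>
  have approx: "\<exists>c S \<mu>. finite S \<and> S \<subseteq> multi_indices r \<and> \<mu> \<in> S \<and> c \<mu> \<noteq> 0 \<and>
      (\<forall>\<alpha>\<in>S. abs_val (c \<alpha>) \<le> abs_val (c \<mu>)) \<and>
      (\<forall>z\<in>coord_fibre. abs_val (\<Sum>\<alpha>\<in>S. c \<alpha> * mpow r z \<alpha>) = abs_val (c \<mu>) \<longrightarrow> abs_val (u w) \<le> abs_val (u
          (coord_point z)))"
    if u: "u \<in> uclosure" and w: "w \<in> fibre" "u w \<noteq> 0" for u w
  proof -
    obtain h where h: "h \<in> fractions" "\<And>x. x \<in> fibre \<Longrightarrow> abs_val (u x - h x) \<le> abs_val (u w) / 2"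
      using uclosureD[OF u, of "abs_val (u w) / 2"] w(2) by auto
    obtain k Q where Q: "Q \<in> polyfun r" "\<And>z. z \<in> coord_fibre \<Longrightarrow> h (coord_point z) = Q z / form_prod z ^ k"
      using h(1) unfolding fractions_def by blast
    obtain c S where S: "finite S" "S \<subseteq> multi_indices r" "Q = (\<lambda>z. \<Sum>\<alpha>\<in>S. c \<alpha> * mpow r z \<alpha>)"
      using Q(1) unfolding polyfun_def by blast
    have abs_h: "abs_val (h (coord_point z)) = abs_val (Q z)" if "z \<in> coord_fibre" for z
      using that by (simp add: Q(2) abs_val_divide abs_val_power abs_form_prod)
    have far: "abs_val (u (coord_point z)) = abs_val (Q z)" if "z \<in> coord_fibre" "abs_val (u w) \<le>
        abs_val (Q z)" for z
    proof -
      have "abs_val (u (coord_point z) - h (coord_point z)) < abs_val (h (coord_point z))"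
        using h(2)[of "coord_point z"] that abs_h[OF that(1)] w(2) unfolding fibre_coord_point
        by (smt (verit) abs_val_pos_iff field_sum_of_halves image_eqI)
      then show ?thesis using abs_val_eqI abs_h[OF that(1)] by metis
    qed
    obtain z0 where z0: "z0 \<in> coord_fibre" "w = coord_point z0" using w(1) unfolding fibre_coord_point by blast
    have "abs_val (h w - u w) < abs_val (u w)"
      using h(2)[OF w(1)] w(2) by (subst abs_val_diff_commute) (smt (verit) abs_val_pos_iff field_sum_of_halves)
    then have Qz0: "abs_val (Q z0) = abs_val (u w)" using abs_h[OF z0(1)] z0(2) abs_val_eqI by metis
    have ne: "S \<noteq> {}"
    proof
      assume "S = {}"
      then have "Q z0 = 0" unfolding S(3) by simp
      then show False using Qz0 w(2) by simp
    qed
    have fin: "finite ((\<lambda>\<alpha>. abs_val (c \<alpha>)) ` S)" "(\<lambda>\<alpha>. abs_val (c \<alpha>)) ` S \<noteq> {}" using S(1) ne by auto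
    obtain \<mu> where \<mu>: "\<mu> \<in> S" "Max ((\<lambda>\<alpha>. abs_val (c \<alpha>)) ` S) = abs_val (c \<mu>)" using Max_in[OF fin] by auto
    have le: "abs_val (c \<beta>) \<le> abs_val (c \<mu>)" if "\<beta> \<in> S" for \<beta>
      using Max_ge[OF fin(1), of "abs_val (c \<beta>)"] that \<mu>(2) by auto
    have "abs_val (Q z0) \<le> abs_val (c \<mu>)"
      unfolding S(3) using z0(1) le by (intro abs_val_sum_le abs_val_term_le) (auto simp: coord_fibre_def)
    then have "abs_val (u w) \<le> abs_val (c \<mu>)" using Qz0 by simp
    then have "\<forall>z\<in>coord_fibre. abs_val (\<Sum>\<alpha>\<in>S. c \<alpha> * mpow r z \<alpha>) = abs_val (c \<mu>) \<longrightarrow> abs_val (u w) \<le>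
        abs_val (u (coord_point z))"
      using far unfolding S(3) by simp
    moreover have "c \<mu> \<noteq> 0" using \<open>abs_val (u w) \<le> abs_val (c \<mu>)\<close> w(2)
      by (metis abs_val_0 abs_val_pos_iff not_le)
    ultimately show ?thesis using S(1,2) \<mu>(1) le
      by (intro exI[of _ c] exI[of _ S] exI[of _ \<mu>] conjI ballI) auto
  qed
  obtain c1 S1 \<mu>1 where 1: "finite S1" "S1 \<subseteq> multi_indices r" "\<mu>1 \<in> S1" "c1 \<mu>1 \<noteq> 0"
      "\<And>\<alpha>. \<alpha> \<in> S1 \<Longrightarrow> abs_val (c1 \<alpha>) \<le> abs_val (c1 \<mu>1)"
      "\<And>z. z \<in> coord_fibre \<Longrightarrow> abs_val (\<Sum>\<alpha>\<in>S1. c1 \<alpha> * mpow r z \<alpha>) = abs_val (c1 \<mu>1) \<Longrightarrow> abs_val (f y) \<le>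
          abs_val (f (coord_point z))"
    using approx[OF f y nonzero(2)] by blast
  obtain c2 S2 \<mu>2 where 2: "finite S2" "S2 \<subseteq> multi_indices r" "\<mu>2 \<in> S2" "c2 \<mu>2 \<noteq> 0"
      "\<And>\<alpha>. \<alpha> \<in> S2 \<Longrightarrow> abs_val (c2 \<alpha>) \<le> abs_val (c2 \<mu>2)"
      "\<And>z. z \<in> coord_fibre \<Longrightarrow> abs_val (\<Sum>\<alpha>\<in>S2. c2 \<alpha> * mpow r z \<alpha>) = abs_val (c2 \<mu>2) \<Longrightarrow> abs_val (g x) \<le>
          abs_val (g (coord_point z))"
    using approx[OF g x nonzero(3)] by blast
  let ?c = "\<lambda>i. if i then c1 else c2" and ?S = "\<lambda>i. if i then S1 else S2" and ?\<mu> = "\<lambda>i. if i then \<mu>1 else \<mu>2"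
  have "\<exists>z\<in>coord_fibre. \<forall>i\<in>{True, False}. abs_val (\<Sum>\<alpha>\<in>?S i. ?c i \<alpha> * mpow r z \<alpha>) = abs_val (?c i (?\<mu> i))"
    by (rule max_point) (use 1(1-5) 2(1-5) in \<open>auto split: if_splits\<close>)
  then obtain z where z: "z \<in> coord_fibre" "abs_val (\<Sum>\<alpha>\<in>S1. c1 \<alpha> * mpow r z \<alpha>) = abs_val (c1 \<mu>1)"
    "abs_val (\<Sum>\<alpha>\<in>S2. c2 \<alpha> * mpow r z \<alpha>) = abs_val (c2 \<mu>2)" by auto
  \<comment> \<open>At the common maximal point z the product f g is 1, which is also |f x| |g x|;
    hence |f y| cannot exceed |f x|.\<close>
  have "abs_val (f y) * abs_val (g x) \<le> abs_val (f (coord_point z)) * abs_val (g (coord_point z))"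
    using 1(6)[OF z(1,2)] 2(6)[OF z(1,3)] by (intro mult_mono) auto
  also have "\<dots> = 1" using fg[of "coord_point z"] z(1) by (simp flip: abs_val_mult add: fibre_coord_point)
  also have "1 = abs_val (f x) * abs_val (g x)" using fg[OF x] by (simp flip: abs_val_mult)
  also have "\<dots> < abs_val (f y) * abs_val (g x)" using less nonzero(3) by (intro mult_strict_right_mono) auto
  finally show False by simp
qed

end

lemma proj_point_self: "\<omega> \<in> proj_point \<omega>"
  unfolding proj_point_def by (intro CollectI exI[of _ 1]) auto

lemma proj_point_scale:
  assumes "c \<noteq> 0"
  shows "proj_point (\<lambda>i. c * \<omega> i) = proj_point \<omega>"
proof (intro set_eqI iffI)
  fix \<xi> assume "\<xi> \<in> proj_point (\<lambda>i. c * \<omega> i)"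
  then obtain d where "d \<noteq> 0" "\<xi> = (\<lambda>i. d * (c * \<omega> i))" unfolding proj_point_def by auto
  then show "\<xi> \<in> proj_point \<omega>"
    unfolding proj_point_def using assms by (intro CollectI exI[of _ "d * c"]) (auto simp: mult.assoc)
next
  fix \<xi> assume "\<xi> \<in> proj_point \<omega>"
  then obtain d where "d \<noteq> 0" "\<xi> = (\<lambda>i. d * \<omega> i)" unfolding proj_point_def by auto
  then show "\<xi> \<in> proj_point (\<lambda>i. c * \<omega> i)"
    unfolding proj_point_def using assms by (intro CollectI exI[of _ "d / c"]) auto
qed

section \<open>Normalised coordinates and expansions in z and 1/P\<close>

context building_fibre
begin

text \<open>The value to which the i-th homogeneous coordinate is normalised. Its absolute value is
  the one prescribed on \<open>fibre_cone\<close>, so normalisation does not leave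
  \<open>coord_fibre\<close>; the value 1 would in general.\<close>

definition chart_scale :: "nat \<Rightarrow> 'c" where
  "chart_scale i = form_scale (dual i)"

definition chart_rep :: "nat \<Rightarrow> (nat \<Rightarrow> 'c) set \<Rightarrow> nat \<Rightarrow> 'c" where
  "chart_rep i x = (SOME \<omega>. \<omega> \<in> x \<and> \<omega> i = chart_scale i)"

definition chart_coords :: "nat \<Rightarrow> (nat \<Rightarrow> 'c) set \<Rightarrow> nat \<Rightarrow> 'c" where
  "chart_coords i x = coords (chart_rep i x)"

text \<open>Rabinowitsch trick: the extra coordinate 1/P turns the condition |P| = 1 into the
  equation \<open>z r * form_prod z = 1\<close> in a polydisc.\<close>

definition tate_coords :: "nat \<Rightarrow> (nat \<Rightarrow> 'c) set \<Rightarrow> nat \<Rightarrow> 'c" where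
  "tate_coords i x = (\<lambda>j. if j < r then chart_coords i x j else if j = r then 1 / form_prod
      (chart_coords i x) else 0)"

lemma abs_chart_scale: "i < r \<Longrightarrow> abs_val (chart_scale i) = M (unit_vec i)"
  unfolding chart_scale_def using abs_form_scale[OF dual(1) dual_nonzero] dual(2) by simp

lemma chart_scale_nonzero: "i < r \<Longrightarrow> chart_scale i \<noteq> 0"
  unfolding chart_scale_def using form_scale_nonzero dual_test_vecs by blast

lemma chart_rep_proj_point:
  assumes "i < r" "\<omega> i \<noteq> 0"
  shows "chart_rep i (proj_point \<omega>) = (\<lambda>j. chart_scale i / \<omega> i * \<omega> j)"
  unfolding chart_rep_def
proof (rule some_equality)
  show "(\<lambda>j. chart_scale i / \<omega> i * \<omega> j) \<in> proj_point \<omega> \<and> chart_scale i / \<omega> i * \<omega> i = chart_scale i"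
    unfolding proj_point_def using assms chart_scale_nonzero by (intro conjI CollectI exI[of _
        "chart_scale i / \<omega> i"]) auto
  fix \<xi> assume \<xi>: "\<xi> \<in> proj_point \<omega> \<and> \<xi> i = chart_scale i"
  then obtain c where "\<xi> = (\<lambda>j. c * \<omega> j)" unfolding proj_point_def by auto
  with \<xi> assms show "\<xi> = (\<lambda>j. chart_scale i / \<omega> i * \<omega> j)" by (auto simp: field_simps)
qed

lemma coords_scale: "coords (\<lambda>i. c * \<omega> i) = (\<lambda>i. c * coords \<omega> i)"
  by (auto simp: coords_def lin_form_scale)

lemma from_coords_coord: "i < r \<Longrightarrow> from_coords z i = form (dual i) z"
  by (simp add: from_coords_def)

lemma coord_fibre_vec: "z \<in> coord_fibre \<Longrightarrow> z \<in> vec r" "z \<in> coord_fibre \<Longrightarrow> z \<in> polydisc r"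
  unfolding coord_fibre_def polydisc_def by auto

lemma abs_form_dual: "z \<in> coord_fibre \<Longrightarrow> i < r \<Longrightarrow> abs_val (form (dual i) z) = M (unit_vec i)"
  by (simp add: abs_form_eq dual)

lemma form_dual_nonzero: "z \<in> coord_fibre \<Longrightarrow> i < r \<Longrightarrow> form (dual i) z \<noteq> 0"
  by (metis abs_form_dual abs_chart_scale chart_scale_nonzero abs_val_eq_0_iff)

lemma chart_coords_coord_point: "z \<in> coord_fibre \<Longrightarrow> i < r \<Longrightarrow> chart_coords i (coord_point z) = (\<lambda>j.
    chart_scale i / form (dual i) z * z j)"
  unfolding chart_coords_def coord_point_def using chart_rep_proj_point[of i "from_coords z"]
      form_dual_nonzero[of z i]
  by (simp add: from_coords_coord coords_from_coords coord_fibre_vec coords_scale del: times_divide_eq_left)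

lemma chart_coords:
  assumes "x \<in> fibre" "i < r"
  shows "chart_coords i x \<in> coord_fibre" "coord_point (chart_coords i x) = x" "form (dual i)
      (chart_coords i x) = chart_scale i"
proof -
  obtain z where z: "z \<in> coord_fibre" "x = coord_point z" using assms(1) unfolding fibre_coord_point by blast
  let ?c = "chart_scale i / form (dual i) z"
  have c: "abs_val ?c = 1" "?c \<noteq> 0"
    using chart_scale_nonzero[OF assms(2)] form_dual_nonzero[OF z(1) assms(2)] abs_chart_scale[OF
        assms(2)] abs_form_dual[OF z(1) assms(2)]
    by (auto simp: abs_val_divide)
  have eq: "chart_coords i x = (\<lambda>j. ?c * z j)" using chart_coords_coord_point[OF z(1) assms(2)] z(2) by simp
  show "chart_coords i x \<in> coord_fibre" unfolding eq by (rule coord_fibre_scale[OF z(1) c(1)])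
  have "coord_point (chart_coords i x) = coord_point z" unfolding eq coord_point_def
      from_coords_scale by (rule proj_point_scale[OF c(2)])
  then show "coord_point (chart_coords i x) = x" using z(2) by simp
  show "form (dual i) (chart_coords i x) = chart_scale i" unfolding eq form_scale using
      form_dual_nonzero[OF z(1) assms(2)] by simp
qed

text \<open>Normalising divides by \<open>form (dual i)\<close>, a factor of
  \<open>form_prod\<close> up to a constant; extend the fraction by the remaining factors.\<close>

lemma chart_coords_fractions: "i < r \<Longrightarrow> j < r \<Longrightarrow> (\<lambda>x. chart_coords i x j) \<in> fractions"
proof (rule HsI[of "\<lambda>z. z j * (\<Prod>a\<in>test_vecs - {dual i}. form a z / form_scale a)" _ 1])
  assume ij: "i < r" "j < r"
  show "(\<lambda>z. z j * (\<Prod>a\<in>test_vecs - {dual i}. form a z / form_scale a)) \<in> polyfun r"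
    unfolding divide_inverse using ij by (intro polyfun_intros form_polyfun) auto
  fix z assume z: "z \<in> coord_fibre"
  let ?R = "\<Prod>a\<in>test_vecs - {dual i}. form a z / form_scale a"
  have form_prod: "form_prod z = form (dual i) z / chart_scale i * ?R"
    unfolding form_prod_def chart_scale_def by (rule prod.remove[OF finite_test_vecs dual_test_vecs[OF ij(1)]])
  then have "?R \<noteq> 0" using form_prod_nonzero[OF z] by auto
  then show "chart_coords i (coord_point z) j = z j * ?R / form_prod z ^ 1"
    using chart_scale_nonzero[OF ij(1)] form_dual_nonzero[OF z ij(1)] by (simp add:
        chart_coords_coord_point z ij form_prod)
qed

text \<open>\<open>form_prod\<close> is homogeneous of degree \<open>card test_vecs\<close>, so the
  rescaling appears as that power of \<open>form (dual i)\<close> in the numerator.\<close>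

lemma inverse_form_prod_fractions: "i < r \<Longrightarrow> (\<lambda>x. 1 / form_prod (chart_coords i x)) \<in> fractions"
proof (rule HsI[of "\<lambda>z. (form (dual i) z * inverse (chart_scale i)) ^ card test_vecs" _ 1])
  assume i: "i < r"
  show "(\<lambda>z. (form (dual i) z * inverse (chart_scale i)) ^ card test_vecs) \<in> polyfun r"
    by (intro polyfun_intros form_polyfun) auto
  fix z assume z: "z \<in> coord_fibre"
  then show "1 / form_prod (chart_coords i (coord_point z)) = (form (dual i) z * inverse
      (chart_scale i)) ^ card test_vecs / form_prod z ^ 1"
    using chart_scale_nonzero[OF i] form_dual_nonzero[OF z i] by (simp add: chart_coords_coord_point
        i form_prod_scale power_divide divide_inverse power_mult_distrib power_inverse)
qed

lemma tate_coords_uclosure: "i < r \<Longrightarrow> j < Suc r \<Longrightarrow> (\<lambda>x. tate_coords i x j) \<in> uclosure"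
  using H_uclosure[OF chart_coords_fractions] H_uclosure[OF inverse_form_prod_fractions] unfolding
      tate_coords_def
  by (cases "j < r") (auto simp: less_Suc_eq)

lemma tate_coords_polydisc: "x \<in> fibre \<Longrightarrow> i < r \<Longrightarrow> tate_coords i x \<in> polydisc (Suc r)"
  using coord_fibre_vec(2)[OF chart_coords(1)[of x i]] abs_form_prod[OF chart_coords(1)[of x i]]
  by (auto simp: tate_coords_def polydisc_def vec_def abs_val_divide)

text \<open>Q/P^n at the normalised representative is a polynomial in \<open>tate_coords\<close> in
  which the last variable always has exponent n. Its coefficients are those of Q, which
  \<open>coefficient_bound\<close> controls by the supremum norm.\<close>

lemma fractions_coefficients:
  assumes D: "D \<in> fractions" and i: "i < r" and b: "\<And>x. x \<in> fibre \<Longrightarrow> abs_val (D x) \<le> b" "b \<ge> 0"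
  shows "\<exists>C. finite {\<alpha>. C \<alpha> \<noteq> 0} \<and> {\<alpha>. C \<alpha> \<noteq> 0} \<subseteq> multi_indices (Suc r) \<and> (\<forall>\<alpha>. abs_val (C \<alpha>) \<le> b) \<and>
    (\<forall>x\<in>fibre. D x = (\<Sum>\<alpha> | C \<alpha> \<noteq> 0. C \<alpha> * mpow (Suc r) (tate_coords i x) \<alpha>))"
proof -
  obtain n Q where Q: "Q \<in> polyfun r" "\<And>z. z \<in> coord_fibre \<Longrightarrow> D (coord_point z) = Q z / form_prod z ^ n"
    using D unfolding fractions_def by blast
  obtain c S where S: "finite S" "S \<subseteq> multi_indices r" "Q = (\<lambda>z. \<Sum>\<alpha>\<in>S. c \<alpha> * mpow r z \<alpha>)"
    using Q(1) unfolding polyfun_def by blast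
  have c_le: "abs_val (c \<alpha>) \<le> b" if "\<alpha> \<in> S" for \<alpha>
  proof (rule coefficient_bound[OF S(1,2) _ that b(2)])
    fix z assume z: "z \<in> coord_fibre"
    then have "abs_val (D (coord_point z)) \<le> b" using b(1) unfolding fibre_coord_point by blast
    then show "abs_val (\<Sum>\<alpha>\<in>S. c \<alpha> * mpow r z \<alpha>) \<le> b"
      using Q(2)[OF z] abs_form_prod[OF z] unfolding S(3) by (simp add: abs_val_divide abs_val_power)
  qed
  let ?u = "\<lambda>\<alpha>. \<alpha>(r := n)"
  have S_r: "\<alpha> r = 0" if "\<alpha> \<in> S" for \<alpha> using S(2) that by (auto simp: multi_indices_def)
  then have restore: "(?u \<alpha>)(r := 0) = \<alpha>" if "\<alpha> \<in> S" for \<alpha> using that by (auto simp: fun_eq_iff)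
  have inj: "inj_on ?u S" by (rule inj_on_inverseI[of _ "\<lambda>\<alpha>. \<alpha>(r := 0)"]) (rule restore)
  define C where "C \<alpha> = (if \<alpha> \<in> ?u ` S then c (\<alpha>(r := 0)) else 0)" for \<alpha>
  have C_u: "C (?u \<alpha>) = c \<alpha>" if "\<alpha> \<in> S" for \<alpha>
    using that restore[OF that] unfolding C_def by (metis imageI)
  have supp: "{\<alpha>. C \<alpha> \<noteq> 0} \<subseteq> ?u ` S" unfolding C_def by auto
  have "D x = (\<Sum>\<alpha> | C \<alpha> \<noteq> 0. C \<alpha> * mpow (Suc r) (tate_coords i x) \<alpha>)" if x: "x \<in> fibre" for x
  proof -
    have "mpow (Suc r) (tate_coords i x) (?u \<alpha>) = mpow r (chart_coords i x) \<alpha> * (1 / form_prod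
        (chart_coords i x)) ^ n" for \<alpha>
    proof -
      have "(\<Prod>j<r. tate_coords i x j ^ ?u \<alpha> j) = mpow r (chart_coords i x) \<alpha>"
        by (intro prod.cong) (auto simp: tate_coords_def)
      then show ?thesis by (simp add: tate_coords_def)
    qed
    then have "(\<Sum>\<alpha>\<in>?u ` S. C \<alpha> * mpow (Suc r) (tate_coords i x) \<alpha>) = Q (chart_coords i x) /
        form_prod (chart_coords i x) ^ n"
      unfolding S(3) sum_divide_distrib
      by (subst sum.reindex[OF inj]) (auto intro!: sum.cong simp: C_u power_divide simp del: fun_upd_apply)
    also have "\<dots> = D x" using Q(2)[OF chart_coords(1)[OF x i]] chart_coords(2)[OF x i] by simp
    finally have "D x = (\<Sum>\<alpha>\<in>?u ` S. C \<alpha> * mpow (Suc r) (tate_coords i x) \<alpha>)" by simp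
    also have "\<dots> = (\<Sum>\<alpha> | C \<alpha> \<noteq> 0. C \<alpha> * mpow (Suc r) (tate_coords i x) \<alpha>)"
      using S(1) supp by (intro sum.mono_neutral_right) auto
    finally show ?thesis .
  qed
  moreover have "?u ` S \<subseteq> multi_indices (Suc r)" using S(2) by (auto simp: multi_indices_def)
  moreover have "abs_val (C \<alpha>) \<le> b" for \<alpha>
  proof (cases "\<alpha> \<in> ?u ` S")
    case True
    then show ?thesis using C_u c_le by auto
  qed (use b(2) in \<open>simp add: C_def\<close>)
  moreover have "finite {\<alpha>. C \<alpha> \<noteq> 0}" using S(1) supp by (meson finite_imageI finite_subset)
  ultimately show ?thesis using supp by (intro exI[of _ C]) auto
qed

text \<open>A function has many expansions in z and 1/P, so separately chosen expansions of the
  approximants \<open>h k\<close> need not converge. Instead the differences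
  \<open>h (Suc k) - h k\<close> are expanded, with coefficients at most 1 / 2^k, and accumulated in
  \<open>G\<close>.\<close>

lemma uclosure_tate:
  assumes i: "i < r" and f: "f \<in> uclosure"
  shows "\<exists>g\<in>tate_algebra (Suc r). \<forall>x\<in>fibre. f x = g (tate_coords i x)"
proof -
  have "\<exists>h\<in>fractions. \<forall>x\<in>fibre. abs_val (f x - h x) \<le> 1 / 2 ^ k" for k :: nat
    using uclosureD[OF f, of "1 / 2 ^ k"] by simp
  then obtain h where h: "\<And>k. h k \<in> fractions" "\<And>k x. x \<in> fibre \<Longrightarrow> abs_val (f x - h k x) \<le> 1 / 2 ^ (k::nat)"
    by metis
  define s where "s C x = (\<Sum>\<alpha> | C \<alpha> \<noteq> 0. C \<alpha> * mpow (Suc r) (tate_coords i x) \<alpha>)" for C x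
  have s_eq: "s C x = (\<Sum>\<alpha>\<in>F. C \<alpha> * mpow (Suc r) (tate_coords i x) \<alpha>)"
    if "finite F" "{\<alpha>. C \<alpha> \<noteq> 0} \<subseteq> F" for C x F
    unfolding s_def using that by (intro sum.mono_neutral_left) auto
  define ok where "ok C \<longleftrightarrow> finite {\<alpha>. C \<alpha> \<noteq> 0} \<and> {\<alpha>. C \<alpha> \<noteq> 0} \<subseteq> multi_indices (Suc r)" for C :: "(nat
      \<Rightarrow> nat) \<Rightarrow> 'c"
  have s_add: "s (\<lambda>\<alpha>. C \<alpha> + C' \<alpha>) x = s C x + s C' x" if "ok C" "ok C'" for C C' x
  proof -
    let ?F = "{\<alpha>. C \<alpha> \<noteq> 0} \<union> {\<alpha>. C' \<alpha> \<noteq> 0}"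
    have F: "finite ?F" using that unfolding ok_def by simp
    have "{\<alpha>. C \<alpha> + C' \<alpha> \<noteq> 0} \<subseteq> ?F" by auto
    then show ?thesis by (simp add: s_eq[OF F] distrib_right sum.distrib)
  qed
  have ok_add: "ok (\<lambda>\<alpha>. C \<alpha> + C' \<alpha>)" if "ok C" "ok C'" for C C'
  proof -
    have "{\<alpha>. C \<alpha> + C' \<alpha> \<noteq> 0} \<subseteq> {\<alpha>. C \<alpha> \<noteq> 0} \<union> {\<alpha>. C' \<alpha> \<noteq> 0}" by auto
    then show ?thesis using that unfolding ok_def by (meson finite_UnI finite_subset le_sup_iff
        order_trans Un_least)
  qed
  obtain b where b: "b > 0" "\<And>x. x \<in> fibre \<Longrightarrow> abs_val (h 0 x) \<le> b"
    using uclosure_bounded[OF H_uclosure[OF h(1)[of 0]]] by auto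
  obtain C0 where C0: "ok C0" "\<And>x. x \<in> fibre \<Longrightarrow> h 0 x = s C0 x"
    using fractions_coefficients[OF h(1)[of 0] i b(2) less_imp_le[OF b(1)]] unfolding ok_def s_def by auto
  have "\<exists>C. ok C \<and> (\<forall>\<alpha>. abs_val (C \<alpha>) \<le> 1 / 2 ^ k) \<and> (\<forall>x\<in>fibre. h (Suc k) x - h k x = s C x)" for k
  proof -
    have "abs_val (h (Suc k) x - h k x) \<le> 1 / 2 ^ k" if x: "x \<in> fibre" for x
    proof (rule abs_val_diff_trans)
      show "abs_val (f x - h k x) \<le> 1 / 2 ^ k" by (rule h(2)[OF x])
      have "(1::real) / 2 ^ Suc k \<le> 1 / 2 ^ k" by (simp add: divide_simps)
      then show "abs_val (h (Suc k) x - f x) \<le> 1 / 2 ^ k"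
        using h(2)[OF x, of "Suc k"] abs_val_diff_commute[of "f x"] by (metis order_trans)
    qed
    then show ?thesis
      using fractions_coefficients[OF fractions_diff[OF h(1)[of "Suc k"] h(1)[of k]] i, of "1 / 2 ^ k"]
      unfolding ok_def s_def by auto
  qed
  then obtain C where C: "\<And>k. ok (C k)" "\<And>k \<alpha>. abs_val (C k \<alpha>) \<le> 1 / 2 ^ k"
    "\<And>k x. x \<in> fibre \<Longrightarrow> h (Suc k) x - h k x = s (C k) x" by metis
  define G where "G k = (\<lambda>\<alpha>. C0 \<alpha> + (\<Sum>l<k. C l \<alpha>))" for k
  have G_Suc: "G (Suc k) = (\<lambda>\<alpha>. G k \<alpha> + C k \<alpha>)" for k
    by (simp add: G_def add.assoc)
  have G: "ok (G k) \<and> (\<forall>x\<in>fibre. h k x = s (G k) x)" for k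
  proof (induction k)
    case 0
    then show ?case using C0 by (simp add: G_def)
  next
    case (Suc k)
    have "h (Suc k) x = s (G (Suc k)) x" if "x \<in> fibre" for x
    proof -
      have "h (Suc k) x = h k x + s (C k) x" using C(3)[OF that, of k] by (simp add: algebra_simps)
      then show ?thesis using Suc that C(1) unfolding G_Suc by (simp add: s_add)
    qed
    moreover have "ok (G (Suc k))" unfolding G_Suc using Suc C(1) by (intro ok_add) auto
    ultimately show ?case by blast
  qed
  have "\<exists>g\<in>tate_algebra (Suc r). \<forall>z\<in>polydisc (Suc r). \<forall>k.
      abs_val (g z - (\<Sum>\<alpha> | G k \<alpha> \<noteq> 0. G k \<alpha> * mpow (Suc r) z \<alpha>)) \<le> 1 / 2 ^ k"
  proof (rule tate_limit[OF comp])
    show "finite {\<alpha>. G k \<alpha> \<noteq> 0}" "{\<alpha>. G k \<alpha> \<noteq> 0} \<subseteq> multi_indices (Suc r)" for k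
      using G[of k] unfolding ok_def by auto
    show "abs_val (G (Suc k) \<alpha> - G k \<alpha>) \<le> 1 / 2 ^ k" for k \<alpha>
      using C(2) by (simp add: G_Suc)
  qed
  then obtain g where g: "g \<in> tate_algebra (Suc r)"
    "\<And>z k. z \<in> polydisc (Suc r) \<Longrightarrow> abs_val (g z - (\<Sum>\<alpha> | G k \<alpha> \<noteq> 0. G k \<alpha> * mpow (Suc r) z \<alpha>)) \<le> 1 / 2 ^ k"
    by blast
  have "f x = g (tate_coords i x)" if x: "x \<in> fibre" for x
  proof (rule ccontr)
    assume "f x \<noteq> g (tate_coords i x)"
    then have "abs_val (f x - g (tate_coords i x)) > 0" by simp
    then obtain k where k: "(1/2) ^ k < abs_val (f x - g (tate_coords i x))"
      using real_arch_pow_inv[of "abs_val (f x - g (tate_coords i x))" "1/2"] by auto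
    have "abs_val (h k x - g (tate_coords i x)) \<le> 1 / 2 ^ k"
      using g(2)[OF tate_coords_polydisc[OF x i], of k] G[of k] x unfolding s_def
      by (subst abs_val_diff_commute) simp
    then have "abs_val (f x - g (tate_coords i x)) \<le> 1 / 2 ^ k"
      by (rule abs_val_diff_trans[OF h(2)[OF x]])
    with k show False by (simp add: power_one_over)
  qed
  with g(1) show ?thesis by blast
qed

section \<open>The affinoid structure of the fibre\<close>

lemma uclosure_eq_tate:
  assumes "i < r"
  shows "uclosure = {f. \<exists>g\<in>tate_algebra (Suc r). \<forall>x\<in>fibre. f x = g (tate_coords i x)}"
proof (intro set_eqI iffI)
  fix f assume "f \<in> {f. \<exists>g\<in>tate_algebra (Suc r). \<forall>x\<in>fibre. f x = g (tate_coords i x)}"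
  then obtain g where g: "g \<in> tate_algebra (Suc r)" "\<And>x. x \<in> fibre \<Longrightarrow> f x = g (tate_coords i x)" by blast
  have "(\<lambda>x. g (tate_coords i x)) \<in> uclosure"
    using assms by (intro uclosure_tate_compose[OF g(1)] tate_coords_polydisc tate_coords_uclosure)
  then show "f \<in> uclosure" by (rule uclosure_cong) (simp add: g(2))
qed (use uclosure_tate[OF assms] in blast)

text \<open>All factors of P have absolute value at most 1 on the polydisc, so a product of at least
  1 makes each of them equal to 1.\<close>

lemma coord_fibre_criterion:
  assumes z: "z \<in> polydisc r" and form_prod: "1 \<le> abs_val (form_prod z)"
  shows "z \<in> coord_fibre"
proof -
  have le: "abs_val (form a z / form_scale a) \<le> 1" if "a \<in> test_vecs" for a
    using abs_form_le[OF z, of a] abs_form_scale[OF test_vecs[OF that]] M_vsum_pos[OF test_vecs[OF that]]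
    by (simp add: abs_val_divide)
  have "abs_val (form a z) = M (vsum r e a)" if a: "a \<in> test_vecs" for a
  proof -
    have "1 \<le> abs_val (form a z / form_scale a) * abs_val (\<Prod>a\<in>test_vecs - {a}. form a z / form_scale a)"
      using form_prod unfolding form_prod_def by (simp only: prod.remove[OF finite_test_vecs a] abs_val_mult)
    also have "\<dots> \<le> abs_val (form a z / form_scale a) * 1"
    proof (rule mult_left_mono)
      show "abs_val (\<Prod>a\<in>test_vecs - {a}. form a z / form_scale a) \<le> 1"
        unfolding abs_val_prod by (rule prod_le_1) (use le in auto)
    qed simp
    finally have "abs_val (form a z / form_scale a) = 1" using le[OF a] by simp
    then show ?thesis
      using abs_form_scale[OF test_vecs[OF a]] M_vsum_pos[OF test_vecs[OF a]] by (simp add: abs_val_divide)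
  qed
  with z show ?thesis unfolding coord_fibre_def by blast
qed

lemma form_cong: "(\<And>j. j < r \<Longrightarrow> z j = w j) \<Longrightarrow> form a z = form a w"
  unfolding form_def by (intro sum.cong) auto

lemma form_prod_cong: "(\<And>j. j < r \<Longrightarrow> z j = w j) \<Longrightarrow> form_prod z = form_prod w"
  unfolding form_prod_def using form_cong[of z w] by simp

text \<open>In the polydisc of dimension r + 1 the fibre is cut out by two equations: one fixes the
  scaling of the representative, the other makes the last coordinate the inverse of P.\<close>

lemma affinoid_fibre: "affinoid fibre uclosure"
proof -
  let ?S = "{\<lambda>z. form (dual 0) z - chart_scale 0, \<lambda>z. z r * form_prod z - 1}"
  have 1: "?S \<subseteq> tate_algebra (Suc r)"
    by (auto intro!: polyfun_tate_algebra polyfun_diff polyfun_mult polyfun_coord polyfun_const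
        form_polyfun form_prod_polyfun)
  have 2: "uclosure = {f. \<exists>g\<in>tate_algebra (Suc r). \<forall>x\<in>fibre. f x = g (tate_coords 0 x)}"
    by (rule uclosure_eq_tate[OF r_pos])
  have form_tate_coords: "form a (tate_coords 0 x) = form a (chart_coords 0 x)" "form_prod
      (tate_coords 0 x) = form_prod (chart_coords 0 x)" for a x
    by (auto intro!: form_cong form_prod_cong simp: tate_coords_def)
  have 3: "inj_on (tate_coords 0) fibre"
  proof (rule inj_onI)
    fix x y assume *: "x \<in> fibre" "y \<in> fibre" "tate_coords 0 x = tate_coords 0 y"
    have "chart_coords 0 x = chart_coords 0 y"
    proof
      fix j
      show "chart_coords 0 x j = chart_coords 0 y j"
        using fun_cong[OF *(3), of j] coord_fibre_vec(1)[OF chart_coords(1)[OF *(1) r_pos]]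
            coord_fibre_vec(1)[OF chart_coords(1)[OF *(2) r_pos]]
        by (cases "j < r") (auto simp: tate_coords_def vec_def)
    qed
    then show "x = y" using chart_coords(2)[OF *(1) r_pos] chart_coords(2)[OF *(2) r_pos] by metis
  qed
  have 4: "tate_coords 0 ` fibre = {z \<in> polydisc (Suc r). \<forall>g\<in>?S. g z = 0}"
  proof (intro set_eqI iffI)
    fix z assume "z \<in> tate_coords 0 ` fibre"
    then obtain x where x: "x \<in> fibre" "z = tate_coords 0 x" by auto
    have "tate_coords 0 x r * form_prod (chart_coords 0 x) = 1" using form_prod_nonzero[OF
        chart_coords(1)[OF x(1) r_pos]] by (simp add: tate_coords_def)
    then show "z \<in> {z \<in> polydisc (Suc r). \<forall>g\<in>?S. g z = 0}"
      using tate_coords_polydisc[OF x(1) r_pos] chart_coords(3)[OF x(1) r_pos] x(2) by (simp add: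
          form_tate_coords)
  next
    fix z assume "z \<in> {z \<in> polydisc (Suc r). \<forall>g\<in>?S. g z = 0}"
    then have z: "z \<in> polydisc (Suc r)" "form (dual 0) z = chart_scale 0" "z r * form_prod z = 1" by auto
    define w where "w = (\<lambda>j. if j < r then z j else 0)"
    have w_eq: "form (dual 0) w = chart_scale 0" "form_prod w = form_prod z"
      using form_cong[of w z "dual 0"] form_prod_cong[of w z] z(2) by (auto simp: w_def)
    have w: "w \<in> polydisc r" using z(1) by (auto simp: w_def polydisc_def vec_def)
    \<comment> \<open>As |z_r| <= 1, the second equation forces |P| >= 1, and the criterion
      applies.\<close>
    have "1 = abs_val (z r) * abs_val (form_prod z)" using z(3) by (simp flip: abs_val_mult)
    also have "\<dots> \<le> 1 * abs_val (form_prod z)" using z(1) by (intro mult_right_mono) (auto simp: polydisc_def)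
    finally have "w \<in> coord_fibre" using w w_eq(2) by (intro coord_fibre_criterion) auto
    then have "chart_coords 0 (coord_point w) = w"
      using chart_coords_coord_point[OF _ r_pos] w_eq(1) chart_scale_nonzero[OF r_pos] by simp
    then have "tate_coords 0 (coord_point w) = z"
    proof -
      assume eq: "chart_coords 0 (coord_point w) = w"
      have "1 / form_prod z = z r" using z(3) by (metis div_by_1 divide_divide_eq_right
          mult_eq_0_iff nonzero_eq_divide_eq zero_neq_one)
      then show ?thesis using z(1) unfolding tate_coords_def eq w_eq(2)
        by (auto simp: fun_eq_iff w_def polydisc_def vec_def)
    qed
    then show "z \<in> tate_coords 0 ` fibre" using \<open>w \<in> coord_fibre\<close> unfolding fibre_coord_point by (metis imageI)
  qed
  show ?thesis
    unfolding affinoid_def using 1 2 3 4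
    by (intro exI[of _ "Suc r"] exI[of _ ?S] exI[of _ "tate_coords 0"] conjI bij_betw_imageI)
qed

text \<open>The case m = 0: there are no inequalities, and the only multi-index is 0, so each series
  is a single term. The empty family is filled by \<open>undefined\<close>.\<close>

lemma rational_subdomain_self: "rational_subdomain fibre uclosure fibre uclosure"
  unfolding rational_subdomain_def
proof (intro exI conjI)
  show "(\<lambda>_. 1) \<in> uclosure" by (rule uclosure_const)
  show "(\<lambda>_. 1) \<in> uclosure" by (rule uclosure_const)
  show "\<forall>x\<in>fibre. 1 * 1 + (\<Sum>j<0::nat. undefined j x * undefined j x) = (1::'c)" by simp
  have mi: "multi_indices 0 = {\<lambda>_. 0}" by (auto simp: multi_indices_def)
  show "uclosure = rational_algebra fibre uclosure fibre 0 (\<lambda>_. 1) undefined"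
    unfolding rational_algebra_def mi
  proof (intro set_eqI iffI)
    fix u assume u: "u \<in> uclosure"
    then show "u \<in> {u. \<exists>a. (\<forall>\<alpha>\<in>{\<lambda>_. 0}. a \<alpha> \<in> uclosure) \<and>
        (\<forall>\<epsilon>>0. finite {\<alpha> \<in> {\<lambda>_. 0}. \<exists>x\<in>fibre. \<epsilon> \<le> abs_val (a \<alpha> x)}) \<and>
        (\<forall>x\<in>fibre. ((\<lambda>\<alpha>. a \<alpha> x * (\<Prod>j<0::nat. (undefined j x / 1) ^ \<alpha> j)) has_sum u x) {\<lambda>_ :: nat. 0 :: nat})}"
      by (intro CollectI exI[of _ "\<lambda>_. u"]) (auto intro!: has_sum_finiteI)
  next
    fix u assume "u \<in> {u. \<exists>a. (\<forall>\<alpha>\<in>{\<lambda>_. 0}. a \<alpha> \<in> uclosure) \<and>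
        (\<forall>\<epsilon>>0. finite {\<alpha> \<in> {\<lambda>_. 0}. \<exists>x\<in>fibre. \<epsilon> \<le> abs_val (a \<alpha> x)}) \<and>
        (\<forall>x\<in>fibre. ((\<lambda>\<alpha>. a \<alpha> x * (\<Prod>j<0::nat. (undefined j x / 1) ^ \<alpha> j)) has_sum u x) {\<lambda>_ :: nat. 0 :: nat})}"
    then obtain a :: "(nat \<Rightarrow> nat) \<Rightarrow> (nat \<Rightarrow> 'c) set \<Rightarrow> 'c" where a: "a (\<lambda>_. 0) \<in> uclosure"
      "\<forall>x\<in>fibre. ((\<lambda>\<alpha>. a \<alpha> x) has_sum u x) {\<lambda>_ :: nat. 0 :: nat}" by auto
    have "a (\<lambda>_. 0) x = u x" if "x \<in> fibre" for x
    proof -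
      have "abs_val (u x - a (\<lambda>_. 0) x) \<le> \<epsilon>" if "\<epsilon> > 0" for \<epsilon>
        using has_sum_approx[OF bspec[OF a(2) \<open>x \<in> fibre\<close>], of "{\<lambda>_. 0}" \<epsilon>] that by simp
      then have "abs_val (u x - a (\<lambda>_. 0) x) \<le> 0" by (rule dense_ge)
      then show ?thesis by (metis abs_val_pos_iff eq_iff_diff_eq_0 not_less)
    qed
    then show "u \<in> uclosure" using uclosure_cong[OF a(1)] by blast
  qed
qed auto

end

section \<open>The fibre in the charts of projective space\<close>

context building_fibre
begin

lemma chart_rep_chart: "i < r \<Longrightarrow> \<omega> i = 1 \<Longrightarrow> chart_rep i (proj_point \<omega>) = (\<lambda>j. chart_scale i * \<omega> j)"
  using chart_rep_proj_point[of i \<omega>] by simp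

lemma chart_coords_chart: "i < r \<Longrightarrow> \<omega> i = 1 \<Longrightarrow> chart_coords i (proj_point \<omega>) = (\<lambda>j. chart_scale i * coords \<omega> j)"
  unfolding chart_coords_def by (simp add: chart_rep_chart coords_scale)

lemma lin_form_polyfun: "lin_form v \<in> polyfun r"
  unfolding lin_form_def[abs_def] by (intro polyfun_intros) auto

lemma form_prod_chart: "i < r \<Longrightarrow> \<omega> i = 1 \<Longrightarrow>
  form_prod (chart_coords i (proj_point \<omega>)) = (\<Prod>a\<in>test_vecs. chart_scale i * lin_form (vsum r e a) \<omega>
      * inverse (form_scale a))"
  by (simp add: chart_coords_chart form_prod_def form_scale form_coords divide_inverse)

lemma polyfun_chart_algebra:
  assumes "g \<in> polyfun r" "\<And>\<omega>. \<omega> i = 1 \<Longrightarrow> f (proj_point \<omega>) = g \<omega>"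
  shows "f \<in> proj_chart_algebra r i"
  using polyfun_tate_algebra[OF assms(1)] assms(2) unfolding proj_chart_algebra_def by blast

lemma form_prod_chart_algebra: "i < r \<Longrightarrow> (\<lambda>x. form_prod (chart_coords i x)) \<in> proj_chart_algebra r i"
  by (rule polyfun_chart_algebra[where g = "\<lambda>\<omega>. \<Prod>a\<in>test_vecs. chart_scale i * lin_form (vsum r e a)
      \<omega> * inverse (form_scale a)"])
    (auto intro!: polyfun_intros lin_form_polyfun simp: form_prod_chart)

lemma form_prod_chart_coords_chart_algebra:
  assumes "i < r" "j < r"
  shows "(\<lambda>x. form_prod (chart_coords i x) * chart_coords i x j) \<in> proj_chart_algebra r i"
proof (rule polyfun_chart_algebra)
  let ?g = "\<lambda>\<omega>. (\<Prod>a\<in>test_vecs. chart_scale i * lin_form (vsum r e a) \<omega> * inverse (form_scale a)) *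
      (chart_scale i * (lin_form (e j) \<omega> * inverse (\<kappa> j)))"
  show "?g \<in> polyfun r" by (intro polyfun_intros lin_form_polyfun)
  show "form_prod (chart_coords i (proj_point \<omega>)) * chart_coords i (proj_point \<omega>) j = ?g \<omega>" if "\<omega> i = 1" for \<omega>
  proof (rule arg_cong2[of _ _ _ _ "(*)"])
    show "form_prod (chart_coords i (proj_point \<omega>)) = (\<Prod>a\<in>test_vecs. chart_scale i * lin_form (vsum
        r e a) \<omega> * inverse (form_scale a))"
      using assms(1) that by (rule form_prod_chart)
    show "chart_coords i (proj_point \<omega>) j = chart_scale i * (lin_form (e j) \<omega> * inverse (\<kappa> j))"
      using that assms by (simp add: chart_coords_chart coords_def divide_inverse)
  qed
qed

lemma const_chart_algebra: "(\<lambda>_. c) \<in> proj_chart_algebra r i"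
  by (rule polyfun_chart_algebra[of "\<lambda>_. c"]) (auto intro: polyfun_const)

text \<open>On \<open>fibre_cone\<close> the j-th coordinate has the constant absolute value
  \<open>M (unit_vec j)\<close>, so these i are the charts that contain the fibre.\<close>

definition maximal_coord :: "nat \<Rightarrow> bool" where
  "maximal_coord i \<longleftrightarrow> i < r \<and> (\<forall>j<r. M (unit_vec j) \<le> M (unit_vec i))"

lemma fibre_chart_point:
  assumes x: "x \<in> fibre" and i: "maximal_coord i"
  defines "\<omega> \<equiv> \<lambda>j. inverse (chart_scale i) * from_coords (chart_coords i x) j"
  shows "\<omega> \<in> polydisc r" "\<omega> i = 1" "x = proj_point \<omega>"
proof -
  have ir: "i < r" using i unfolding maximal_coord_def by simp
  note z = chart_coords[OF x ir]
  show "\<omega> i = 1" unfolding \<omega>_def from_coords_coord[OF ir] z(3) using chart_scale_nonzero[OF ir] by simp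
  have "abs_val (\<omega> j) \<le> 1" if j: "j < r" for j
  proof -
    have "abs_val (\<omega> j) = M (unit_vec j) / M (unit_vec i)"
      unfolding \<omega>_def from_coords_coord[OF j] abs_val_mult abs_val_inverse abs_form_dual[OF z(1) j]
          abs_chart_scale[OF ir]
      by (simp add: divide_inverse)
    moreover have "M (unit_vec i) > 0" using abs_chart_scale[OF ir] chart_scale_nonzero[OF ir] by
        (metis abs_val_pos_iff)
    ultimately show ?thesis using i j unfolding maximal_coord_def by simp
  qed
  then show "\<omega> \<in> polydisc r" by (auto simp: polydisc_def vec_def \<omega>_def from_coords_def)
  have "proj_point \<omega> = coord_point (chart_coords i x)"
    unfolding \<omega>_def coord_point_def using chart_scale_nonzero[OF ir] by (intro proj_point_scale) simp
  then show "x = proj_point \<omega>" using z(2) by simp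
qed

lemma chart_algebra_uclosure:
  assumes f: "f \<in> proj_chart_algebra r i" and i: "maximal_coord i"
  shows "f \<in> uclosure"
proof -
  have ir: "i < r" using i unfolding maximal_coord_def by simp
  let ?\<Omega> = "\<lambda>x j. inverse (chart_scale i) * from_coords (chart_coords i x) j"
  obtain g where g: "g \<in> tate_algebra r"
    "\<And>\<omega>. \<omega> \<in> polydisc r \<Longrightarrow> \<omega> i = 1 \<Longrightarrow> f (proj_point \<omega>) = g \<omega>"
    using f unfolding proj_chart_algebra_def by blast
  have "(\<lambda>x. g (?\<Omega> x)) \<in> uclosure"
  proof (rule uclosure_tate_compose[OF g(1)])
    show "?\<Omega> x \<in> polydisc r" if "x \<in> fibre" for x by (rule fibre_chart_point(1)[OF that i])
    show "(\<lambda>x. ?\<Omega> x j) \<in> uclosure" if "j < r" for j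
      unfolding from_coords_coord[OF that] form_def
      by (intro uclosure_mult uclosure_const uclosure_sum H_uclosure chart_coords_fractions ir) auto
  qed
  then show ?thesis
    by (rule uclosure_cong) (metis fibre_chart_point[OF _ i] g(2))
qed

text \<open>The conditions |z_j| <= 1 and |P| >= 1 are brought to the common denominator h = P, with
  f_j = P z_j for j < r and f_r = 1; the latter generates the unit ideal. The quotients f_j / h are
  then the \<open>tate_coords\<close>, so Tate series are rational series with constant
  coefficients.\<close>

lemma rational_subdomain_chart:
  assumes i: "maximal_coord i"
  shows "rational_subdomain (proj_chart r i) (proj_chart_algebra r i) fibre uclosure"
proof -
  have ir: "i < r" using i unfolding maximal_coord_def by simp
  define h where "h = (\<lambda>x. form_prod (chart_coords i x))"
  define f where "f = (\<lambda>j x. if j < r then form_prod (chart_coords i x) * chart_coords i x j else 1)"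
  have h: "h \<in> proj_chart_algebra r i" unfolding h_def by (rule form_prod_chart_algebra[OF ir])
  have f: "f j \<in> proj_chart_algebra r i" for j
    unfolding f_def using form_prod_chart_coords_chart_algebra[OF ir] const_chart_algebra by (cases
        "j < r") auto
  have unit: "\<forall>x\<in>proj_chart r i. 0 * h x + (\<Sum>j<Suc r. (if j = r then 1 else 0) * f j x) = 1"
    by (simp add: f_def)
  have R: "fibre = {x \<in> proj_chart r i. \<forall>j<Suc r. abs_val (f j x) \<le> abs_val (h x)}"
  proof (intro subset_antisym subsetI)
    fix x assume x: "x \<in> fibre"
    have "x \<in> proj_chart r i" unfolding proj_chart_def using fibre_chart_point[OF x i] by blast
    moreover have "abs_val (f j x) \<le> abs_val (h x)" for j
      using abs_form_prod[OF chart_coords(1)[OF x ir]] coord_fibre_vec(2)[OF chart_coords(1)[OF x ir]]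
      by (auto simp: f_def h_def abs_val_mult polydisc_def)
    ultimately show "x \<in> {x \<in> proj_chart r i. \<forall>j<Suc r. abs_val (f j x) \<le> abs_val (h x)}" by blast
  next
    fix x assume "x \<in> {x \<in> proj_chart r i. \<forall>j<Suc r. abs_val (f j x) \<le> abs_val (h x)}"
    then have xc: "x \<in> proj_chart r i" and le: "\<And>j. j < Suc r \<Longrightarrow> abs_val (f j x) \<le> abs_val (h x)" by auto
    obtain \<omega> where \<omega>: "x = proj_point \<omega>" "\<omega> \<in> polydisc r" "\<omega> i = 1" using xc unfolding proj_chart_def by auto
    let ?z = "chart_coords i x"
    have z_eq: "?z = (\<lambda>j. chart_scale i * coords \<omega> j)" unfolding \<omega>(1) using ir \<omega>(3) by (rule chart_coords_chart)
    have PP1: "1 \<le> abs_val (form_prod ?z)" using le[of r] by (simp add: f_def h_def)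
    have "abs_val (?z j) \<le> 1" if "j < r" for j
    proof -
      have "abs_val (form_prod ?z) * abs_val (?z j) \<le> abs_val (form_prod ?z) * 1"
        using le[of j] that by (simp add: f_def h_def abs_val_mult)
      moreover have "0 < abs_val (form_prod ?z)" using PP1 by linarith
      ultimately show ?thesis by (rule mult_left_le_imp_le)
    qed
    moreover have "?z \<in> vec r" unfolding z_eq by (auto simp: coords_def vec_def)
    ultimately have "?z \<in> coord_fibre" using PP1 by (intro coord_fibre_criterion) (auto simp: polydisc_def)
    moreover have "coord_point ?z = x"
    proof -
      have "from_coords ?z = (\<lambda>j. chart_scale i * \<omega> j)"
        unfolding z_eq from_coords_scale using from_coords_coords[of \<omega>] \<omega>(2) by (simp add: polydisc_def)
      then show ?thesis unfolding coord_point_def \<omega>(1) using proj_point_scale[OF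
          chart_scale_nonzero[OF ir]] \<omega>(1) by metis
    qed
    ultimately show "x \<in> fibre" unfolding fibre_coord_point by (metis imageI)
  qed
  have quot: "f j x / h x = tate_coords i x j" if "x \<in> fibre" "j < Suc r" for j x
    using that form_prod_nonzero[OF chart_coords(1)[OF that(1) ir]] by (auto simp: f_def h_def tate_coords_def)
  have term_eq: "(\<Prod>j<Suc r. (f j x / h x) ^ \<alpha> j) = mpow (Suc r) (tate_coords i x) \<alpha>" if "x \<in> fibre" for x \<alpha>
    using quot[OF that] by (intro prod.cong) auto
  have B: "uclosure = rational_algebra (proj_chart r i) (proj_chart_algebra r i) fibre (Suc r) h f"
  proof (intro subset_antisym subsetI)
    fix u assume "u \<in> uclosure"
    then obtain g where g: "g \<in> tate_algebra (Suc r)" "\<And>x. x \<in> fibre \<Longrightarrow> u x = g (tate_coords i x)"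
      using uclosure_tate[OF ir] by blast
    obtain a where a: "\<And>\<epsilon>. \<epsilon> > 0 \<Longrightarrow> finite {\<alpha> \<in> multi_indices (Suc r). abs_val (a \<alpha>) \<ge> \<epsilon>}"
      "\<And>z. z \<in> polydisc (Suc r) \<Longrightarrow> ((\<lambda>\<alpha>. a \<alpha> * mpow (Suc r) z \<alpha>) has_sum g z) (multi_indices (Suc r))"
      using g(1) unfolding tate_algebra_def by auto
    show "u \<in> rational_algebra (proj_chart r i) (proj_chart_algebra r i) fibre (Suc r) h f"
      unfolding rational_algebra_def
    proof (intro CollectI exI[of _ "\<lambda>\<alpha> _. a \<alpha>"] conjI ballI allI impI)
      show "(\<lambda>_. a \<alpha>) \<in> proj_chart_algebra r i" for \<alpha> by (rule const_chart_algebra)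
      show "finite {\<alpha> \<in> multi_indices (Suc r). \<exists>x\<in>proj_chart r i. \<epsilon> \<le> abs_val (a \<alpha>)}" if "\<epsilon> > 0" for \<epsilon>
        by (rule finite_subset[OF _ a(1)[OF that]]) auto
      show "((\<lambda>\<alpha>. a \<alpha> * (\<Prod>j<Suc r. (f j x / h x) ^ \<alpha> j)) has_sum u x) (multi_indices (Suc r))"
        if x: "x \<in> fibre" for x
        unfolding term_eq[OF x] g(2)[OF x] by (rule a(2)[OF tate_coords_polydisc[OF x ir]])
    qed
  next
    fix u assume "u \<in> rational_algebra (proj_chart r i) (proj_chart_algebra r i) fibre (Suc r) h f"
    then obtain a where a: "\<And>\<alpha>. \<alpha> \<in> multi_indices (Suc r) \<Longrightarrow> a \<alpha> \<in> proj_chart_algebra r i"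
      and fin: "\<And>\<epsilon>. \<epsilon> > 0 \<Longrightarrow> finite {\<alpha> \<in> multi_indices (Suc r). \<exists>x\<in>proj_chart r i. abs_val (a \<alpha> x) \<ge> \<epsilon>}"
      and sum: "\<And>x. x \<in> fibre \<Longrightarrow> ((\<lambda>\<alpha>. a \<alpha> x * (\<Prod>j<Suc r. (f j x / h x) ^ \<alpha> j)) has_sum u x)
          (multi_indices (Suc r))"
      unfolding rational_algebra_def by blast
    show "u \<in> uclosure"
    proof (rule uclosure_series[of "Suc r" a "\<lambda>j x. tate_coords i x j"])
      show "a \<alpha> \<in> uclosure" if "\<alpha> \<in> multi_indices (Suc r)" for \<alpha>
        by (rule chart_algebra_uclosure[OF a[OF that] i])
      show "finite {\<alpha> \<in> multi_indices (Suc r). \<exists>x\<in>fibre. \<epsilon> \<le> abs_val (a \<alpha> x)}" if "\<epsilon> > 0" for \<epsilon>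
        by (rule finite_subset[OF _ fin[OF that]]) (use R in blast)
      show "(\<lambda>x. tate_coords i x j) \<in> uclosure" if "j < Suc r" for j by (rule tate_coords_uclosure[OF ir that])
      show "abs_val (tate_coords i x j) \<le> 1" if "j < Suc r" "x \<in> fibre" for j x
        using tate_coords_polydisc[OF that(2) ir] that(1) by (simp add: polydisc_def)
      show "((\<lambda>\<alpha>. a \<alpha> x * mpow (Suc r) (tate_coords i x) \<alpha>) has_sum u x) (multi_indices (Suc r))"
        if x: "x \<in> fibre" for x
        using sum[OF x] unfolding term_eq[OF x] .
    qed
  qed
  have "\<exists>u c. u \<in> proj_chart_algebra r i \<and> (\<forall>j<Suc r. c j \<in> proj_chart_algebra r i) \<and>
      (\<forall>x\<in>proj_chart r i. u x * h x + (\<Sum>j<Suc r. c j x * f j x) = 1)"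
    using unit const_chart_algebra
    by (intro exI[of _ "\<lambda>_. 0"] exI[of _ "\<lambda>j _. if j = r then 1 else 0"]) blast
  then show ?thesis
    unfolding rational_subdomain_def using h f R B
    by (intro exI[of _ "Suc r"] exI[of _ h] exI[of _ f]) blast
qed

text \<open>The chart demands |\<omega>_j| <= |\<omega>_i|, but on the fibre this ratio is constant,
  and above 1 for some j.\<close>

lemma fibre_disjoint_chart:
  assumes "i < r" "\<not> maximal_coord i"
  shows "fibre \<inter> proj_chart r i = {}"
proof (rule ccontr)
  assume "fibre \<inter> proj_chart r i \<noteq> {}"
  then obtain \<omega> \<xi> where *: "\<omega> \<in> polydisc r" "\<omega> i = 1" "\<xi> \<in> fibre_cone" "proj_point \<xi> = proj_point \<omega>"
    unfolding fibre_def proj_chart_def by blast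
  obtain j where j: "j < r" "M (unit_vec i) < M (unit_vec j)"
    using assms unfolding maximal_coord_def by force
  obtain c where c: "\<xi> = (\<lambda>j. c * \<omega> j)"
    using proj_point_self[of \<xi>] *(4) unfolding proj_point_def by auto
  have abs_\<xi>: "abs_val (\<xi> k) = M (unit_vec k)" if "k < r" for k
    using *(3) unit_vec_vec[OF that] lin_form_unit_vec[OF that, of \<xi>] unfolding fibre_cone_def by auto
  have "abs_val (\<xi> j) \<le> abs_val c * 1"
    unfolding c abs_val_mult using *(1) j(1) by (intro mult_left_mono) (auto simp: polydisc_def)
  also have "\<dots> = abs_val (\<xi> i)" unfolding c using *(2) by simp
  finally show False using abs_\<xi>[OF j(1)] abs_\<xi>[OF assms(1)] j(2) by simp
qed

lemma ex_maximal_coord: "\<exists>i. maximal_coord i"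
proof -
  let ?S = "(\<lambda>j. M (unit_vec j)) ` {..<r}"
  have S: "finite ?S" "?S \<noteq> {}" using r_pos by auto
  obtain i where "i < r" "Max ?S = M (unit_vec i)" using Max_in[OF S] by auto
  then show ?thesis unfolding maximal_coord_def using Max_ge[OF S(1)] by (intro exI[of _ i]) fastforce
qed

lemma open_affinoid_fibre: "open_affinoid_subspace (proj_atlas r) fibre"
proof -
  obtain i where i: "maximal_coord i" using ex_maximal_coord by blast
  then have "proj_chart r i \<in> fst ` proj_atlas r"
    unfolding proj_atlas_def maximal_coord_def by force
  moreover have "fibre \<subseteq> proj_chart r i"
    using rational_subdomain_chart[OF i] unfolding rational_subdomain_def by blast
  ultimately have "fibre \<subseteq> \<Union> (fst ` proj_atlas r)" by blast
  moreover have "case p of (X, A') \<Rightarrow> \<exists>\<R>. finite \<R> \<and> \<Union> \<R> = fibre \<inter> X \<and>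
      (\<forall>R\<in>\<R>. \<exists>B. rational_subdomain fibre uclosure R B \<and> rational_subdomain X A' R B)"
    if "p \<in> proj_atlas r" for p
  proof -
    obtain i where i: "i < r" "p = (proj_chart r i, proj_chart_algebra r i)"
      using \<open>p \<in> proj_atlas r\<close> unfolding proj_atlas_def by auto
    let ?X = "proj_chart r i" and ?A' = "proj_chart_algebra r i"
    have "\<exists>\<R>. finite \<R> \<and> \<Union> \<R> = fibre \<inter> ?X \<and>
      (\<forall>R\<in>\<R>. \<exists>B. rational_subdomain fibre uclosure R B \<and> rational_subdomain ?X ?A' R B)"
    proof (cases "maximal_coord i")
      case True
      then have R: "rational_subdomain ?X ?A' fibre uclosure" by (rule rational_subdomain_chart)
      then have "fibre \<inter> ?X = fibre" unfolding rational_subdomain_def by blast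
      with R show ?thesis using rational_subdomain_self by (intro exI[of _ "{fibre}"]) auto
    next
      case False
      then show ?thesis using fibre_disjoint_chart[OF i(1)] by (intro exI[of _ "{}"]) auto
    qed
    then show ?thesis using i(2) by simp
  qed
  ultimately show ?thesis
    unfolding open_affinoid_subspace_def using affinoid_fibre by blast
qed

text \<open>The whole fibre is a rational subdomain of a single chart, so the definition of a
  section applies with R the fibre itself.\<close>

lemma holomorphic_uclosure: "f \<in> holomorphic_functions (proj_atlas r) fibre \<Longrightarrow> f \<in> uclosure"
proof -
  assume f: "f \<in> holomorphic_functions (proj_atlas r) fibre"
  obtain i where i: "maximal_coord i" using ex_maximal_coord by blast
  then have "(proj_chart r i, proj_chart_algebra r i) \<in> proj_atlas r"
    unfolding proj_atlas_def maximal_coord_def by blast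
  then show ?thesis
    using f rational_subdomain_chart[OF i] unfolding holomorphic_functions_def by blast
qed

lemma absolute_value_property_fibre: "absolute_value_property (proj_atlas r) fibre"
  unfolding absolute_value_property_def
proof (intro ballI impI)
  fix f assume f: "f \<in> holomorphic_functions (proj_atlas r) fibre"
    and "\<exists>g\<in>holomorphic_functions (proj_atlas r) fibre. \<forall>x\<in>fibre. f x * g x = 1"
  then obtain g where g: "g \<in> holomorphic_functions (proj_atlas r) fibre" "\<And>x. x \<in> fibre \<Longrightarrow> f x * g x = 1"
    by blast
  have "abs_val (f x) = abs_val (f y)" if "x \<in> fibre" "y \<in> fibre" for x y
    using unit_abs_le[OF holomorphic_uclosure[OF f] holomorphic_uclosure[OF g(1)] g(2)] that
    by (intro antisym) auto
  then show "\<exists>c. \<forall>x\<in>fibre. abs_val (f x) = c"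
    by (cases "fibre = {}") blast+
qed

section \<open>Comparison with the building map\<close>

lemma building_map_proj_point:
  "building_map \<iota> r (proj_point \<omega>) = homothety_class r (\<lambda>v. abs_val (lin_form v \<omega>))"
proof -
  have eq: "homothety_class r (\<lambda>v. abs_val (lin_form v \<xi>)) = homothety_class r (\<lambda>v. abs_val (lin_form v \<omega>))"
    if \<xi>: "\<xi> \<in> proj_point \<omega>" for \<xi>
  proof -
    obtain c where "c \<noteq> 0" "\<xi> = (\<lambda>i. c * \<omega> i)" using \<xi> unfolding proj_point_def by auto
    then show ?thesis by (intro homothety_class_eqI[of "abs_val c"]) (auto simp: lin_form_scale abs_val_mult)
  qed
  have "building_map \<iota> r (proj_point \<omega>) =
      (\<Union>\<xi>\<in>proj_point \<omega>. homothety_class r (\<lambda>v. abs_val (lin_form v \<omega>)))"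
    unfolding building_map_def lin_form_def[symmetric] using eq by (rule SUP_cong[OF refl])
  also have "\<dots> = homothety_class r (\<lambda>v. abs_val (lin_form v \<omega>))"
    using proj_point_self[of \<omega>] by blast
  finally show ?thesis .
qed

lemma fibre_cone_Omega: "\<omega> \<in> fibre_cone \<Longrightarrow> proj_point \<omega> \<in> Omega \<iota> r"
  unfolding Omega_def lin_form_def[symmetric]
proof (intro CollectI exI[of _ \<omega>] conjI ballI impI)
  fix v assume "\<omega> \<in> fibre_cone" "v \<in> vec r" "lin_form v \<omega> = 0"
  then show "v = (\<lambda>_. 0)" using Md(2)[of v] unfolding fibre_cone_def by (metis (mono_tags, lifting)
      abs_val_0 mem_Collect_eq)
qed (auto simp: fibre_cone_def)

lemma fibre_eq: "{P \<in> Omega \<iota> r. building_map \<iota> r P = homothety_class r M} = fibre"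
proof (intro subset_antisym subsetI)
  fix P assume "P \<in> {P \<in> Omega \<iota> r. building_map \<iota> r P = homothety_class r M}"
  then obtain \<omega> where P: "P = proj_point \<omega>" "\<omega> \<in> vec r"
    and "homothety_class r (\<lambda>v. abs_val (lin_form v \<omega>)) = homothety_class r M"
    unfolding Omega_def by (auto simp: building_map_proj_point)
  then have "(\<lambda>v. abs_val (lin_form v \<omega>)) \<in> homothety_class r M" using homothety_class_self by metis
  then obtain c where c: "c > 0" "\<And>v. v \<in> vec r \<Longrightarrow> abs_val (lin_form v \<omega>) = c * M v"
    unfolding homothety_class_def by auto
  \<comment> \<open>Rescaling by d turns the norm c M into M. It requires an element of absolute
    value 1 / c, and comparing both norms at e_0 yields one.\<close>
  define d where "d = \<kappa> 0 / lin_form (e 0) \<omega>"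
  have M0: "M (e 0) > 0" using e_ge[OF r_pos] by simp
  have lin0: "abs_val (lin_form (e 0) \<omega>) = c * M (e 0)" using c(2) e_vec[OF r_pos] by simp
  have d: "abs_val d = 1 / c"
    unfolding d_def using M0 c(1) by (simp add: abs_val_divide abs_\<kappa> r_pos lin0)
  then have "d \<noteq> 0" using c(1) by auto
  moreover have "(\<lambda>i. d * \<omega> i) \<in> fibre_cone"
    unfolding fibre_cone_def using P(2) c d by (auto simp: lin_form_scale abs_val_mult vec_def)
  ultimately show "P \<in> fibre"
    unfolding fibre_def P(1) using proj_point_scale[of d \<omega>] by (metis imageI)
next
  fix P assume "P \<in> fibre"
  then obtain \<omega> where \<omega>: "\<omega> \<in> fibre_cone" "P = proj_point \<omega>" unfolding fibre_def by auto
  have "homothety_class r (\<lambda>v. abs_val (lin_form v \<omega>)) = homothety_class r M"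
    using \<omega>(1) by (intro homothety_class_eqI[of 1]) (auto simp: fibre_cone_def)
  then show "P \<in> {P \<in> Omega \<iota> r. building_map \<iota> r P = homothety_class r M}"
    using fibre_cone_Omega[OF \<omega>(1)] unfolding \<omega>(2) by (simp add: building_map_proj_point)
qed

end

theorem theorem2p4:
  fixes \<iota> :: "'k::{field,finite} fls \<Rightarrow> 'c::nonarch_field"
    and r :: nat
    and x :: "((nat \<Rightarrow> 'k fls) \<Rightarrow> real) set"
  assumes "completed_algebraic_closure \<iota>"
    and "r \<ge> 2"
    and "x \<in> BT_rat r"
  shows "open_affinoid_subspace_of_Omega \<iota> r {P \<in> Omega \<iota> r. building_map \<iota> r P = x} \<and>
         absolute_value_property (proj_atlas r) {P \<in> Omega \<iota> r. building_map \<iota> r P = x}"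
proof -
  interpret complete_closure \<iota> "real CARD('k)"
    using assms(1) by unfold_locales auto
  obtain M :: "(nat \<Rightarrow> 'k fls) \<Rightarrow> real" and D C where normM: "nonarch_norm r M" and x_eq: "x =
      homothety_class r M"
    and D: "D > 0" and C: "C > 0"
    and vals: "\<And>v. v \<in> vec r \<Longrightarrow> v \<noteq> (\<lambda>_. 0) \<Longrightarrow> \<exists>n::int. M v = real CARD('k) powr (n / real D)"
    and lower: "\<And>v i. v \<in> vec r \<Longrightarrow> C * abs_inf (v i) \<le> M v"
    using BT_rat_norm[OF assms(3)] by blast
  obtain e where e: "\<And>j. j < r \<Longrightarrow> e j \<in> vec r" "\<And>j. j < r \<Longrightarrow> 1 \<le> M (e j)"
    "\<And>j. j < r \<Longrightarrow> M (e j) < real CARD('k)"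
    and span: "\<And>v. v \<in> vec r \<Longrightarrow> \<exists>a\<in>vec r. v = vsum r e a"
    and orth: "\<And>a j. j < r \<Longrightarrow> abs_inf (a j) * M (e j) \<le> M (vsum r e a)"
    using orthogonal_basis[OF normM D C vals lower] by blast
  \<comment> \<open>M(e_j) is a rational power of q and hence the absolute value of a root of a
    power of T.\<close>
  have "\<exists>\<kappa>::'c. abs_val \<kappa> = M (e j)" if j: "j < r" for j
  proof -
    have "e j \<noteq> (\<lambda>_. 0)" using nonarch_normD(2)[OF normM e(1)[OF j]] e(2)[OF j] by auto
    then obtain n :: int where "M (e j) = real CARD('k) powr (n / real D)" using vals e(1)[OF j] by blast
    then show ?thesis using ex_abs_val[OF D, of n] by metis
  qed
  then obtain \<kappa> :: "nat \<Rightarrow> 'c" where \<kappa>: "\<And>j. j < r \<Longrightarrow> abs_val (\<kappa> j) = M (e j)" by metis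
  interpret building_fibre \<iota> "real CARD('k)" r M e \<kappa>
    using assms(2) normM e span orth \<kappa> by unfold_locales auto
  have "{P \<in> Omega \<iota> r. building_map \<iota> r P = x} = fibre" unfolding x_eq by (rule fibre_eq)
  moreover have "fibre \<subseteq> Omega \<iota> r" using fibre_eq by blast
  ultimately show ?thesis
    using open_affinoid_fibre absolute_value_property_fibre
    unfolding open_affinoid_subspace_of_Omega_def by simp
qed

end
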